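(* Let $W$ be a finite Weyl group with length function $\ell$, and let $H$ be a parabolic subgroup of $W$ which is isomorphic to a direct product of symmetric groups. Let $\mu$ be the cycle type of an element of $H$, let $v_\mu\in H$ be an element of cycle type $\mu$, and for $k\ge 0$ let $\chi^k$ be the character of the natural $W$-action on the $k$-th homogeneous component $R^k$ of the coinvariant algebra of $W$. Then $$\chi^k(v_\mu)=\sum_{\{w\in W:\ \ell(w)=k\}} \mathrm{weight}_\mu(w).$$
   Context: $W$ is generated by its simple reflections $s_i$, and $\ell$ is the corresponding length function. Let $V$ be the vector space (over a field of characteristic $0$, e.g. $\mathbb{R}$) spanned by the root system of $W$, with its natural $W$-action. The coinvariant algebra of $W$ is $\mathrm{Sym}(V)/I$, where $I$ is the ideal generated by the $W$-invariants of positive degree; it is graded by polynomial degree and $W$ acts on each homogeneous component $R^k$. A parabolic subgroup is a subgroup generated by a subset of the simple reflections of $W$. $H$ is identified with a direct product of symmetric groups $S_{n_1}\times\cdots\times S_{n_r}$ by the natural isomorphism under which the simple reflections of $H$ (adjacent transpositions in the factors) correspond to simple reflections of $W$. Cycle type and weight of elements of $H$ are taken under this identification: the cycle type $\mu$ of an element of $H$ is the collection $(\mu^{(1)},\dots,\mu^{(r)})$, where $\mu^{(j)}$ is a partition of $n_j$, namely the cycle type of the component in $S_{n_j}$. Definition of $m$: permutations are multiplied as functions (composition), $(\pi\sigma)(i)=\pi(\sigma(i))$. For $\pi\in S_n$ set $m(\pi):=(-1)^m$ if there exists $0\le m<n$ such that $\pi(1)>\pi(2)>\cdots>\pi(m+1)<\cdots<\pi(n)$,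 and $m(\pi):=0$ otherwise. Definition of the weight on $S_n$: for a partition $\mu=(\mu_1,\dots,\mu_t)$ of $n$, let $S_\mu=S_{\mu_1}\times\cdots\times S_{\mu_t}$ be the corresponding Young subgroup of $S_n$ (permuting separately the consecutive blocks of sizes $\mu_1,\dots,\mu_t$). Every $\pi\in S_n$ can be written uniquely as $\pi=r\cdot(\pi_1\times\cdots\times\pi_t)$ with $\pi_i\in S_{\mu_i}$ and $r$ the representative of minimal length of the left coset $\pi S_\mu$. Set $\mathrm{weight}_\mu(\pi):=\prod_{i=1}^t m(\pi_i)$, with $m(\pi_i)$ computed in $S_{\mu_i}$. Definition of the weight on $H$: for $\pi=(\pi^{(1)},\dots,\pi^{(r)})\in H= S_{n_1}\times\cdots\times S_{n_r}$ and $\mu=(\mu^{(1)},\dots,\mu^{(r)})$, set $\mathrm{weight}_\mu(\pi):=\prod_{j=1}^r\mathrm{weight}_{\mu^{(j)}}(\pi^{(j)})$. Definition of the weight on $W$: for $w\in W$, write $w=r\cdot\pi$ with $\pi\in H$ and $r$ the representative of minimal length of the left coset $wH$; set $\mathrm{weight}_\mu(w):=\mathrm{weight}_\mu(\pi)$. *)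

theory Defs
  imports
    "HOL-Analysis.Analysis"
    "HOL-Algebra.Sym_Groups"
    "HOL-Algebra.Product_Groups"
    "HOL-Combinatorics.Orbits"
    "HOL-Library.Function_Algebras"
    "HOL-Library.Multiset"
begin

(* Pointwise scalar multiplication, so that "span" is available for real-valued functions. *)
instantiation "fun" :: (type, real_vector) real_vector
begin

definition scaleR_fun :: "real \<Rightarrow> ('a \<Rightarrow> 'b) \<Rightarrow> 'a \<Rightarrow> 'b" where
  "scaleR_fun c f = (\<lambda>x. c *\<^sub>R f x)"

instance
  by standard (auto simp: scaleR_fun_def plus_fun_def fun_eq_iff algebra_simps)

end


section \<open>Groups of functions generated by involutions\<close>

definition prod_fun :: "('a \<Rightarrow> 'a) list \<Rightarrow> 'a \<Rightarrow> 'a" where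
  "prod_fun fs = foldr (\<circ>) fs id"

(* Only used for sets S of involutions, where closing under inverses is not needed. *)
definition generated_group :: "('a \<Rightarrow> 'a) set \<Rightarrow> ('a \<Rightarrow> 'a) set" where
  "generated_group S = {prod_fun fs | fs. set fs \<subseteq> S}"

definition word_length :: "('a \<Rightarrow> 'a) set \<Rightarrow> ('a \<Rightarrow> 'a) \<Rightarrow> nat" where
  "word_length S w = (LEAST k. \<exists>fs. length fs = k \<and> set fs \<subseteq> S \<and> w = prod_fun fs)"

definition comp_group :: "('a \<Rightarrow> 'a) set \<Rightarrow> ('a \<Rightarrow> 'a) monoid" where
  "comp_group K = \<lparr>carrier = K, mult = (\<circ>), one = id\<rparr>"

definition min_coset_rep :: "(('a \<Rightarrow> 'a) \<Rightarrow> nat) \<Rightarrow> ('a \<Rightarrow> 'a) set \<Rightarrow> ('a \<Rightarrow> 'a) \<Rightarrow> 'a \<Rightarrow> 'a" where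
  "min_coset_rep len K g = (ARG_MIN len x. x \<in> (\<lambda>h. g \<circ> h) ` K)"

(* The factor h in the decomposition g = r h, r the shortest element of gK. *)
definition subgroup_part :: "(('a \<Rightarrow> 'a) \<Rightarrow> nat) \<Rightarrow> ('a \<Rightarrow> 'a) set \<Rightarrow> ('a \<Rightarrow> 'a) \<Rightarrow> 'a \<Rightarrow> 'a" where
  "subgroup_part len K g = inv' (min_coset_rep len K g) \<circ> g"


section \<open>Root systems and Weyl groups\<close>

definition reflection :: "'a::euclidean_space \<Rightarrow> 'a \<Rightarrow> 'a" where
  "reflection \<alpha> x = x - (2 * (x \<bullet> \<alpha>) / (\<alpha> \<bullet> \<alpha>)) *\<^sub>R \<alpha>"

(* The roots need not span the ambient space. *)
definition root_system :: "'a::euclidean_space set \<Rightarrow> bool" where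
  "root_system \<Phi> \<longleftrightarrow> finite \<Phi> \<and> 0 \<notin> \<Phi> \<and>
     (\<forall>\<alpha>\<in>\<Phi>. reflection \<alpha> ` \<Phi> = \<Phi>) \<and>
     (\<forall>\<alpha>\<in>\<Phi>. \<forall>\<beta>\<in>\<Phi>. 2 * (\<beta> \<bullet> \<alpha>) / (\<alpha> \<bullet> \<alpha>) \<in> \<int>) \<and>
     (\<forall>\<alpha>\<in>\<Phi>. \<forall>c. c *\<^sub>R \<alpha> \<in> \<Phi> \<longrightarrow> c = 1 \<or> c = -1)"

definition root_base :: "'a::euclidean_space set \<Rightarrow> 'a set \<Rightarrow> bool" where
  "root_base \<Phi> \<Delta> \<longleftrightarrow> \<Delta> \<subseteq> \<Phi> \<and> independent \<Delta> \<and>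
     (\<forall>\<beta>\<in>\<Phi>. \<exists>c :: 'a \<Rightarrow> int. \<beta> = (\<Sum>\<alpha>\<in>\<Delta>. of_int (c \<alpha>) *\<^sub>R \<alpha>) \<and>
        ((\<forall>\<alpha>\<in>\<Delta>. 0 \<le> c \<alpha>) \<or> (\<forall>\<alpha>\<in>\<Delta>. c \<alpha> \<le> 0)))"

definition weyl_group :: "'a::euclidean_space set \<Rightarrow> ('a \<Rightarrow> 'a) set" where
  "weyl_group \<Phi> = generated_group (reflection ` \<Phi>)"


section \<open>The coinvariant algebra\<close>

(* Sym(V) is realised as the algebra of polynomial functions on the dual of V (the field being
   infinite); the dual is identified with V by the inner product, v in V becoming the function
   x |-> v \<bullet> x.  The identification is compatible with the group action, since the
   elements of W are orthogonal: (w v) \<bullet> x = v \<bullet> (w^-1 x). *)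

definition sym_power :: "'a::euclidean_space set \<Rightarrow> nat \<Rightarrow> ('a \<Rightarrow> real) set" where
  "sym_power V k = span {(\<lambda>x. \<Prod>i<k. v i \<bullet> x) | v. \<forall>i<k. v i \<in> V}"

definition sym_algebra :: "'a::euclidean_space set \<Rightarrow> ('a \<Rightarrow> real) set" where
  "sym_algebra V = span (\<Union>k. sym_power V k)"

definition act :: "('a \<Rightarrow> 'a) \<Rightarrow> ('a \<Rightarrow> real) \<Rightarrow> 'a \<Rightarrow> real" where
  "act w f = f \<circ> inv' w"

definition coinvariant_ideal :: "('a::euclidean_space \<Rightarrow> 'a) set \<Rightarrow> 'a set \<Rightarrow> ('a \<Rightarrow> real) set" where
  "coinvariant_ideal W V =
     span {g * f | g f d. g \<in> sym_algebra V \<and> 0 < d \<and> f \<in> sym_power V d \<and> (\<forall>w\<in>W. act w f = f)}"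

(* The classes of the elements of B form a basis of U modulo N, i.e. of the image of U in
   the quotient by N. *)
definition basis_mod :: "'v::real_vector set \<Rightarrow> 'v set \<Rightarrow> 'v set \<Rightarrow> bool" where
  "basis_mod U N B \<longleftrightarrow> finite B \<and> B \<subseteq> U \<and>
     (\<forall>u\<in>U. \<exists>!c. (\<forall>b. b \<notin> B \<longrightarrow> c b = 0) \<and> u - (\<Sum>b\<in>B. c b *\<^sub>R b) \<in> N)"

definition coord_mod :: "'v::real_vector set \<Rightarrow> 'v set \<Rightarrow> 'v \<Rightarrow> 'v \<Rightarrow> real" where
  "coord_mod N B u = (THE c. (\<forall>b. b \<notin> B \<longrightarrow> c b = 0) \<and> u - (\<Sum>b\<in>B. c b *\<^sub>R b) \<in> N)"

(* Trace of the endomorphism that T induces on the image of U in the quotient by N, for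
   subspaces U and N preserved by T; it does not depend on the basis chosen. *)
definition trace_mod :: "'v::real_vector set \<Rightarrow> 'v set \<Rightarrow> ('v \<Rightarrow> 'v) \<Rightarrow> real" where
  "trace_mod U N T = (let B = (SOME B. basis_mod U N B) in \<Sum>b\<in>B. coord_mod N B (T b) b)"

definition coinvariant_character ::
    "'a::euclidean_space set \<Rightarrow> nat \<Rightarrow> ('a \<Rightarrow> 'a) \<Rightarrow> real" where
  "coinvariant_character \<Phi> k w =
     trace_mod (sym_power (span \<Phi>) k) (coinvariant_ideal (weyl_group \<Phi>) (span \<Phi>)) (act w)"


section \<open>Permutations and weights\<close>

definition adjacent_transpositions :: "nat \<Rightarrow> (nat \<Rightarrow> nat) set" where
  "adjacent_transpositions n = {Transposition.transpose i (Suc i) | i. 1 \<le> i \<and> i < n}"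

definition product_adjacent_transpositions :: "nat \<Rightarrow> (nat \<Rightarrow> nat) \<Rightarrow> (nat \<Rightarrow> nat \<Rightarrow> nat) set" where
  "product_adjacent_transpositions r n =
     {(\<lambda>j\<in>{1..r}. if j = j0 then t else id) | j0 t. j0 \<in> {1..r} \<and> t \<in> adjacent_transpositions (n j0)}"

(* Partitions are weakly decreasing lists of positive parts; fixed points contribute parts 1. *)
definition cycle_type :: "nat \<Rightarrow> (nat \<Rightarrow> nat) \<Rightarrow> nat list" where
  "cycle_type n \<pi> =
     rev (sorted_list_of_multiset (image_mset card (mset_set (orbit \<pi> ` {1..n}))))"

definition unimodal_at :: "nat \<Rightarrow> (nat \<Rightarrow> nat) \<Rightarrow> nat \<Rightarrow> bool" where
  "unimodal_at n \<pi> m \<longleftrightarrow> m < n \<and> (\<forall>i\<in>{1..m}. \<pi> i > \<pi> (Suc i)) \<and> (\<forall>i\<in>{Suc m..<n}. \<pi> i < \<pi> (Suc i))"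

definition unimodal_sign :: "nat \<Rightarrow> (nat \<Rightarrow> nat) \<Rightarrow> int" where
  "unimodal_sign n \<pi> =
     (if \<exists>m. unimodal_at n \<pi> m then (-1) ^ (THE m. unimodal_at n \<pi> m) else 0)"

(* Blocks are indexed from 0, as are the parts of the list. *)
definition block_offset :: "nat list \<Rightarrow> nat \<Rightarrow> nat" where
  "block_offset \<mu> i = sum_list (take i \<mu>)"

definition block :: "nat list \<Rightarrow> nat \<Rightarrow> nat set" where
  "block \<mu> i = {block_offset \<mu> i <.. block_offset \<mu> (Suc i)}"

definition young_subgroup :: "nat list \<Rightarrow> (nat \<Rightarrow> nat) set" where
  "young_subgroup \<mu> =
     {\<sigma>. \<sigma> permutes {1..sum_list \<mu>} \<and> (\<forall>i<length \<mu>. \<sigma> ` block \<mu> i = block \<mu> i)}"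

definition young_component :: "nat list \<Rightarrow> nat \<Rightarrow> (nat \<Rightarrow> nat) \<Rightarrow> nat \<Rightarrow> nat" where
  "young_component \<mu> i \<sigma> =
     (\<lambda>k. if k \<in> {1..\<mu> ! i} then \<sigma> (k + block_offset \<mu> i) - block_offset \<mu> i else k)"

definition sym_weight :: "nat list \<Rightarrow> (nat \<Rightarrow> nat) \<Rightarrow> int" where
  "sym_weight \<mu> \<pi> =
     (let \<sigma> = subgroup_part (word_length (adjacent_transpositions (sum_list \<mu>))) (young_subgroup \<mu>) \<pi>
      in \<Prod>i<length \<mu>. unimodal_sign (\<mu> ! i) (young_component \<mu> i \<sigma>))"

definition product_weight :: "nat \<Rightarrow> (nat \<Rightarrow> nat list) \<Rightarrow> (nat \<Rightarrow> nat \<Rightarrow> nat) \<Rightarrow> int" where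
  "product_weight r \<mu> \<pi> = (\<Prod>j\<in>{1..r}. sym_weight (\<mu> j) (\<pi> j))"

(* S: simple reflections of W; H: parabolic subgroup; \<psi>: identification of H with the
   product of r symmetric groups. *)
definition weyl_weight ::
    "('a \<Rightarrow> 'a) set \<Rightarrow> ('a \<Rightarrow> 'a) set \<Rightarrow> (('a \<Rightarrow> 'a) \<Rightarrow> nat \<Rightarrow> nat \<Rightarrow> nat) \<Rightarrow> nat \<Rightarrow>
     (nat \<Rightarrow> nat list) \<Rightarrow> ('a \<Rightarrow> 'a) \<Rightarrow> int" where
  "weyl_weight S H \<psi> r \<mu> w = product_weight r \<mu> (\<psi> (subgroup_part (word_length S) H w))"

end

theory Submission
  imports Defs
begin

text \<open>
  Both sides are compared through their generating functions in \<open>q\<close>.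

  For the character, let \<open>F v\<close> be the graded trace of \<open>v\<close> on the symmetric algebra.  The
  divided difference operators of Bernstein, Gelfand and Gelfand exhibit the symmetric algebra as a
  free module over the invariants with a homogeneous basis indexed by \<open>W\<close>, the degree being the
  length.  Taking graded traces, \<open>F v\<close> is the Hilbert series of the invariants times the generating
  function of the characters \<open>\<chi>\<close>, which for \<open>v = 1\<close> is the Poincare polynomial of \<open>W\<close>.  Newton's
  identities give the logarithmic derivative of \<open>F v\<close> in terms of the traces of the powers of \<open>v\<close> on
  the reflection representation, that is, of numbers of fixed points of permutations.  Dividing
  \<open>F v\<close> by \<open>F 1\<close>, the generating function of the \<open>\<chi>\<close> is the Poincare polynomial of \<open>W\<close> times the
  product of \<open>(1 - q) ^ p / (1 - q ^ p)\<close> over all cycle lengths \<open>p\<close>.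

  For the weights, length-additive coset factorisations reduce the sum from \<open>W\<close> to the symmetric
  groups \<open>S\<^sub>p\<close>.  Inserting the largest value at either end of a unimodal permutation shows that the
  signed sum over \<open>S\<^sub>p\<close> is the product of \<open>1 - q ^ i\<close> for \<open>i < p\<close>, which gives the same product.
\<close>

section \<open>Words and coset factorisations\<close>

text \<open>The Hilbert series of the invariants stays unspecified: it is a common factor of both
  graded traces and cancels. The divided differences show that it is a factor at all, and that the
  complementary factor at the identity counts \<open>W\<close> by length; this is the only link
  between polynomial degree and length, and it works for every Weyl group, while only
  \<open>H\<close> is of type A.

  The map \<open>\<psi>\<close> is merely a group isomorphism matching generators. To get traces
  from it, the commutation and braid relations are turned back into formulas for simple reflections
  on simple roots. Simple roots outside \<open>J\<close> contribute as they do for the identity, so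
  the trace of a power of \<open>v\<close> differs from the trace of the identity only by fixed
  points minus \<open>n j\<close>.

  Newton's identities are obtained over the reals, without eigenvalues, from cyclicity of the trace
  applied to multiplication and differentiation. Since traces on quotients are defined through an
  arbitrarily chosen basis, they are all computed through dual families (\<open>dual_mod\<close>).
  Quotients of generating functions are written cross-multiplied and cancelled in the integral
  domain of real power series.\<close>

lemma prod_fun_simps [simp]:
  "prod_fun [] = id" "prod_fun (f # fs) = f \<circ> prod_fun fs"
  by (simp_all add: prod_fun_def)

lemma prod_fun_append [simp]: "prod_fun (fs @ gs) = prod_fun fs \<circ> prod_fun gs"
  by (induction fs) (simp_all add: comp_assoc)

lemma word_length_le:
  "set fs \<subseteq> S \<Longrightarrow> word_length S (prod_fun fs) \<le> length fs"
  unfolding word_length_def by (rule Least_le) blast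

lemma word_length_attained:
  assumes "w \<in> generated_group S"
  obtains fs where "set fs \<subseteq> S" "w = prod_fun fs" "length fs = word_length S w"
proof -
  obtain gs where "set gs \<subseteq> S" "w = prod_fun gs"
    using assms by (auto simp: generated_group_def)
  then have "\<exists>fs. length fs = length gs \<and> set fs \<subseteq> S \<and> w = prod_fun fs" by blast
  then have "\<exists>fs. length fs = word_length S w \<and> set fs \<subseteq> S \<and> w = prod_fun fs"
    unfolding word_length_def by (rule LeastI)
  then show ?thesis using that by blast
qed

lemma generated_group_id: "id \<in> generated_group S"
  unfolding generated_group_def by (rule CollectI, rule exI[of _ "[]"]) simp

lemma generated_group_comp:
  "f \<in> generated_group S \<Longrightarrow> g \<in> generated_group S \<Longrightarrow> f \<circ> g \<in> generated_group S"
  unfolding generated_group_def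
proof clarify
  fix fs gs assume "set fs \<subseteq> S" "set gs \<subseteq> S"
  then show "\<exists>hs. prod_fun fs \<circ> prod_fun gs = prod_fun hs \<and> set hs \<subseteq> S"
    by (intro exI[of _ "fs @ gs"]) auto
qed

lemma generated_group_gen: "s \<in> S \<Longrightarrow> s \<in> generated_group S"
  unfolding generated_group_def by (rule CollectI, rule exI[of _ "[s]"]) simp

lemma generated_group_induct [consumes 1, case_names id comp]:
  assumes "w \<in> generated_group S" "P id"
    and "\<And>s w. s \<in> S \<Longrightarrow> w \<in> generated_group S \<Longrightarrow> P w \<Longrightarrow> P (s \<circ> w)"
  shows "P w"
proof -
  have "set fs \<subseteq> S \<Longrightarrow> P (prod_fun fs)" for fs
  proof (induction fs)
    case (Cons f fs)
    then have "prod_fun fs \<in> generated_group S" by (auto simp: generated_group_def)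
    then have "P (f \<circ> prod_fun fs)" using assms(3)[of f "prod_fun fs"] Cons by simp
    then show ?case unfolding prod_fun_simps .
  qed (use assms in simp)
  then show ?thesis using assms(1) by (auto simp: generated_group_def)
qed

lemma generated_group_involutions:
  assumes "\<And>s. s \<in> S \<Longrightarrow> s \<circ> s = id" "w \<in> generated_group S"
  shows "bij w" "inv' w \<in> generated_group S"
proof -
  have "\<exists>w'\<in>generated_group S. w' \<circ> w = id \<and> w \<circ> w' = id" using assms(2)
  proof (induction rule: generated_group_induct)
    case id
    then show ?case using generated_group_id by (intro bexI[of _ id]) auto
  next
    case (comp s w)
    then obtain w' where w': "w'\<in>generated_group S" "w' \<circ> w = id" "w \<circ> w' = id" by blast
    have "w' \<circ> s \<circ> (s \<circ> w) = w' \<circ> (s \<circ> s) \<circ> w" "s \<circ> w \<circ> (w' \<circ> s) = s \<circ> (w \<circ> w') \<circ> s"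
      by (simp_all add: comp_assoc)
    then have "w' \<circ> s \<circ> (s \<circ> w) = id" "s \<circ> w \<circ> (w' \<circ> s) = id"
      using w' assms(1)[OF comp(1)] by simp_all
    then show ?case using generated_group_comp[OF w'(1) generated_group_gen[OF comp(1)]] by blast
  qed
  then obtain w' where w': "w'\<in>generated_group S" "w' \<circ> w = id" "w \<circ> w' = id" by blast
  then show "bij w" using o_bij by blast
  have "inv' w = w'" using w' inv_unique_comp by blast
  then show "inv' w \<in> generated_group S" using w' by simp
qed

text \<open>Lowering \<open>f\<close> step by step spells a word with \<open>f g\<close> letters,
  and no word is shorter because each letter raises \<open>f\<close> by at most one. This criterion
  identifies word length with inversion counts for parabolic subgroups, for symmetric groups and for
  their products.\<close>

lemma word_length_eqI:
  assumes G: "id \<in> G" "\<And>g s. g \<in> G \<Longrightarrow> s \<in> S \<Longrightarrow> g \<circ> s \<in> G"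
    and invol: "\<And>s. s \<in> S \<Longrightarrow> s \<circ> s = id"
    and f: "f id = 0" "\<And>g. g \<in> G \<Longrightarrow> f g = 0 \<Longrightarrow> g = id"
      "\<And>g s. g \<in> G \<Longrightarrow> s \<in> S \<Longrightarrow> f (g \<circ> s) \<le> Suc (f g)"
      "\<And>g. g \<in> G \<Longrightarrow> 0 < f g \<Longrightarrow> \<exists>s\<in>S. Suc (f (g \<circ> s)) = f g"
    and g: "g \<in> G"
  shows "word_length S g = f g" and "g \<in> generated_group S"
proof -
  have word: "\<exists>fs. set fs \<subseteq> S \<and> g = prod_fun fs \<and> length fs = f g" using g
  proof (induction "f g" arbitrary: g)
    case 0
    then have "g = id" using f(2) by simp
    then show ?case using 0 by (intro exI[of _ "[]"]) auto
  next
    case (Suc m)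
    then obtain s where s: "s \<in> S" "Suc (f (g \<circ> s)) = f g" using f(4)[of g] by auto
    then obtain fs where fs: "set fs \<subseteq> S" "g \<circ> s = prod_fun fs" "length fs = f (g \<circ> s)"
      using Suc.hyps(1)[of "g \<circ> s"] Suc.hyps(2) G(2) Suc.prems by auto
    have "g = g \<circ> s \<circ> s" using invol[OF s(1)] by (simp add: comp_assoc)
    then have "g = prod_fun (fs @ [s])" using fs by simp
    then show ?case using fs s by (intro exI[of _ "fs @ [s]"]) auto
  qed
  then show "g \<in> generated_group S" by (auto simp: generated_group_def)
  have upper: "prod_fun fs \<in> G \<and> f (prod_fun fs) \<le> length fs" if "set fs \<subseteq> S" for fs
    using that
  proof (induction fs rule: rev_induct)
    case (snoc s fs)
    then have "f (prod_fun fs \<circ> s) \<le> Suc (length fs)" "prod_fun fs \<circ> s \<in> G"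
      using f(3)[of "prod_fun fs" s] G(2) by auto
    moreover have "prod_fun (fs @ [s]) = prod_fun fs \<circ> s"
      unfolding prod_fun_append prod_fun_simps comp_id ..
    ultimately show ?case by (metis length_append_singleton)
  qed (use G f in auto)
  obtain fs where "set fs \<subseteq> S" "g = prod_fun fs" "length fs = word_length S g"
    using word_length_attained \<open>g \<in> generated_group S\<close> by blast
  then have "f g \<le> word_length S g" using upper by metis
  moreover have "word_length S g \<le> f g" using word word_length_le by metis
  ultimately show "word_length S g = f g" by simp
qed

text \<open>Additivity of the length makes the shortest element of each left coset unique, so
  \<open>g = r \<circ> h\<close> is a bijection from shortest representatives times \<open>K\<close>
  onto \<open>G\<close>. Every sum over \<open>G\<close> then splits into a sum over representatives
  times a sum over \<open>K\<close>; comparing the split for \<open>F\<close> and for the constant 1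
  eliminates the representatives.\<close>

lemma coset_factorization:
  fixes q :: "'c::comm_semiring_1" and F :: "('a \<Rightarrow> 'a) \<Rightarrow> 'c" and len :: "('a \<Rightarrow> 'a) \<Rightarrow> nat"
  assumes fin: "finite G" and KG: "K \<subseteq> G"
    and GK: "\<And>g h. g \<in> G \<Longrightarrow> h \<in> K \<Longrightarrow> g \<circ> h \<in> G"
    and K: "id \<in> K" "\<And>h k. h \<in> K \<Longrightarrow> k \<in> K \<Longrightarrow> h \<circ> k \<in> K" "\<And>h. h \<in> K \<Longrightarrow> inv' h \<in> K"
    and bij: "\<And>g. g \<in> G \<Longrightarrow> bij g"
    and add: "\<And>r h. r \<in> G \<Longrightarrow> \<forall>k\<in>K. len r \<le> len (r \<circ> k) \<Longrightarrow> h \<in> K \<Longrightarrow>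
        len (r \<circ> h) = len r + len h"
    and zero: "\<And>h. h \<in> K \<Longrightarrow> len h = 0 \<Longrightarrow> h = id"
  shows "(\<Sum>g\<in>G. q ^ len g * F (subgroup_part len K g)) * (\<Sum>h\<in>K. q ^ len h) =
         (\<Sum>g\<in>G. q ^ len g) * (\<Sum>h\<in>K. q ^ len h * F h)"
proof -
  define R where "R = {r \<in> G. \<forall>k\<in>K. len r \<le> len (r \<circ> k)}"
  have rep: "min_coset_rep len K (r \<circ> h) = r" if r: "r \<in> R" and h: "h \<in> K" for r h
  proof -
    let ?C = "(\<lambda>k. (r \<circ> h) \<circ> k) ` K"
    have bh: "bij h" "bij r" using bij KG h r by (auto simp: R_def)
    have "r \<in> ?C"
    proof (rule image_eqI[of _ _ "inv' h"])
      have "h \<circ> inv' h = id" using bh(1) bij_is_surj surj_iff by blast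
      then show "r = r \<circ> h \<circ> inv' h" by (simp add: comp_assoc)
    qed (use K h in auto)
    have sub: "\<exists>k\<in>K. x = r \<circ> k" if "x \<in> ?C" for x
    proof -
      obtain k where "k \<in> K" "x = r \<circ> h \<circ> k" using \<open>x \<in> ?C\<close> by blast
      then show ?thesis using K(2)[OF h, of k] by (auto simp: comp_assoc)
    qed
    have min: "len r \<le> len x" if "x \<in> ?C" for x
      using sub[OF that] r by (auto simp: R_def)
    have "is_arg_min len (\<lambda>x. x \<in> ?C) (ARG_MIN len x. x \<in> ?C)"
      unfolding arg_min_def
    proof (rule someI[of _ r])
      show "is_arg_min len (\<lambda>x. x \<in> ?C) r"
        using \<open>r \<in> ?C\<close> min by (auto simp: is_arg_min_def not_less)
    qed
    then have m: "min_coset_rep len K (r \<circ> h) \<in> ?C"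
       "len (min_coset_rep len K (r \<circ> h)) \<le> len r"
      using \<open>r \<in> ?C\<close> unfolding min_coset_rep_def is_arg_min_def by (auto simp: not_less)
    then obtain k where k: "k \<in> K" "min_coset_rep len K (r \<circ> h) = r \<circ> k" using sub by blast
    \<comment> \<open>The minimiser picked by \<open>ARG_MIN\<close> is no longer than
      \<open>r\<close>, so additivity leaves length 0 for \<open>k\<close>.\<close>
    have "len (r \<circ> k) = len r + len k" using add k(1) r by (auto simp: R_def)
    then have "k = id" using m(2) k zero[of k] by simp
    then show ?thesis using k by simp
  qed
  have part: "subgroup_part len K (r \<circ> h) = h" if "r \<in> R" "h \<in> K" for r h
  proof -
    have "bij r" using that bij by (auto simp: R_def)
    then have "inv' r \<circ> (r \<circ> h) = h"
      by (metis bij_is_inj comp_assoc inv_o_cancel id_comp)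
    then show ?thesis using rep[OF that] by (simp add: subgroup_part_def)
  qed
  have ex: "\<exists>r\<in>R. \<exists>h\<in>K. g = r \<circ> h" if g: "g \<in> G" for g
  proof -
    obtain k where k: "k \<in> K" "\<And>k'. k' \<in> K \<Longrightarrow> len (g \<circ> k) \<le> len (g \<circ> k')"
      using arg_min_nat_lemma[of "\<lambda>k. k \<in> K" id "\<lambda>k. len (g \<circ> k)"] K(1) by blast
    have "bij k" using bij KG k by auto
    have "g \<circ> k \<in> R"
      using k g GK K(2) by (auto simp: R_def comp_assoc)
    moreover have "k \<circ> inv' k = id" using \<open>bij k\<close> bij_is_surj surj_iff by blast
    then have "g = g \<circ> k \<circ> inv' k" by (simp add: comp_assoc)
    ultimately show ?thesis using K(3) k(1) by blast
  qed
  have bb: "bij_betw (\<lambda>(r, h). r \<circ> h) (R \<times> K) G"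
    unfolding bij_betw_def
  proof
    show "inj_on (\<lambda>(r, h). r \<circ> h) (R \<times> K)"
      by (rule inj_onI) (metis (no_types, lifting) rep part mem_Sigma_iff case_prod_conv surj_pair)
    show "(\<lambda>(r, h). r \<circ> h) ` (R \<times> K) = G"
    proof
      show "(\<lambda>(r, h). r \<circ> h) ` (R \<times> K) \<subseteq> G" using GK by (auto simp: R_def)
      show "G \<subseteq> (\<lambda>(r, h). r \<circ> h) ` (R \<times> K)" using ex by (force simp: image_iff)
    qed
  qed
  have eq: "(\<Sum>g\<in>G. q ^ len g * F (subgroup_part len K g)) =
      (\<Sum>r\<in>R. q ^ len r) * (\<Sum>h\<in>K. q ^ len h * F h)" for F
  proof -
    have "(\<Sum>g\<in>G. q ^ len g * F (subgroup_part len K g)) =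
       (\<Sum>(r, h)\<in>R \<times> K. q ^ len (r \<circ> h) * F (subgroup_part len K (r \<circ> h)))"
      by (subst sum.reindex_bij_betw[OF bb, symmetric]) (simp add: case_prod_unfold)
    also have "\<dots> = (\<Sum>(r, h)\<in>R \<times> K. q ^ len r * (q ^ len h * F h))"
    proof (rule sum.cong[OF refl], clarify)
      fix r h assume "r \<in> R" "h \<in> K"
      then show "q ^ len (r \<circ> h) * F (subgroup_part len K (r \<circ> h)) = q ^ len r * (q ^ len h * F h)"
        using part[of r h] add[of r h] by (simp add: R_def power_add mult.assoc)
    qed
    also have "\<dots> = (\<Sum>r\<in>R. q ^ len r) * (\<Sum>h\<in>K. q ^ len h * F h)"
      by (simp add: sum.cartesian_product sum_product)
    finally show ?thesis .
  qed
  show ?thesis using eq[of F] eq[of "\<lambda>_. 1"] by (simp add: mult_ac)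
qed

section \<open>Traces on quotients of subspaces\<close>

text \<open>Linearity is asked on \<open>U\<close> alone, since operators such as \<open>dd\<close>
  and \<open>dir_deriv\<close> are under control only on polynomial functions.\<close>

definition lin_on :: "'v::real_vector set \<Rightarrow> ('v \<Rightarrow> 'w::real_vector) \<Rightarrow> bool" where
  "lin_on U T \<longleftrightarrow> (\<forall>x\<in>U. \<forall>y\<in>U. T (x + y) = T x + T y) \<and> (\<forall>c. \<forall>x\<in>U. T (c *\<^sub>R x) = c *\<^sub>R T x)"

lemma lin_onD:
  assumes "lin_on U T"
  shows "x \<in> U \<Longrightarrow> y \<in> U \<Longrightarrow> T (x + y) = T x + T y" "x \<in> U \<Longrightarrow> T (c *\<^sub>R x) = c *\<^sub>R T x"
  using assms by (auto simp: lin_on_def)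

lemma lin_on_diff:
  assumes "lin_on U T" "subspace U" "x \<in> U" "y \<in> U"
  shows "T (x - y) = T x - T y"
proof -
  have "T (x + (-1) *\<^sub>R y) = T x + (-1) *\<^sub>R T y"
    using assms by (metis lin_onD subspace_scale)
  then show ?thesis by simp
qed

lemma lin_on_zero:
  assumes "lin_on U T" "subspace U" shows "T 0 = 0"
  using lin_onD(2)[OF assms(1), of 0 0] subspace_0[OF assms(2)] by simp

lemma lin_on_sum:
  assumes "lin_on U T" "subspace U" "\<And>i. i \<in> I \<Longrightarrow> e i \<in> U"
  shows "T (\<Sum>i\<in>I. c i *\<^sub>R e i) = (\<Sum>i\<in>I. c i *\<^sub>R T (e i))"
  using assms(3)
proof (induction I rule: infinite_finite_induct)
  case (insert i I)
  have "(\<Sum>i\<in>I. c i *\<^sub>R e i) \<in> U"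
    by (intro subspace_sum assms(2) subspace_scale) (use insert.prems in auto)
  then show ?case using insert lin_onD[OF assms(1)] subspace_scale[OF assms(2)]
    by simp
qed (use lin_on_zero assms in auto)

lemma subspace_lin_on_preimage:
  assumes "lin_on U T" "subspace U" "subspace U'"
  shows "subspace {x. x \<in> U \<and> T x \<in> U'}"
  using assms lin_on_zero[OF assms(1,2)]
  by (intro subspaceI) (auto simp: lin_onD subspace_0 subspace_add subspace_scale)

lemma subspace_lin_on_equalizer:
  assumes "lin_on U S" "lin_on U T" "subspace U"
  shows "subspace {x. x \<in> U \<and> S x = T x}"
  using assms lin_on_zero[OF assms(1,3)] lin_on_zero[OF assms(2,3)]
  by (intro subspaceI) (auto simp: lin_onD subspace_0 subspace_add subspace_scale)

text \<open>A basis of \<open>U\<close> modulo \<open>N\<close> together with its dual functionals.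
  Having the functionals explicit turns a trace into a plain sum and avoids the choice made in
  \<open>trace_mod\<close>.\<close>

definition dual_mod :: "'v::real_vector set \<Rightarrow> 'v set \<Rightarrow> 'i set \<Rightarrow> ('i \<Rightarrow> 'v) \<Rightarrow> ('i \<Rightarrow> 'v \<Rightarrow> real) \<Rightarrow> bool" where
  "dual_mod U N I e \<phi> \<longleftrightarrow> subspace U \<and> subspace N \<and> finite I \<and> (\<forall>i\<in>I. e i \<in> U) \<and>
     (\<forall>i\<in>I. lin_on U (\<phi> i)) \<and> (\<forall>i\<in>I. \<forall>u\<in>U \<inter> N. \<phi> i u = 0) \<and>
     (\<forall>i\<in>I. \<forall>j\<in>I. \<phi> i (e j) = (if i = j then 1 else 0)) \<and>
     (\<forall>u\<in>U. u - (\<Sum>i\<in>I. \<phi> i u *\<^sub>R e i) \<in> N)"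

text \<open>Cyclicity of the trace, \<open>tr (P Q) = tr (Q P)\<close>, for maps between two
  possibly different quotients. With one map the identity it gives independence of the basis; with
  multiplication and differentiation it drives Newton's identities.\<close>

lemma dual_mod_swap:
  assumes d: "dual_mod U N I e \<phi>" and d': "dual_mod U' N' I' e' \<phi>'"
    and P: "lin_on U' P" "P ` U' \<subseteq> U" "P ` (U' \<inter> N') \<subseteq> N"
    and Q: "lin_on U Q" "Q ` U \<subseteq> U'" "Q ` (U \<inter> N) \<subseteq> N'"
  shows "(\<Sum>i\<in>I. \<phi> i (P (Q (e i)))) = (\<Sum>j\<in>I'. \<phi>' j (Q (P (e' j))))"
proof -
  \<comment> \<open>The matrix expansion of \<open>P\<close> is stated for arbitrary data, so that
    it serves once for \<open>P\<close> and once, with the roles exchanged, for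
    \<open>Q\<close>.\<close>
  have half: "\<phi> i (P x) = (\<Sum>j\<in>I'. \<phi>' j x * \<phi> i (P (e' j)))"
    if d: "dual_mod U N I e \<phi>" and d': "dual_mod U' N' I' e' \<phi>'"
    and P: "lin_on U' P" "P ` U' \<subseteq> U" "P ` (U' \<inter> N') \<subseteq> N" and x: "x \<in> U'" and i: "i \<in> I"
  for U U' N N' I I' and e e' \<phi> \<phi>' P x i
  proof -
    note D = d[unfolded dual_mod_def] d'[unfolded dual_mod_def]
    let ?s = "\<Sum>j\<in>I'. \<phi>' j x *\<^sub>R e' j"
    have s: "?s \<in> U'" using D by (intro subspace_sum subspace_scale) auto
    have "x - ?s \<in> U' \<inter> N'" using D x s by (auto intro: subspace_diff)
    then have "P (x - ?s) \<in> N" "P (x - ?s) \<in> U" using P by auto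
    then have "\<phi> i (P (x - ?s)) = 0" using D i by blast
    moreover have "P (x - ?s) = P x - (\<Sum>j\<in>I'. \<phi>' j x *\<^sub>R P (e' j))"
      using lin_on_diff[OF P(1) _ x s] lin_on_sum[OF P(1), of I' e' "\<lambda>j. \<phi>' j x"] D by auto
    moreover have "(\<Sum>j\<in>I'. \<phi>' j x *\<^sub>R P (e' j)) \<in> U"
      using D P by (intro subspace_sum subspace_scale) auto
    moreover have "P x \<in> U" using P x by auto
    moreover have "\<phi> i (\<Sum>j\<in>I'. \<phi>' j x *\<^sub>R P (e' j)) = (\<Sum>j\<in>I'. \<phi>' j x *\<^sub>R \<phi> i (P (e' j)))"
      by (rule lin_on_sum[of U]) (use D P i in auto)
    ultimately show ?thesis using lin_on_diff[of U "\<phi> i"] D i by auto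
  qed
  have "(\<Sum>i\<in>I. \<phi> i (P (Q (e i)))) = (\<Sum>i\<in>I. \<Sum>j\<in>I'. \<phi>' j (Q (e i)) * \<phi> i (P (e' j)))"
    by (intro sum.cong refl half[OF d d' P]) (use Q d in \<open>auto simp: dual_mod_def\<close>)
  also have "\<dots> = (\<Sum>j\<in>I'. \<Sum>i\<in>I. \<phi> i (P (e' j)) * \<phi>' j (Q (e i)))"
    by (subst sum.swap) (simp add: mult.commute)
  also have "\<dots> = (\<Sum>j\<in>I'. \<phi>' j (Q (P (e' j))))"
    by (intro sum.cong refl half[OF d' d Q, symmetric]) (use P d' in \<open>auto simp: dual_mod_def\<close>)
  finally show ?thesis .
qed

lemma dual_mod_unique_coords:
  assumes d: "dual_mod U N I e \<phi>" and u: "u \<in> U" and c: "u - (\<Sum>i\<in>I. c i *\<^sub>R e i) \<in> N" and i: "i \<in> I"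
  shows "c i = \<phi> i u"
proof -
  note D = d[unfolded dual_mod_def]
  have s: "(\<Sum>i\<in>I. c i *\<^sub>R e i) \<in> U" using D by (intro subspace_sum subspace_scale) auto
  then have "u - (\<Sum>i\<in>I. c i *\<^sub>R e i) \<in> U \<inter> N" using u c D by (auto intro: subspace_diff)
  then have "\<phi> i (u - (\<Sum>i\<in>I. c i *\<^sub>R e i)) = 0" using D i by blast
  moreover have "\<phi> i (\<Sum>i\<in>I. c i *\<^sub>R e i) = (\<Sum>j\<in>I. c j *\<^sub>R \<phi> i (e j))"
    by (rule lin_on_sum[of U]) (use D i in auto)
  moreover have "\<dots> = (\<Sum>j\<in>I. if i = j then c i else 0)"
    using D i by (intro sum.cong) auto
  moreover have "\<dots> = c i" using D i by simp
  ultimately show ?thesis using lin_on_diff[of U "\<phi> i" u "\<Sum>i\<in>I. c i *\<^sub>R e i"] D i u s by auto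
qed

lemma dual_mod_basis_mod:
  assumes d: "dual_mod U N I e \<phi>"
  shows "basis_mod U N (e ` I)"
proof -
  note D = d[unfolded dual_mod_def]
  have inj: "inj_on e I"
    by (rule inj_onI) (metis D zero_neq_one)
  have sum: "(\<Sum>b\<in>e ` I. c b *\<^sub>R b) = (\<Sum>i\<in>I. c (e i) *\<^sub>R e i)" for c
    using inj by (simp add: sum.reindex)
  have "\<exists>!c. (\<forall>b. b \<notin> e ` I \<longrightarrow> c b = 0) \<and> u - (\<Sum>b\<in>e ` I. c b *\<^sub>R b) \<in> N" if u: "u \<in> U" for u
  proof (rule ex1I)
    let ?c = "\<lambda>b. if b \<in> e ` I then \<phi> (the_inv_into I e b) u else 0"
    have "(\<Sum>b\<in>e ` I. ?c b *\<^sub>R b) = (\<Sum>i\<in>I. \<phi> i u *\<^sub>R e i)"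
      unfolding sum by (intro sum.cong) (auto simp: the_inv_into_f_f[OF inj])
    then show "(\<forall>b. b \<notin> e ` I \<longrightarrow> ?c b = 0) \<and> u - (\<Sum>b\<in>e ` I. ?c b *\<^sub>R b) \<in> N"
      using D u by auto
    fix c assume c: "(\<forall>b. b \<notin> e ` I \<longrightarrow> c b = 0) \<and> u - (\<Sum>b\<in>e ` I. c b *\<^sub>R b) \<in> N"
    have "c (e i) = \<phi> i u" if "i \<in> I" for i
      using dual_mod_unique_coords[OF d u _ that, of "\<lambda>i. c (e i)"] c unfolding sum by auto
    then show "c = ?c" using c by (auto simp: fun_eq_iff the_inv_into_f_f[OF inj])
  qed
  then show ?thesis using D by (auto simp: basis_mod_def)
qed

text \<open>Uniqueness of coordinates is what makes \<open>coord_mod\<close> linear: sums and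
  multiples of coordinate vectors are coordinates of the sums and multiples.\<close>

lemma basis_mod_dual_mod:
  assumes b: "basis_mod U N B" and U: "subspace U" and N: "subspace N"
  shows "dual_mod U N B (\<lambda>b. b) (\<lambda>b u. coord_mod N B u b)"
proof -
  note D = b[unfolded basis_mod_def]
  let ?C = "\<lambda>u c. (\<forall>b. b \<notin> B \<longrightarrow> c b = 0) \<and> u - (\<Sum>b\<in>B. c b *\<^sub>R b) \<in> N"
  have ex1: "\<exists>!c. ?C u c" if "u \<in> U" for u using D that by blast
  have coord: "?C u (coord_mod N B u)" if "u \<in> U" for u
    using theI'[OF ex1[OF that]] unfolding coord_mod_def .
  have eqI: "coord_mod N B u = c" if "u \<in> U" "?C u c" for u c
    using ex1[OF that(1)] coord[OF that(1)] that(2) by blast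
  have lin: "lin_on U (\<lambda>u. coord_mod N B u b)" for b
    unfolding lin_on_def
  proof (intro conjI ballI allI)
    fix x y assume xy: "x \<in> U" "y \<in> U"
    have "x + y - (\<Sum>b\<in>B. (coord_mod N B x b + coord_mod N B y b) *\<^sub>R b) =
      (x - (\<Sum>b\<in>B. coord_mod N B x b *\<^sub>R b)) + (y - (\<Sum>b\<in>B. coord_mod N B y b *\<^sub>R b))"
      by (simp add: scaleR_add_left sum.distrib)
    also have "\<dots> \<in> N" using coord xy by (intro subspace_add[OF N]) auto
    finally have "coord_mod N B (x + y) = (\<lambda>b. coord_mod N B x b + coord_mod N B y b)"
      using coord xy by (intro eqI) (auto intro: subspace_add[OF U])
    then show "coord_mod N B (x + y) b = coord_mod N B x b + coord_mod N B y b" by simp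
  next
    fix c x assume x: "x \<in> U"
    have "c *\<^sub>R x - (\<Sum>b\<in>B. (c * coord_mod N B x b) *\<^sub>R b) = c *\<^sub>R (x - (\<Sum>b\<in>B. coord_mod N B x b *\<^sub>R b))"
      by (simp add: scaleR_diff_right scaleR_sum_right)
    also have "\<dots> \<in> N" using coord x by (intro subspace_scale[OF N]) auto
    finally have "coord_mod N B (c *\<^sub>R x) = (\<lambda>b. c * coord_mod N B x b)"
      using coord x by (intro eqI) (auto intro: subspace_scale[OF U])
    then show "coord_mod N B (c *\<^sub>R x) b = c *\<^sub>R coord_mod N B x b" by simp
  qed
  have zero: "coord_mod N B u = (\<lambda>_. 0)" if "u \<in> U \<inter> N" for u
    by (rule eqI) (use that in auto)
  have delta: "coord_mod N B b = (\<lambda>b'. if b' = b then 1 else 0)" if "b \<in> B" for b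
  proof (rule eqI)
    have "(\<Sum>b'\<in>B. (if b' = b then 1 else 0) *\<^sub>R b') = (\<Sum>b'\<in>B. if b = b' then b else 0)"
      by (intro sum.cong) auto
    also have "\<dots> = b" using D that by simp
    finally show "?C b (\<lambda>b'. if b' = b then 1 else 0)" using that N by (auto simp: subspace_0)
  qed (use D that in auto)
  show ?thesis unfolding dual_mod_def
    using U N D lin zero delta coord by auto
qed

text \<open>The basis picked by \<open>SOME\<close> also yields a dual family, so the two diagonal
  sums agree by \<open>dual_mod_swap\<close> with the identity as second map.\<close>

lemma trace_mod_eq:
  assumes d: "dual_mod U N I e \<phi>" and T: "lin_on U T" "T ` U \<subseteq> U" "T ` (U \<inter> N) \<subseteq> N"
  shows "trace_mod U N T = (\<Sum>i\<in>I. \<phi> i (T (e i)))"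
proof -
  let ?B = "SOME B. basis_mod U N B"
  note D = d[unfolded dual_mod_def]
  have "basis_mod U N ?B" using dual_mod_basis_mod[OF d] by (rule someI)
  then have d': "dual_mod U N ?B (\<lambda>b. b) (\<lambda>b u. coord_mod N ?B u b)"
    using basis_mod_dual_mod D by blast
  have "(\<Sum>i\<in>I. \<phi> i (T (id (e i)))) = (\<Sum>j\<in>?B. coord_mod N ?B (id (T j)) j)"
    by (rule dual_mod_swap[OF d d']) (use T in \<open>auto simp: lin_on_def\<close>)
  then show ?thesis by (simp add: trace_mod_def Let_def)
qed

lemma dual_mod_representation:
  assumes "independent B" "finite B"
  shows "dual_mod (span B) {0} B (\<lambda>b. b) (\<lambda>b u. representation B u b)"
  unfolding dual_mod_def
proof (intro conjI ballI)
  fix b assume b: "b \<in> B"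
  show "lin_on (span B) (\<lambda>u. representation B u b)"
    unfolding lin_on_def using representation_add[OF assms(1)] representation_scale[OF assms(1)]
    by simp
  fix b' assume b': "b' \<in> B"
  show "representation B b' b = (if b = b' then 1 else 0)"
    using representation_basis[OF assms(1) b'] by auto
qed (use assms in \<open>auto simp: span_base subspace_single_0 representation_zero sum_representation_eq\<close>)

lemma finite_dim_basis:
  fixes U :: "'v::real_vector set"
  assumes "subspace U" "finite X" "U \<subseteq> span X"
  obtains B where "independent B" "finite B" "span B = U"
proof -
  obtain B where B: "B \<subseteq> U" "independent B" "U \<subseteq> span B"
    using maximal_independent_subset by blast
  then have "finite B" using independent_span_bound[OF assms(2)] assms(3) by blast
  moreover have "span B = U" using B span_minimal[OF B(1) assms(1)] by auto
  ultimately show ?thesis using that B by blast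
qed

section \<open>Reflections\<close>

lemma reflection_linear: "linear (reflection \<alpha>)"
  by (rule linearI)
    (simp_all add: reflection_def inner_add_left algebra_simps add_divide_distrib)

lemma reflection_self: "\<alpha> \<noteq> 0 \<Longrightarrow> reflection \<alpha> \<alpha> = - \<alpha>"
proof -
  assume "\<alpha> \<noteq> 0"
  then have "2 * (\<alpha> \<bullet> \<alpha>) / (\<alpha> \<bullet> \<alpha>) = 2" by simp
  then show ?thesis unfolding reflection_def by (simp add: scaleR_2)
qed

lemma reflection_reflection [simp]: "reflection \<alpha> (reflection \<alpha> x) = x"
proof (cases "\<alpha> = 0")
  case False
  have "reflection \<alpha> (reflection \<alpha> x) = reflection \<alpha> x - (2 * (x \<bullet> \<alpha>) / (\<alpha> \<bullet> \<alpha>)) *\<^sub>R reflection \<alpha> \<alpha>"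
    using linear_diff[OF reflection_linear] linear_cmul[OF reflection_linear]
    by (metis reflection_def)
  then show ?thesis using reflection_self[OF False] by (simp add: reflection_def)
qed (simp add: reflection_def)

lemma reflection_involution: "reflection \<alpha> \<circ> reflection \<alpha> = id"
  by (simp add: fun_eq_iff)

lemma reflection_inner: "reflection \<alpha> x \<bullet> reflection \<alpha> y = x \<bullet> y"
proof (cases "\<alpha> = 0")
  case False
  then have "\<alpha> \<bullet> \<alpha> \<noteq> 0" by simp
  then show ?thesis
    by (simp add: reflection_def inner_diff_left inner_diff_right inner_commute field_simps)
qed (simp add: reflection_def)

lemma reflection_minus: "reflection (- \<alpha>) = reflection \<alpha>"
  by (simp add: reflection_def fun_eq_iff)

lemma reflection_eq_parallel:
  assumes "reflection \<alpha> = reflection \<beta>" "\<alpha> \<noteq> 0"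
  shows "\<exists>c. \<alpha> = c *\<^sub>R \<beta>"
proof -
  have "- \<alpha> = \<alpha> - (2 * (\<alpha> \<bullet> \<beta>) / (\<beta> \<bullet> \<beta>)) *\<^sub>R \<beta>"
    using assms reflection_self by (metis reflection_def)
  then have "\<alpha> - - \<alpha> = (2 * (\<alpha> \<bullet> \<beta>) / (\<beta> \<bullet> \<beta>)) *\<^sub>R \<beta>"
    by (metis diff_diff_eq2 add_diff_cancel_left')
  then have "2 *\<^sub>R \<alpha> = (2 * (\<alpha> \<bullet> \<beta>) / (\<beta> \<bullet> \<beta>)) *\<^sub>R \<beta>" by (simp add: scaleR_2)
  then have "(1/2) *\<^sub>R 2 *\<^sub>R \<alpha> = (1/2) *\<^sub>R (2 * (\<alpha> \<bullet> \<beta>) / (\<beta> \<bullet> \<beta>)) *\<^sub>R \<beta>" by simp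
  then show ?thesis by auto
qed

lemma reflection_conj:
  assumes "linear w" "\<And>x y. w x \<bullet> w y = x \<bullet> y"
  shows "w (reflection \<alpha> x) = reflection (w \<alpha>) (w x)"
  using assms by (simp add: reflection_def linear_diff linear_cmul)

lemma reflection_group:
  assumes "w \<in> generated_group (reflection ` X)"
  shows reflection_group_linear: "linear w"
    and reflection_group_inner: "\<And>x y. w x \<bullet> w y = x \<bullet> y"
    and reflection_group_bij: "bij w"
    and reflection_group_inv: "inv' w \<in> generated_group (reflection ` X)"
proof -
  have "linear w \<and> (\<forall>x y. w x \<bullet> w y = x \<bullet> y)" using assms
  proof (induction rule: generated_group_induct)
    case id
    then show ?case using linear_id by (auto simp: id_def)
  next
    case (comp s w)
    then obtain \<alpha> where "s = reflection \<alpha>" by blast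
    then show ?case using comp linear_compose[OF _ reflection_linear, of w] by (simp add: o_def reflection_inner)
  qed
  then show "linear w" "\<And>x y. w x \<bullet> w y = x \<bullet> y" by auto
  show "bij w" "inv' w \<in> generated_group (reflection ` X)"
    using generated_group_involutions[OF _ assms] reflection_involution by auto
qed

section \<open>Based root systems\<close>

locale based_roots =
  fixes \<Phi> \<Delta> :: "'a::euclidean_space set"
  assumes root_system: "root_system \<Phi>" and root_base: "root_base \<Phi> \<Delta>"
begin

lemma finite_roots: "finite \<Phi>" and zero_not_root: "0 \<notin> \<Phi>"
  and reflection_root: "\<alpha> \<in> \<Phi> \<Longrightarrow> \<beta> \<in> \<Phi> \<Longrightarrow> reflection \<alpha> \<beta> \<in> \<Phi>"
  and root_reduced: "\<alpha> \<in> \<Phi> \<Longrightarrow> c *\<^sub>R \<alpha> \<in> \<Phi> \<Longrightarrow> c = 1 \<or> c = -1"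
  using root_system by (auto simp: root_system_def)

lemma simple_root: "\<alpha> \<in> \<Delta> \<Longrightarrow> \<alpha> \<in> \<Phi>" and independent_base: "independent \<Delta>"
  using root_base by (auto simp: root_base_def)

lemma finite_base: "finite \<Delta>"
  using finite_roots simple_root by (meson finite_subset subsetI)

lemma uminus_root: "\<alpha> \<in> \<Phi> \<Longrightarrow> - \<alpha> \<in> \<Phi>"
  using reflection_root[of \<alpha> \<alpha>] reflection_self[of \<alpha>] zero_not_root by metis

lemma root_span: "\<beta> \<in> \<Phi> \<Longrightarrow> \<beta> \<in> span \<Delta>"
proof -
  assume "\<beta> \<in> \<Phi>"
  then obtain c :: "'a \<Rightarrow> int" where "\<beta> = (\<Sum>\<alpha>\<in>\<Delta>. of_int (c \<alpha>) *\<^sub>R \<alpha>)"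
    using root_base by (auto simp: root_base_def)
  then show ?thesis by (auto intro: span_sum span_scale span_base)
qed

lemma span_roots: "span \<Phi> = span \<Delta>"
  using root_span simple_root by (intro subset_antisym span_minimal span_mono) auto

section \<open>Coordinates in the base and positive roots\<close>

abbreviation coeff :: "'a \<Rightarrow> 'a \<Rightarrow> real" where
  "coeff \<beta> \<alpha> \<equiv> representation \<Delta> \<beta> \<alpha>"

lemma coeff_sum: "\<beta> \<in> span \<Delta> \<Longrightarrow> (\<Sum>\<alpha>\<in>\<Delta>. coeff \<beta> \<alpha> *\<^sub>R \<alpha>) = \<beta>"
  by (rule sum_representation_eq[OF independent_base]) (auto simp: finite_base)

lemmas coeff_simps =
  representation_add[OF independent_base] representation_diff[OF independent_base]
  representation_neg[OF independent_base] representation_scale[OF independent_base]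

lemma coeff_simple: "\<alpha> \<in> \<Delta> \<Longrightarrow> coeff \<alpha> \<gamma> = (if \<gamma> = \<alpha> then 1 else 0)"
  using representation_basis[OF independent_base] by auto

definition Pos :: "'a set" where
  "Pos = {\<beta> \<in> \<Phi>. \<forall>\<alpha>\<in>\<Delta>. 0 \<le> coeff \<beta> \<alpha>}"

lemma Pos_root: "\<beta> \<in> Pos \<Longrightarrow> \<beta> \<in> \<Phi>"
  by (simp add: Pos_def)

lemma finite_Pos: "finite Pos"
  using finite_roots by (simp add: Pos_def)

lemma simple_Pos: "\<alpha> \<in> \<Delta> \<Longrightarrow> \<alpha> \<in> Pos"
  by (simp add: Pos_def simple_root coeff_simple)

lemma coeff_eqI: "\<beta> \<in> span \<Delta> \<Longrightarrow> \<gamma> \<in> span \<Delta> \<Longrightarrow> (\<And>\<alpha>. \<alpha> \<in> \<Delta> \<Longrightarrow> coeff \<beta> \<alpha> = coeff \<gamma> \<alpha>) \<Longrightarrow> \<beta> = \<gamma>"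
  using coeff_sum[of \<beta>] coeff_sum[of \<gamma>] by (metis (no_types, lifting) sum.cong)

lemma root_nonzero_coeff: "\<beta> \<in> \<Phi> \<Longrightarrow> \<exists>\<alpha>\<in>\<Delta>. coeff \<beta> \<alpha> \<noteq> 0"
  using coeff_eqI[of \<beta> 0] zero_not_root root_span by (auto simp: representation_zero span_zero)

lemma Pos_or_neg: "\<beta> \<in> \<Phi> \<Longrightarrow> \<beta> \<in> Pos \<or> - \<beta> \<in> Pos"
proof -
  assume b: "\<beta> \<in> \<Phi>"
  then obtain c :: "'a \<Rightarrow> int" where c: "\<beta> = (\<Sum>\<alpha>\<in>\<Delta>. of_int (c \<alpha>) *\<^sub>R \<alpha>)"
     "(\<forall>\<alpha>\<in>\<Delta>. 0 \<le> c \<alpha>) \<or> (\<forall>\<alpha>\<in>\<Delta>. c \<alpha> \<le> 0)"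
    using root_base by (fastforce simp: root_base_def)
  have "coeff \<beta> \<gamma> = of_int (c \<gamma>)" if "\<gamma> \<in> \<Delta>" for \<gamma>
  proof -
    have "coeff \<beta> \<gamma> = (\<Sum>\<alpha>\<in>\<Delta>. coeff (of_int (c \<alpha>) *\<^sub>R \<alpha>) \<gamma>)"
      unfolding c(1) by (subst representation_sum[OF independent_base]) (auto intro: span_scale span_base)
    also have "\<dots> = (\<Sum>\<alpha>\<in>\<Delta>. if \<gamma> = \<alpha> then of_int (c \<gamma>) else 0)"
      by (intro sum.cong) (auto simp: coeff_simps coeff_simple span_base)
    also have "\<dots> = of_int (c \<gamma>)" using that finite_base by simp
    finally show ?thesis .
  qed
  then show ?thesis using b c(2) uminus_root[OF b] root_span[OF b]
    by (auto simp: Pos_def coeff_simps)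
qed

lemma Pos_not_neg: "\<beta> \<in> Pos \<Longrightarrow> - \<beta> \<notin> Pos"
proof
  assume b: "\<beta> \<in> Pos" "- \<beta> \<in> Pos"
  then obtain \<alpha> where "\<alpha> \<in> \<Delta>" "coeff \<beta> \<alpha> \<noteq> 0" using root_nonzero_coeff Pos_root by blast
  then show False using b root_span[of \<beta>] by (force simp: Pos_def coeff_simps)
qed

lemma Pos_iff: "\<beta> \<in> \<Phi> \<Longrightarrow> \<beta> \<in> Pos \<longleftrightarrow> - \<beta> \<notin> Pos"
  using Pos_or_neg Pos_not_neg by blast

lemma PosI: "\<beta> \<in> \<Phi> \<Longrightarrow> \<alpha> \<in> \<Delta> \<Longrightarrow> 0 < coeff \<beta> \<alpha> \<Longrightarrow> \<beta> \<in> Pos"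
  using Pos_or_neg[of \<beta>] root_span[of \<beta>] by (force simp: Pos_def coeff_simps)

lemma reflection_Pos_eq:
  assumes "reflection \<alpha> = reflection \<beta>" "\<alpha> \<in> Pos" "\<beta> \<in> Pos" shows "\<alpha> = \<beta>"
proof -
  obtain c where c: "\<alpha> = c *\<^sub>R \<beta>"
    using reflection_eq_parallel[OF assms(1)] assms zero_not_root Pos_root by metis
  then have "c = 1 \<or> c = -1" using root_reduced assms Pos_root by metis
  then show ?thesis using c assms Pos_not_neg by auto
qed

lemma coeff_reflection:
  assumes "\<alpha> \<in> \<Delta>" "\<gamma> \<noteq> \<alpha>" "\<beta> \<in> span \<Delta>"
  shows "coeff (reflection \<alpha> \<beta>) \<gamma> = coeff \<beta> \<gamma>"
  using assms by (simp add: reflection_def coeff_simps coeff_simple span_base span_scale)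

text \<open>A simple reflection changes only the coefficient at its own root. Reducedness supplies
  another nonzero coefficient of \<open>\<beta>\<close>; it is positive, survives, and one positive
  coefficient decides the sign of a root.\<close>

lemma reflection_simple_Pos:
  assumes "\<alpha> \<in> \<Delta>" "\<beta> \<in> Pos" "\<beta> \<noteq> \<alpha>"
  shows "reflection \<alpha> \<beta> \<in> Pos"
proof -
  have b: "\<beta> \<in> \<Phi>" "\<beta> \<in> span \<Delta>" using assms Pos_root root_span by auto
  have "\<exists>\<gamma>\<in>\<Delta>. \<gamma> \<noteq> \<alpha> \<and> coeff \<beta> \<gamma> \<noteq> 0"
  proof (rule ccontr)
    assume "\<not> ?thesis"
    then have "\<beta> = coeff \<beta> \<alpha> *\<^sub>R \<alpha>"
      using assms(1) b(2) by (intro coeff_eqI) (auto simp: span_base span_scale coeff_simps coeff_simple)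
    moreover have "coeff \<beta> \<alpha> = 1 \<or> coeff \<beta> \<alpha> = -1"
      using root_reduced[of \<alpha> "coeff \<beta> \<alpha>"] calculation b(1) simple_root assms(1) by simp
    moreover have "coeff \<beta> \<alpha> \<ge> 0" using assms by (auto simp: Pos_def)
    ultimately show False using assms(3) by auto
  qed
  then obtain \<gamma> where g: "\<gamma> \<in> \<Delta>" "\<gamma> \<noteq> \<alpha>" "coeff \<beta> \<gamma> \<noteq> 0" by blast
  then have "coeff \<beta> \<gamma> > 0" using assms(2) by (force simp: Pos_def)
  then show ?thesis
    using PosI[of "reflection \<alpha> \<beta>" \<gamma>] coeff_reflection g b assms reflection_root simple_root by simp
qed

lemma reflection_simple_self: "\<alpha> \<in> \<Delta> \<Longrightarrow> reflection \<alpha> \<alpha> = - \<alpha>"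
  using reflection_self simple_root zero_not_root by metis

section \<open>Weyl group, inversion sets and the exchange condition\<close>

definition WG :: "('a \<Rightarrow> 'a) set" where "WG = generated_group (reflection ` \<Delta>)"

lemma WG_linear: "w \<in> WG \<Longrightarrow> linear w"
  and WG_inner: "w \<in> WG \<Longrightarrow> w x \<bullet> w y = x \<bullet> y"
  and WG_bij: "w \<in> WG \<Longrightarrow> bij w"
  and WG_inv: "w \<in> WG \<Longrightarrow> inv' w \<in> WG"
  unfolding WG_def using reflection_group by blast+

lemma WG_id: "id \<in> WG" and WG_comp: "w \<in> WG \<Longrightarrow> u \<in> WG \<Longrightarrow> w \<circ> u \<in> WG"
  and WG_simple: "\<alpha> \<in> \<Delta> \<Longrightarrow> reflection \<alpha> \<in> WG"
  unfolding WG_def by (auto intro: generated_group_id generated_group_comp generated_group_gen)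

lemma WG_root: "w \<in> WG \<Longrightarrow> \<beta> \<in> \<Phi> \<Longrightarrow> w \<beta> \<in> \<Phi>"
  unfolding WG_def
proof (induction rule: generated_group_induct)
  case (comp s w)
  then show ?case using reflection_root simple_root by auto
qed simp

lemma WG_neg: "w \<in> WG \<Longrightarrow> w (- x) = - w x"
  using WG_linear linear_neg by blast

lemma parabolic_subset: "J \<subseteq> \<Delta> \<Longrightarrow> generated_group (reflection ` J) \<subseteq> WG"
  unfolding WG_def generated_group_def by blast

text \<open>The inversion set of \<open>w\<close>: its cardinality turns out to be the
  length.\<close>

definition N :: "('a \<Rightarrow> 'a) \<Rightarrow> 'a set" where
  "N w = {\<beta> \<in> Pos. w \<beta> \<notin> Pos}"

lemma finite_N: "finite (N w)" using finite_Pos by (simp add: N_def)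

text \<open>Since \<open>reflection \<alpha>\<close> permutes the positive roots other than
  \<open>\<alpha>\<close>, it carries the old inversions to new ones, and \<open>\<alpha>\<close>
  itself is added.\<close>

lemma N_comp_simple:
  assumes w: "w \<in> WG" and a: "\<alpha> \<in> \<Delta>" and p: "w \<alpha> \<in> Pos"
  shows "N (w \<circ> reflection \<alpha>) = insert \<alpha> (reflection \<alpha> ` N w)" "card (N (w \<circ> reflection \<alpha>)) = Suc (card (N w))"
proof -
  note s = reflection_simple_self[OF a]
  have aN: "\<alpha> \<notin> N w" using p by (simp add: N_def)
  show eq: "N (w \<circ> reflection \<alpha>) = insert \<alpha> (reflection \<alpha> ` N w)"
  proof (intro Set.set_eqI iffI)
    fix \<beta> assume b: "\<beta> \<in> N (w \<circ> reflection \<alpha>)"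
    show "\<beta> \<in> insert \<alpha> (reflection \<alpha> ` N w)"
    proof (cases "\<beta> = \<alpha>")
      case False
      then have "reflection \<alpha> \<beta> \<in> N w"
        using b reflection_simple_Pos[OF a] by (auto simp: N_def)
      then show ?thesis by (metis reflection_reflection image_eqI insertI2)
    qed simp
  next
    fix \<beta> assume "\<beta> \<in> insert \<alpha> (reflection \<alpha> ` N w)"
    then consider "\<beta> = \<alpha>" | \<gamma> where "\<gamma> \<in> N w" "\<beta> = reflection \<alpha> \<gamma>" by blast
    then show "\<beta> \<in> N (w \<circ> reflection \<alpha>)"
    proof cases
      case 1
      then show ?thesis using simple_Pos[OF a] p s Pos_not_neg WG_neg[OF w]
        by (simp add: N_def)
    next
      case 2
      then show ?thesis using reflection_simple_Pos[OF a, of \<gamma>] aN by (auto simp: N_def)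
    qed
  qed
  have "\<alpha> \<notin> reflection \<alpha> ` N w"
  proof
    assume "\<alpha> \<in> reflection \<alpha> ` N w"
    then have "reflection \<alpha> \<alpha> \<in> N w" by (metis imageE reflection_reflection)
    then show False using s simple_Pos[OF a] Pos_not_neg by (simp add: N_def)
  qed
  moreover have "inj_on (reflection \<alpha>) (N w)"
    by (metis inj_on_inverseI reflection_reflection)
  ultimately show "card (N (w \<circ> reflection \<alpha>)) = Suc (card (N w))"
    unfolding eq using finite_N by (simp add: card_image)
qed

lemma comp_reflection_reflection: "w \<circ> reflection \<alpha> \<circ> reflection \<alpha> = w"
  "reflection \<alpha> \<circ> (reflection \<alpha> \<circ> w) = w"
  by (auto simp: fun_eq_iff)

lemma N_comp_simple_neg:
  assumes w: "w \<in> WG" and a: "\<alpha> \<in> \<Delta>" and p: "w \<alpha> \<notin> Pos"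
  shows "Suc (card (N (w \<circ> reflection \<alpha>))) = card (N w)"
proof -
  have "(w \<circ> reflection \<alpha>) \<alpha> \<in> Pos"
    using p Pos_iff[of "w \<alpha>"] WG_root[OF w simple_root[OF a]] WG_neg[OF w, of \<alpha>]
      reflection_simple_self[OF a] by simp
  then show ?thesis using N_comp_simple(2)[of "w \<circ> reflection \<alpha>" \<alpha>] w a WG_comp WG_simple
    comp_reflection_reflection by metis
qed

text \<open>Let \<open>\<alpha>\<close> travel through the word from the right. The letter
  \<open>\<beta>\<close> at which it turns negative must equal the root reached so far, by
  \<open>reflection_simple_Pos\<close>; conjugation then moves \<open>reflection \<alpha>\<close> up
  to that letter, where the two cancel.\<close>

lemma exchange:
  assumes "set as \<subseteq> \<Delta>" "\<alpha> \<in> \<Delta>" "prod_fun (map reflection as) \<alpha> \<notin> Pos"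
  shows "\<exists>bs. set bs \<subseteq> set as \<and> Suc (length bs) = length as \<and>
    prod_fun (map reflection as) \<circ> reflection \<alpha> = prod_fun (map reflection bs)"
  using assms
proof (induction as)
  case Nil
  then show ?case using simple_Pos by simp
next
  case (Cons \<beta> as)
  let ?w = "prod_fun (map reflection as)"
  have w: "?w \<in> WG" unfolding WG_def generated_group_def using Cons.prems
    by (intro CollectI exI[of _ "map reflection as"]) auto
  show ?case
  proof (cases "?w \<alpha> \<in> Pos")
    case False
    then obtain bs where bs: "set bs \<subseteq> set as" "Suc (length bs) = length as"
      "?w \<circ> reflection \<alpha> = prod_fun (map reflection bs)"
      using Cons.IH Cons.prems by (metis list.set_intros(2) subset_code(1))
    have "prod_fun (map reflection (\<beta> # as)) \<circ> reflection \<alpha> = prod_fun (map reflection (\<beta> # bs))"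
      using bs(3) by (simp add: o_def fun_eq_iff)
    moreover have "set (\<beta> # bs) \<subseteq> set (\<beta> # as)" "Suc (length (\<beta> # bs)) = length (\<beta> # as)"
      using bs by auto
    ultimately show ?thesis by blast
  next
    case True
    have "reflection \<beta> (?w \<alpha>) \<notin> Pos" using Cons.prems by simp
    then have "?w \<alpha> = \<beta>" using reflection_simple_Pos[of \<beta> "?w \<alpha>"] True Cons.prems by auto
    then have "?w \<circ> reflection \<alpha> = reflection \<beta> \<circ> ?w"
      using reflection_conj[OF WG_linear[OF w] WG_inner[OF w]] by (auto simp: fun_eq_iff)
    then have "prod_fun (map reflection (\<beta> # as)) \<circ> reflection \<alpha> = ?w"
      unfolding list.map prod_fun_simps comp_assoc by (metis comp_reflection_reflection(2))
    moreover have "set as \<subseteq> set (\<beta> # as)" "Suc (length as) = length (\<beta> # as)" by auto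
    ultimately show ?thesis by blast
  qed
qed

section \<open>Parabolic subgroups\<close>

lemma parabolic_diff_span:
  assumes h: "h \<in> generated_group (reflection ` J)" shows "h x - x \<in> span J"
  using h
proof (induction rule: generated_group_induct)
  case (comp s w)
  then obtain \<alpha> where a: "\<alpha> \<in> J" "s = reflection \<alpha>" by blast
  have eq: "(s \<circ> w) x - x = (w x - x) - (2 * (w x \<bullet> \<alpha>) / (\<alpha> \<bullet> \<alpha>)) *\<^sub>R \<alpha>"
    using a by (simp add: reflection_def)
  show ?case unfolding eq using comp a span_diff[OF _ span_scale[OF span_base]] by blast
qed (simp add: span_zero)

lemma coeff_span_outside:
  assumes "J \<subseteq> \<Delta>" "x \<in> span J" "\<gamma> \<in> \<Delta> - J" shows "coeff x \<gamma> = 0"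
  using representation_extend[OF independent_base assms(2,1)] representation_ne_zero[of J x \<gamma>] assms by auto

text \<open>An element of the parabolic subgroup moves vectors only by elements of
  \<open>span J\<close>, so it keeps all coefficients at simple roots outside \<open>J\<close>. A
  root outside \<open>span J\<close> has a nonzero coefficient there, and that coefficient fixes its
  sign.\<close>

lemma parabolic_complement_Pos:
  assumes J: "J \<subseteq> \<Delta>" and h: "h \<in> generated_group (reflection ` J)"
    and b: "\<beta> \<in> \<Phi>" "\<beta> \<notin> span J"
  shows "h \<beta> \<notin> span J" "h \<beta> \<in> Pos \<longleftrightarrow> \<beta> \<in> Pos"
proof -
  note diff = parabolic_diff_span[OF h]
  have hr: "h \<beta> \<in> \<Phi>" using WG_root parabolic_subset[OF J] h b by blast
  have notJ: "\<exists>\<gamma>\<in>\<Delta> - J. coeff x \<gamma> \<noteq> 0" if "x \<in> \<Phi>" "x \<notin> span J" for x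
  proof (rule ccontr)
    assume "\<not> ?thesis"
    then have "(\<Sum>\<alpha>\<in>\<Delta>. coeff x \<alpha> *\<^sub>R \<alpha>) = (\<Sum>\<alpha>\<in>J. coeff x \<alpha> *\<^sub>R \<alpha>)"
      by (intro sum.mono_neutral_right) (use finite_base J in auto)
    then have "x \<in> span J"
      using coeff_sum[OF root_span[OF that(1)]] by (metis (no_types, lifting) span_sum span_scale span_base)
    then show False using that by simp
  qed
  have eq: "coeff (h \<beta>) \<gamma> = coeff \<beta> \<gamma>" if "\<gamma> \<in> \<Delta> - J" for \<gamma>
    using coeff_span_outside[OF J diff that, of \<beta>] hr b root_span by (simp add: coeff_simps)
  show "h \<beta> \<notin> span J"
    using diff b(2) span_diff[of "h \<beta>" J "h \<beta> - \<beta>"] by auto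
  obtain \<gamma> where g: "\<gamma> \<in> \<Delta> - J" "coeff \<beta> \<gamma> \<noteq> 0" using notJ b by blast
  show "h \<beta> \<in> Pos \<longleftrightarrow> \<beta> \<in> Pos"
  proof (cases "coeff \<beta> \<gamma> > 0")
    case True
    then show ?thesis using PosI[of \<beta> \<gamma>] PosI[of "h \<beta>" \<gamma>] eq g b hr by auto
  next
    case False
    then show ?thesis using eq[of \<gamma>] g by (force simp: Pos_def)
  qed
qed

lemma linear_image_Pos:
  assumes "\<beta> \<in> Pos" "linear w" "\<And>\<alpha>. \<alpha> \<in> J \<Longrightarrow> w \<alpha> \<in> Pos" "\<beta> \<in> span J" "J \<subseteq> \<Delta>" "w \<beta> \<in> \<Phi>"
  shows "w \<beta> \<in> Pos"
proof -
  have fJ: "finite J" using assms finite_base finite_subset by blast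
  have c: "coeff \<beta> \<alpha> = representation J \<beta> \<alpha>" if "\<alpha> \<in> \<Delta>" for \<alpha>
    using representation_extend[OF independent_base assms(4,5)] by simp
  have iJ: "independent J" using independent_base independent_mono assms(5) by blast
  have b: "(\<Sum>\<alpha>\<in>J. coeff \<beta> \<alpha> *\<^sub>R \<alpha>) = \<beta>"
    using sum_representation_eq[OF iJ assms(4) fJ] c assms(5) by (simp add: subset_iff)
  have "w (\<Sum>\<alpha>\<in>J. coeff \<beta> \<alpha> *\<^sub>R \<alpha>) = (\<Sum>\<alpha>\<in>J. coeff \<beta> \<alpha> *\<^sub>R w \<alpha>)"
    using assms(2) by (simp add: linear_cmul linear_sum)
  then have "w \<beta> = (\<Sum>\<alpha>\<in>J. coeff \<beta> \<alpha> *\<^sub>R w \<alpha>)" unfolding b .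
  then have "coeff (w \<beta>) \<gamma> = (\<Sum>\<alpha>\<in>J. coeff \<beta> \<alpha> * coeff (w \<alpha>) \<gamma>)" for \<gamma>
    using assms(3) root_span Pos_root
    by (simp add: representation_sum[OF independent_base] coeff_simps span_scale)
  moreover have "(\<Sum>\<alpha>\<in>J. coeff \<beta> \<alpha> * coeff (w \<alpha>) \<gamma>) \<ge> 0" if "\<gamma> \<in> \<Delta>" for \<gamma>
    using assms that by (intro sum_nonneg mult_nonneg_nonneg) (auto simp: Pos_def)
  ultimately show ?thesis using assms by (auto simp: Pos_def)
qed

text \<open>The right-hand side does not mention \<open>J\<close>: the length inside a parabolic
  subgroup is the restriction of the length of the whole group. Inversions of \<open>h\<close> lie
  in \<open>span J\<close>, so a nonempty inversion set forces a descent at some root of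
  \<open>J\<close>.\<close>

lemma parabolic_word_length:
  assumes J: "J \<subseteq> \<Delta>" and h: "h \<in> generated_group (reflection ` J)"
  shows "word_length (reflection ` J) h = card (N h)"
proof -
  let ?H = "generated_group (reflection ` J)"
  have HW: "g \<in> WG" if "g \<in> ?H" for g using that parabolic_subset[OF J] by blast
  have step: "\<exists>\<alpha>\<in>J. g \<alpha> \<notin> Pos" if g: "g \<in> ?H" "N g \<noteq> {}" for g
  proof (rule ccontr)
    assume n: "\<not> ?thesis"
    obtain \<beta> where b: "\<beta> \<in> Pos" "g \<beta> \<notin> Pos" using g by (auto simp: N_def)
    then have "\<beta> \<in> span J" using parabolic_complement_Pos(2)[OF J g(1)] Pos_root by blast
    then have "g \<beta> \<in> Pos"
      using linear_image_Pos[of \<beta> g J] n b WG_linear WG_root Pos_root HW g J by blast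
    then show False using b by simp
  qed
  show ?thesis
  proof (rule word_length_eqI(1)[where G = ?H])
    show "id \<in> ?H" by (rule generated_group_id)
    show "g \<circ> s \<in> ?H" if "g \<in> ?H" "s \<in> reflection ` J" for g s
      using that generated_group_comp generated_group_gen by blast
    show "s \<circ> s = id" if "s \<in> reflection ` J" for s
      using that reflection_involution by auto
    show "card (N id) = 0" by (simp add: N_def)
    show "h \<in> ?H" by fact
  next
    fix g assume g: "g \<in> ?H" "card (N g) = 0"
    then have Ng: "N g = {}" using finite_N by simp
    obtain fs where fs: "set fs \<subseteq> reflection ` J" "g = prod_fun fs" "length fs = word_length (reflection ` J) g"
      using word_length_attained[OF g(1)] by blast
    have "fs \<in> lists (reflection ` J)" using fs(1) by auto
    then obtain cs where cs: "cs \<in> lists J" "fs = map reflection cs" by (auto simp: lists_image)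
    \<comment> \<open>A nonempty shortest word would end in some \<open>\<alpha>\<close> that its
      remaining letters send to a negative root, and the exchange condition would shorten
      it.\<close>
    show "g = id"
    proof (cases cs rule: rev_cases)
      case Nil
      then show ?thesis using fs cs by simp
    next
      case (snoc as \<alpha>)
      then have a: "\<alpha> \<in> J" "set as \<subseteq> J" using cs by auto
      have g_eq: "g = prod_fun (map reflection as) \<circ> reflection \<alpha>"
        unfolding fs(2) cs(2) snoc by simp
      have "g \<alpha> \<in> Pos" using Ng a J simple_Pos by (auto simp: N_def)
      then have "prod_fun (map reflection as) \<alpha> \<notin> Pos"
      proof -
        have "prod_fun (map reflection as) \<in> ?H" unfolding generated_group_def using a
          by (intro CollectI exI[of _ "map reflection as"]) auto
        then have "g \<alpha> = - prod_fun (map reflection as) \<alpha>"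
          using g_eq a J reflection_simple_self WG_neg HW by auto
        then show ?thesis using \<open>g \<alpha> \<in> Pos\<close> Pos_not_neg by (metis minus_minus)
      qed
      then obtain bs where "set bs \<subseteq> set as" "Suc (length bs) = length as" "g = prod_fun (map reflection bs)"
        using exchange[of as \<alpha>] a J g_eq by auto
      moreover have "word_length (reflection ` J) (prod_fun (map reflection bs)) \<le> length (map reflection bs)"
        using calculation a by (intro word_length_le) auto
      ultimately show ?thesis using fs(3) cs(2) snoc by simp
    qed
  next
    fix g s assume g: "g \<in> ?H" "s \<in> reflection ` J"
    then obtain \<alpha> where a: "\<alpha> \<in> \<Delta>" "s = reflection \<alpha>" using J by blast
    show "card (N (g \<circ> s)) \<le> Suc (card (N g))"
    proof (cases "g \<alpha> \<in> Pos")
      case True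
      then show ?thesis using N_comp_simple(2)[OF HW[OF g(1)] a(1)] a(2) by simp
    next
      case False
      then show ?thesis using N_comp_simple_neg[OF HW[OF g(1)] a(1)] a(2) by simp
    qed
  next
    fix g assume g: "g \<in> ?H" "0 < card (N g)"
    then have "N g \<noteq> {}" by auto
    then obtain \<alpha> where "\<alpha> \<in> J" "g \<alpha> \<notin> Pos" using step g by blast
    then show "\<exists>s\<in>reflection ` J. Suc (card (N (g \<circ> s))) = card (N g)"
      using N_comp_simple_neg[OF HW[OF g(1)]] J by blast
  qed
qed

lemma simple_word_length: "w \<in> WG \<Longrightarrow> word_length (reflection ` \<Delta>) w = card (N w)"
  using parabolic_word_length[of \<Delta> w] by (simp add: WG_def)

lemma WG_eq_idI: "w \<in> WG \<Longrightarrow> N w = {} \<Longrightarrow> w = id"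
proof -
  assume w: "w \<in> WG" "N w = {}"
  then obtain fs where "w = prod_fun fs" "length fs = word_length (reflection ` \<Delta>) w"
    using word_length_attained unfolding WG_def by metis
  then show ?thesis using simple_word_length[OF w(1)] w(2) by simp
qed

text \<open>A root of minimal height in a Weyl orbit is simple.\<close>
lemma root_conjugate_simple:
  assumes "\<beta> \<in> Pos" shows "\<exists>w\<in>WG. \<exists>\<alpha>\<in>\<Delta>. \<beta> = w \<alpha>"
proof -
  let ?O = "{\<gamma> \<in> Pos. \<exists>w\<in>WG. \<beta> = w \<gamma>}" and ?ht = "\<lambda>\<gamma>. \<Sum>\<alpha>\<in>\<Delta>. coeff \<gamma> \<alpha>"
  have "\<beta> \<in> ?O" using assms WG_id by (auto intro: bexI[of _ id])
  then have ne: "finite (?ht ` ?O)" "?ht ` ?O \<noteq> {}" using finite_Pos by (auto intro: finite_imageI)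
  obtain \<gamma> where g: "\<gamma> \<in> ?O" "?ht \<gamma> = Min (?ht ` ?O)" using Min_in[OF ne] by (metis (no_types, lifting) imageE)
  have min: "?ht \<gamma> \<le> ?ht \<delta>" if "\<delta> \<in> ?O" for \<delta>
    using g(2) Min_le[OF ne(1)] that by auto
  obtain w where w: "w \<in> WG" "\<beta> = w \<gamma>" using g by blast
  have gr: "\<gamma> \<in> Pos" "\<gamma> \<in> \<Phi>" "\<gamma> \<in> span \<Delta>" using g Pos_root root_span by auto
  have "\<gamma> \<in> \<Delta>"
  proof (rule ccontr)
    assume nd: "\<gamma> \<notin> \<Delta>"
    \<comment> \<open>Expanding the positive number \<open>\<gamma> \<bullet> \<gamma>\<close> in
      simple roots produces an \<open>\<alpha>\<close> with positive coefficient and positive inner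
      product; reflecting in it lowers the height.\<close>
    have "\<gamma> \<bullet> \<gamma> = (\<Sum>\<alpha>\<in>\<Delta>. coeff \<gamma> \<alpha> * (\<gamma> \<bullet> \<alpha>))"
      using coeff_sum[OF gr(3)] inner_sum_right[of \<gamma> "\<lambda>\<alpha>. coeff \<gamma> \<alpha> *\<^sub>R \<alpha>" \<Delta>] by simp
    moreover have "\<gamma> \<bullet> \<gamma> > 0" using gr zero_not_root by auto
    ultimately have "0 < (\<Sum>\<alpha>\<in>\<Delta>. coeff \<gamma> \<alpha> * (\<gamma> \<bullet> \<alpha>))" by simp
    then have "\<not> (\<forall>\<alpha>\<in>\<Delta>. coeff \<gamma> \<alpha> * (\<gamma> \<bullet> \<alpha>) \<le> 0)"
      using sum_nonpos[of \<Delta> "\<lambda>\<alpha>. coeff \<gamma> \<alpha> * (\<gamma> \<bullet> \<alpha>)"] by (meson not_less)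
    then have "\<exists>\<alpha>\<in>\<Delta>. coeff \<gamma> \<alpha> * (\<gamma> \<bullet> \<alpha>) > 0" by (meson not_less)
    then obtain \<alpha> where a: "\<alpha> \<in> \<Delta>" "coeff \<gamma> \<alpha> * (\<gamma> \<bullet> \<alpha>) > 0" by blast
    then have pos: "\<gamma> \<bullet> \<alpha> > 0" using gr(1) by (auto simp: Pos_def zero_less_mult_iff not_less[symmetric])
    let ?d = "reflection \<alpha> \<gamma>"
    have "?d \<in> Pos" using reflection_simple_Pos a gr nd by metis
    moreover have "\<beta> = (w \<circ> reflection \<alpha>) ?d" using w by simp
    ultimately have "?d \<in> ?O" using WG_comp[OF w(1) WG_simple[OF a(1)]] by blast
    then have "?ht \<gamma> \<le> ?ht ?d" by (rule min)
    moreover have "?ht ?d = ?ht \<gamma> - 2 * (\<gamma> \<bullet> \<alpha>) / (\<alpha> \<bullet> \<alpha>)"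
    proof -
      have "?ht ?d = (\<Sum>\<delta>\<in>\<Delta>. coeff \<gamma> \<delta> - (if \<delta> = \<alpha> then 2 * (\<gamma> \<bullet> \<alpha>) / (\<alpha> \<bullet> \<alpha>) else 0))"
        using a gr by (intro sum.cong) (auto simp: reflection_def coeff_simps span_base span_scale coeff_simple)
      then show ?thesis using a finite_base by (simp add: sum_subtractf)
    qed
    moreover have "2 * (\<gamma> \<bullet> \<alpha>) / (\<alpha> \<bullet> \<alpha>) > 0"
    proof -
      have "\<alpha> \<noteq> 0" using a simple_root zero_not_root by blast
      then show ?thesis using pos by simp
    qed
    ultimately show False by linarith
  qed
  then show ?thesis using w by blast
qed

text \<open>A positive root is \<open>w \<alpha>\<close> with \<open>\<alpha>\<close> simple, so its
  reflection is the conjugate of a simple reflection by \<open>w\<close>; negative roots give the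
  same reflections.\<close>

lemma weyl_group_eq: "weyl_group \<Phi> = WG"
proof
  show "WG \<subseteq> weyl_group \<Phi>"
    unfolding WG_def weyl_group_def generated_group_def using simple_root by blast
  have pos: "reflection \<beta> \<in> WG" if b: "\<beta> \<in> Pos" for \<beta>
  proof -
    obtain w \<alpha> where w: "w \<in> WG" "\<alpha> \<in> \<Delta>" "\<beta> = w \<alpha>" using root_conjugate_simple[OF b] by blast
    have "reflection \<beta> x = (w \<circ> reflection \<alpha> \<circ> inv' w) x" for x
      using reflection_conj[OF WG_linear WG_inner, OF w(1) w(1), of \<alpha> "inv' w x"] w
        WG_bij[OF w(1)] by (simp add: bij_is_surj surj_f_inv_f)
    then have "reflection \<beta> = w \<circ> reflection \<alpha> \<circ> inv' w" by (simp only: fun_eq_iff) simp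
    then show ?thesis using w WG_comp WG_simple WG_inv by metis
  qed
  have gen: "s \<in> WG" if "s \<in> reflection ` \<Phi>" for s
    using that pos Pos_or_neg reflection_minus by (metis imageE)
  show "weyl_group \<Phi> \<subseteq> WG"
  proof
    fix w assume "w \<in> weyl_group \<Phi>"
    then show "w \<in> WG" unfolding weyl_group_def
    proof (induction rule: generated_group_induct)
      case (comp s w)
      then show ?case using WG_comp gen by blast
    qed (rule WG_id)
  qed
qed

lemma reflection_WG: "\<beta> \<in> \<Phi> \<Longrightarrow> reflection \<beta> \<in> WG"
  using weyl_group_eq unfolding weyl_group_def by (metis generated_group_gen image_eqI)

section \<open>Length and reduced words\<close>

definition len :: "('a \<Rightarrow> 'a) \<Rightarrow> nat" where "len w = card (N w)"

abbreviation simple_word :: "'a list \<Rightarrow> 'a \<Rightarrow> 'a" where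
  "simple_word as \<equiv> prod_fun (map reflection as)"

lemma simple_word_WG: "set as \<subseteq> \<Delta> \<Longrightarrow> simple_word as \<in> WG"
  unfolding WG_def generated_group_def by (intro CollectI exI[of _ "map reflection as"]) auto

lemma len_simple_word: "set as \<subseteq> \<Delta> \<Longrightarrow> len (simple_word as) \<le> length as"
  using word_length_le[of "map reflection as" "reflection ` \<Delta>"] simple_word_length[of "simple_word as"]
    simple_word_WG by (auto simp: len_def image_mono)

lemma reduced_word:
  assumes "w \<in> WG"
  obtains as where "set as \<subseteq> \<Delta>" "w = simple_word as" "length as = len w"
proof -
  obtain fs where fs: "set fs \<subseteq> reflection ` \<Delta>" "w = prod_fun fs" "length fs = word_length (reflection ` \<Delta>) w"
    using word_length_attained assms unfolding WG_def by metis
  have "fs \<in> lists (reflection ` \<Delta>)" using fs(1) by auto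
  then obtain as where "as \<in> lists \<Delta>" "fs = map reflection as" by (auto simp: lists_image)
  then show ?thesis using that[of as] fs simple_word_length[OF assms] by (auto simp: len_def)
qed

text \<open>Every element has a word of at most \<open>card Pos\<close> letters, because an
  inversion set consists of positive roots.\<close>

lemma finite_WG: "finite WG"
proof -
  have "WG \<subseteq> simple_word ` {as. set as \<subseteq> \<Delta> \<and> length as \<le> card Pos}"
  proof
    fix w assume "w \<in> WG"
    then obtain as where as: "set as \<subseteq> \<Delta>" "w = simple_word as" "length as = len w"
      by (rule reduced_word)
    have "len w \<le> card Pos" using finite_Pos unfolding len_def N_def by (intro card_mono) auto
    then show "w \<in> simple_word ` {as. set as \<subseteq> \<Delta> \<and> length as \<le> card Pos}" using as by auto
  qed
  moreover have "finite {as. set as \<subseteq> \<Delta> \<and> length as \<le> card Pos}"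
    using finite_lists_length_le[OF finite_base] by simp
  ultimately show ?thesis using finite_surj by blast
qed

lemma len_id: "len id = 0" by (simp add: len_def N_def)

lemma len_eq_0: "w \<in> WG \<Longrightarrow> len w = 0 \<Longrightarrow> w = id"
  using WG_eq_idI finite_N by (simp add: len_def)

lemma rev_word_inv:
  "simple_word (rev as) \<circ> simple_word as = id"
proof (induction as)
  case (Cons a as)
  have "simple_word (rev (a # as)) \<circ> simple_word (a # as) =
    simple_word (rev as) \<circ> (reflection a \<circ> (reflection a \<circ> simple_word as))"
    by (simp add: o_def)
  also have "\<dots> = id" using Cons comp_reflection_reflection by metis
  finally show ?case .
qed simp

lemma len_inv: assumes "w \<in> WG" shows "len (inv' w) = len w"
proof -
  have le: "len (inv' w) \<le> len w" if w: "w \<in> WG" for w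
  proof -
    obtain as where as: "set as \<subseteq> \<Delta>" "w = simple_word as" "length as = len w"
      using reduced_word[OF w] .
    have "inv' w = simple_word (rev as)"
      using rev_word_inv[of as] rev_word_inv[of "rev as"] as(2) inv_unique_comp[of w "simple_word (rev as)"]
      by simp
    then show ?thesis using len_simple_word[of "rev as"] as by simp
  qed
  show ?thesis using le[OF assms] le[OF WG_inv[OF assms]] inv_inv_eq[OF WG_bij[OF assms]] by simp
qed

lemma len_comp_simple:
  assumes "w \<in> WG" "\<alpha> \<in> \<Delta>"
  shows "len (w \<circ> reflection \<alpha>) = (if w \<alpha> \<in> Pos then Suc (len w) else len w - 1)"
    and "w \<alpha> \<notin> Pos \<Longrightarrow> len w > 0"
  using N_comp_simple(2)[OF assms] N_comp_simple_neg[OF assms] by (auto simp: len_def)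

lemma inv_comp_WG: "u \<in> WG \<Longrightarrow> v \<in> WG \<Longrightarrow> inv' (u \<circ> v) = inv' v \<circ> inv' u"
  using WG_bij o_inv_distrib by blast

lemma inv_reflection: "inv' (reflection \<alpha>) = reflection \<alpha>"
  using inv_unique_comp reflection_involution by blast

lemma len_simple_comp:
  assumes "w \<in> WG" "\<alpha> \<in> \<Delta>"
  shows "len (reflection \<alpha> \<circ> w) = (if inv' w \<alpha> \<in> Pos then Suc (len w) else len w - 1)"
    and "inv' w \<alpha> \<notin> Pos \<Longrightarrow> len w > 0"
proof -
  have "len (reflection \<alpha> \<circ> w) = len (inv' w \<circ> reflection \<alpha>)"
    using len_inv[of "reflection \<alpha> \<circ> w"] assms WG_comp WG_simple inv_comp_WG inv_reflection by metis
  then show "len (reflection \<alpha> \<circ> w) = (if inv' w \<alpha> \<in> Pos then Suc (len w) else len w - 1)"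
    using len_comp_simple(1)[OF WG_inv assms(2), OF assms(1)] len_inv[OF assms(1)] by simp
  show "inv' w \<alpha> \<notin> Pos \<Longrightarrow> len w > 0"
    using len_comp_simple(2)[OF WG_inv assms(2), OF assms(1)] len_inv[OF assms(1)] by simp
qed

section \<open>The longest element\<close>

definition w0 :: "'a \<Rightarrow> 'a" where "w0 = (SOME w. w \<in> WG \<and> len w = Max (len ` WG))"

text \<open>At an element of maximal length each simple root must become negative, since otherwise
  its reflection would lengthen the element; by linearity all positive roots become
  negative.\<close>

lemma w0: "w0 \<in> WG" "len w0 = card Pos" "\<beta> \<in> Pos \<Longrightarrow> - w0 \<beta> \<in> Pos"
proof -
  have "Max (len ` WG) \<in> len ` WG" using finite_WG WG_id by (intro Max_in) auto
  then have "\<exists>w. w \<in> WG \<and> len w = Max (len ` WG)" by auto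
  then have w: "w0 \<in> WG" "len w0 = Max (len ` WG)" unfolding w0_def by (metis (mono_tags, lifting) someI_ex)+
  then show "w0 \<in> WG" by simp
  have max: "len u \<le> len w0" if "u \<in> WG" for u using w finite_WG that by simp
  have simple: "w0 \<alpha> \<notin> Pos" if "\<alpha> \<in> \<Delta>" for \<alpha>
    using max[OF WG_comp[OF w(1) WG_simple[OF that]]] len_comp_simple(1)[OF w(1) that] by auto
  have neg: "- w0 \<beta> \<in> Pos" if b: "\<beta> \<in> Pos" for \<beta>
  proof -
    have "linear (\<lambda>x. - w0 x)" using WG_linear[OF w(1)] by (simp add: linear_compose_neg)
    moreover have "- w0 \<alpha> \<in> Pos" if "\<alpha> \<in> \<Delta>" for \<alpha>
      using simple[OF that] WG_root[OF w(1) simple_root[OF that]] Pos_iff by blast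
    moreover have "- w0 \<beta> \<in> \<Phi>" using WG_root[OF w(1)] b Pos_root uminus_root by blast
    ultimately show ?thesis
      using linear_image_Pos[OF b, of "\<lambda>x. - w0 x" \<Delta>] root_span[OF Pos_root[OF b]] by simp
  qed
  then show "\<beta> \<in> Pos \<Longrightarrow> - w0 \<beta> \<in> Pos" .
  have "N w0 = Pos" using neg Pos_not_neg by (fastforce simp: N_def)
  then show "len w0 = card Pos" by (simp add: len_def)
qed

text \<open>The map \<open>- w0\<close> permutes the positive roots and carries the inversions of
  \<open>w \<circ> w0\<close> onto the non-inversions of \<open>w\<close>.\<close>

lemma len_comp_w0:
  assumes "w \<in> WG" shows "len (w \<circ> w0) + len w = card Pos"
proof -
  let ?f = "\<lambda>\<beta>. - w0 \<beta>"
  have inj: "inj_on ?f Pos" using WG_bij[OF w0(1)] by (auto intro!: inj_onI simp: bij_is_inj inj_eq)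
  have img: "?f ` Pos = Pos"
    using w0(3) inj finite_Pos by (intro endo_inj_surj) auto
  have "?f ` N (w \<circ> w0) = Pos - N w"
  proof -
    have "\<beta> \<in> N (w \<circ> w0) \<longleftrightarrow> ?f \<beta> \<in> Pos - N w" if "\<beta> \<in> Pos" for \<beta>
      using that w0(3)[OF that] Pos_iff[OF WG_root[OF assms WG_root[OF w0(1) Pos_root[OF that]]]]
        WG_neg[OF assms] by (auto simp: N_def)
    then have "N (w \<circ> w0) = {\<beta> \<in> Pos. ?f \<beta> \<in> Pos - N w}" by (auto simp: N_def)
    moreover have "?f ` {\<beta> \<in> Pos. ?f \<beta> \<in> Pos - N w} = ?f ` Pos \<inter> (Pos - N w)" by blast
    ultimately show ?thesis unfolding img by blast
  qed
  then have "card (N (w \<circ> w0)) = card (Pos - N w)"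
    using inj by (metis (no_types, lifting) N_def card_image inj_on_subset mem_Collect_eq subsetI)
  moreover have "card (Pos - N w) = card Pos - card (N w)" "card (N w) \<le> card Pos"
    using finite_Pos finite_N by (auto simp: N_def intro!: card_Diff_subset card_mono)
  ultimately show ?thesis by (simp add: len_def)
qed

lemma w0_unique: assumes "w \<in> WG" "len w = card Pos" shows "w = w0"
proof -
  have "w \<circ> w0 = id" using len_comp_w0[OF assms(1)] assms len_eq_0 WG_comp w0(1) by simp
  moreover have "w0 \<circ> w0 = id" using len_comp_w0[OF w0(1)] w0 len_eq_0 WG_comp by simp
  ultimately show ?thesis by (metis comp_assoc comp_id id_comp)
qed

lemma w0_involution: "w0 \<circ> w0 = id"
  using len_comp_w0[OF w0(1)] w0 len_eq_0 WG_comp by simp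

text \<open>Minimality makes \<open>r\<close> keep the positive roots of \<open>span J\<close>
  positive. So the inversions of \<open>h\<close> lie inside \<open>span J\<close> and those of
  \<open>r\<close> outside it, and the inversions of \<open>r \<circ> h\<close> are those of
  \<open>h\<close> together with the images of those of \<open>r\<close> under
  \<open>inv' h\<close>.\<close>

lemma parabolic_length_additive:
  assumes J: "J \<subseteq> \<Delta>" and h: "h \<in> generated_group (reflection ` J)" and r: "r \<in> WG"
    and min: "\<forall>k\<in>generated_group (reflection ` J). len r \<le> len (r \<circ> k)"
  shows "len (r \<circ> h) = len r + len h"
proof -
  let ?H = "generated_group (reflection ` J)"
  have hW: "h \<in> WG" using h parabolic_subset[OF J] by blast
  have rJ: "r \<alpha> \<in> Pos" if "\<alpha> \<in> J" for \<alpha>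
    using that min generated_group_gen[of "reflection \<alpha>" "reflection ` J"] J
      len_comp_simple[OF r, of \<alpha>] by (force split: if_splits)
  have rspan: "r \<beta> \<in> Pos" if "\<beta> \<in> Pos" "\<beta> \<in> span J" for \<beta>
    using linear_image_Pos[OF that(1) WG_linear[OF r] rJ that(2) J] WG_root[OF r] Pos_root that by blast
  have hspan: "h \<beta> \<in> span J" if "\<beta> \<in> span J" "\<beta> \<in> \<Phi>" for \<beta>
  proof (rule ccontr)
    assume n: "h \<beta> \<notin> span J"
    have "inv' h (h \<beta>) \<notin> span J"
      using parabolic_complement_Pos(1)[OF J reflection_group_inv[OF h]] n WG_root[OF hW that(2)] by blast
    then show False using that WG_bij[OF hW] by (simp add: bij_is_inj)
  qed
  have NhJ: "\<beta> \<in> span J" if "\<beta> \<in> N h" for \<beta>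
    using that parabolic_complement_Pos(2)[OF J h, of \<beta>] Pos_root by (auto simp: N_def)
  have NrJ: "\<beta> \<notin> span J" if "\<beta> \<in> N r" for \<beta>
    using that rspan by (auto simp: N_def)
  have part1: "\<beta> \<in> N (r \<circ> h)" if b: "\<beta> \<in> N h" for \<beta>
  proof -
    have "h \<beta> \<in> \<Phi>" "- h \<beta> \<in> Pos" using b WG_root[OF hW] Pos_root Pos_iff by (auto simp: N_def)
    moreover have "- h \<beta> \<in> span J" using hspan NhJ[OF b] b Pos_root by (auto simp: N_def span_neg)
    ultimately have "r (- h \<beta>) \<in> Pos" using rspan by blast
    then have "r (h \<beta>) \<notin> Pos" using WG_neg[OF r] Pos_not_neg by metis
    then show ?thesis using b by (simp add: N_def)
  qed
  have part2: "inv' h \<gamma> \<in> N (r \<circ> h) - N h" if g: "\<gamma> \<in> N r" for \<gamma>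
  proof -
    have "inv' h \<gamma> \<in> Pos"
      using parabolic_complement_Pos(2)[OF J reflection_group_inv[OF h], of \<gamma>] g NrJ Pos_root
      by (auto simp: N_def)
    then show ?thesis using g WG_bij[OF hW] by (auto simp: N_def bij_is_surj surj_f_inv_f)
  qed
  have part3: "h \<beta> \<in> N r" if "\<beta> \<in> N (r \<circ> h) - N h" for \<beta>
    using that by (auto simp: N_def)
  have bb: "bij_betw h (N (r \<circ> h) - N h) (N r)"
    by (rule bij_betw_byWitness[where f' = "inv' h"])
      (use part2 part3 WG_bij[OF hW] in \<open>auto simp: bij_is_surj surj_f_inv_f bij_is_inj\<close>)
  have "card (N (r \<circ> h)) = card (N h) + card (N (r \<circ> h) - N h)"
    using part1 finite_N by (metis card_Diff_subset card_mono le_add_diff_inverse subsetI)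
  then show ?thesis using bij_betw_same_card[OF bb] by (simp add: len_def)
qed

end

section \<open>Polynomial functions\<close>

definition lin :: "'a::euclidean_space \<Rightarrow> 'a \<Rightarrow> real" where
  "lin u = (\<lambda>x. u \<bullet> x)"

lemma scaleR_fun_apply [simp]: "(c *\<^sub>R f) x = c *\<^sub>R f x"
  by (simp add: scaleR_fun_def)

lemma lin_linear: "lin (u + v) = lin u + lin v" "lin (c *\<^sub>R u) = c *\<^sub>R lin u" "lin (u - v) = lin u - lin v" "lin (- u) = - lin u"
  by (simp_all add: lin_def fun_eq_iff inner_add_left inner_diff_left)

lemma fun_mult_scaleR: "(c *\<^sub>R f) * g = c *\<^sub>R (f * g)" "f * (c *\<^sub>R g) = c *\<^sub>R (f * g)"
  for f g :: "'a \<Rightarrow> real"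
  by (simp_all add: fun_eq_iff)

lemma linear_mult_fun: "linear (\<lambda>f. g * f)" for g :: "'a \<Rightarrow> real"
  by (rule linearI) (simp_all add: distrib_left fun_mult_scaleR)

lemma linear_lin: "linear lin"
  by (rule linearI) (simp_all add: lin_linear)

lemma subspace_linear_preimage: "linear T \<Longrightarrow> subspace U \<Longrightarrow> subspace {x. T x \<in> U}"
  by (rule subspaceI) (auto simp: linear_0 linear_add linear_cmul subspace_0 subspace_add subspace_scale)

lemma linear_image_span_subspace:
  assumes "linear T" "subspace U" "\<And>b. b \<in> B \<Longrightarrow> T b \<in> U" "f \<in> span B"
  shows "T f \<in> U"
proof -
  have "span B \<subseteq> {x. T x \<in> U}"
    using assms by (intro span_minimal subspace_linear_preimage) auto
  then show ?thesis using assms by auto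
qed

lemma subspace_sym_power: "subspace (sym_power V k)" by (simp add: sym_power_def)

lemma subspace_sym_algebra: "subspace (sym_algebra V)" by (simp add: sym_algebra_def)

lemma sym_power_algebra: "f \<in> sym_power V k \<Longrightarrow> f \<in> sym_algebra V"
  unfolding sym_algebra_def by (auto intro: span_base)

lemma sym_power_0: "sym_power V 0 = range (\<lambda>c x. c)"
proof -
  have "sym_power V 0 = span {1}" by (simp add: sym_power_def one_fun_def)
  also have "\<dots> = range (\<lambda>c x. c)" unfolding span_singleton
    by (auto simp: fun_eq_iff image_iff)
  finally show ?thesis .
qed

lemma one_sym_power: "1 \<in> sym_power V 0" by (auto simp: sym_power_0 one_fun_def)

lemma one_sym_algebra: "1 \<in> sym_algebra V" using one_sym_power sym_power_algebra by blast

lemma lin_prod: "lin u * (\<lambda>x. \<Prod>i<k. v i \<bullet> x) = (\<lambda>x. \<Prod>i<Suc k. (v(k := u)) i \<bullet> x)"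
  by (simp add: fun_eq_iff lin_def mult.commute)

lemma lin_sym_power:
  assumes u: "u \<in> V" and f: "f \<in> sym_power V k"
  shows "lin u * f \<in> sym_power V (Suc k)"
proof (rule linear_image_span_subspace[OF linear_mult_fun subspace_sym_power _ f[unfolded sym_power_def]])
  fix b assume "b \<in> {\<lambda>x. \<Prod>i<k. v i \<bullet> x |v. \<forall>i<k. v i \<in> V}"
  then obtain v where v: "b = (\<lambda>x. \<Prod>i<k. v i \<bullet> x)" "\<forall>i<k. v i \<in> V" by blast
  have "\<forall>i<Suc k. (v(k := u)) i \<in> V" using v u by (simp add: less_Suc_eq)
  then show "lin u * b \<in> sym_power V (Suc k)"
    unfolding v(1) lin_prod sym_power_def by (intro span_base) blast
qed

lemma sym_power_Suc_induct [consumes 1, case_names subspace mult]: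
  assumes f: "f \<in> sym_power V (Suc k)" and P: "subspace {f. P f}"
    and step: "\<And>u f. u \<in> V \<Longrightarrow> f \<in> sym_power V k \<Longrightarrow> P (lin u * f)"
  shows "P f"
proof -
  have "f \<in> span {\<lambda>x. \<Prod>i<Suc k. v i \<bullet> x |v. \<forall>i<Suc k. v i \<in> V}" using f unfolding sym_power_def .
  moreover have "{\<lambda>x. \<Prod>i<Suc k. v i \<bullet> x |v. \<forall>i<Suc k. v i \<in> V} \<subseteq> {f. P f}"
  proof clarify
    fix v :: "nat \<Rightarrow> 'a" assume v: "\<forall>i<Suc k. v i \<in> V"
    have "(\<lambda>x. \<Prod>i<k. v i \<bullet> x) \<in> sym_power V k"
      unfolding sym_power_def using v by (intro span_base) auto
    then have "P (lin (v k) * (\<lambda>x. \<Prod>i<k. v i \<bullet> x))" using step v by simp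
    then show "P (\<lambda>x. \<Prod>i<Suc k. v i \<bullet> x)" by (simp add: lin_prod fun_upd_idem)
  qed
  ultimately show ?thesis using span_minimal[OF _ P] by blast
qed

lemma sym_algebra_sym_power_induct:
  assumes f: "f \<in> sym_algebra V" and P: "subspace {f. P f}"
    and step: "\<And>k f. f \<in> sym_power V k \<Longrightarrow> P f"
  shows "P f"
  using f span_minimal[OF _ P, of "\<Union>k. sym_power V k"] step unfolding sym_algebra_def by blast

lemma sym_algebra_induct [consumes 1, case_names subspace one mult]:
  assumes f: "f \<in> sym_algebra V" and P: "subspace {f. P f}" and one: "P 1"
    and step: "\<And>u f. u \<in> V \<Longrightarrow> f \<in> sym_algebra V \<Longrightarrow> P f \<Longrightarrow> P (lin u * f)"
  shows "P f"
  using f P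
proof (rule sym_algebra_sym_power_induct)
  fix k f assume "f \<in> sym_power V k"
  then show "P f"
  proof (induction k arbitrary: f)
    case 0
    then obtain c where "f = c *\<^sub>R 1" by (auto simp: sym_power_0 fun_eq_iff)
    then show ?case using subspace_scale[OF P, of 1 c] one by blast
  next
    case (Suc k)
    from Suc.prems P show ?case
      by (rule sym_power_Suc_induct) (use Suc.IH step sym_power_algebra in blast)
  qed
qed

lemma mult_sym_power:
  assumes f: "f \<in> sym_power V k" and g: "g \<in> sym_power V m"
  shows "f * g \<in> sym_power V (k + m)"
  using f
proof (induction k arbitrary: f)
  case 0
  then obtain c where "f = c *\<^sub>R 1" by (auto simp: sym_power_0 fun_eq_iff)
  then have "f * g = c *\<^sub>R g" by (metis fun_mult_scaleR(1) mult_1)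
  then show ?case using subspace_scale[OF subspace_sym_power g] by (metis add_0)
next
  case (Suc k)
  have "subspace {f. f * g \<in> sym_power V (Suc k + m)}"
    using subspace_linear_preimage[OF linear_mult_fun subspace_sym_power, of g]
    by (simp add: mult.commute)
  with Suc.prems show ?case
  proof (rule sym_power_Suc_induct)
    fix u f assume "u \<in> V" "f \<in> sym_power V k"
    then have "lin u * (f * g) \<in> sym_power V (Suc (k + m))" using Suc.IH lin_sym_power by blast
    then show "lin u * f * g \<in> sym_power V (Suc k + m)" by (simp add: mult.assoc)
  qed
qed

lemma mult_sym_algebra:
  assumes f: "f \<in> sym_algebra V" and g: "g \<in> sym_algebra V"
  shows "f * g \<in> sym_algebra V"
proof (rule sym_algebra_sym_power_induct[OF f])
  show "subspace {f. f * g \<in> sym_algebra V}"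
    using subspace_linear_preimage[OF linear_mult_fun subspace_sym_algebra, of g]
    by (simp add: mult.commute)
  fix k f assume f: "f \<in> sym_power V k"
  show "f * g \<in> sym_algebra V"
  proof (rule sym_algebra_sym_power_induct[OF g])
    show "subspace {g. f * g \<in> sym_algebra V}"
      using subspace_linear_preimage[OF linear_mult_fun subspace_sym_algebra, of f] .
    fix m g assume "g \<in> sym_power V m"
    then show "f * g \<in> sym_algebra V" using mult_sym_power[OF f] sym_power_algebra by blast
  qed
qed

lemma lin_sym_algebra: "u \<in> V \<Longrightarrow> lin u \<in> sym_algebra V"
  using lin_sym_power[OF _ one_sym_power, of u V] sym_power_algebra by simp

text \<open>Evaluation at \<open>0\<close> extracts the constant term; scalar coordinates of
  polynomial functions are read off in this way later.\<close>

lemma sym_power_at_0: "f \<in> sym_power V k \<Longrightarrow> 0 < k \<Longrightarrow> f 0 = 0"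
proof (cases k)
  case (Suc m)
  assume "f \<in> sym_power V k"
  then have "f \<in> sym_power V (Suc m)" using Suc by simp
  then show ?thesis
  proof (induction rule: sym_power_Suc_induct)
    case subspace
    then show ?case by (rule subspaceI) auto
  qed (simp add: lin_def)
qed simp

lemma sym_power_finite_dim:
  assumes "subspace V"
  shows "\<exists>X. finite X \<and> sym_power V k \<subseteq> span X"
proof (induction k)
  case 0
  show ?case
    by (rule exI[of _ "{1}"]) (auto simp: sym_power_0 span_singleton fun_eq_iff image_iff)
next
  case (Suc k)
  then obtain X where X: "finite X" "sym_power V k \<subseteq> span X" by blast
  obtain B where B: "finite B" "V \<subseteq> span B" using basis_exists by (metis finiteI_independent)
  let ?Y = "(\<lambda>(b, f). lin b * f) ` (B \<times> X)"
  have bX: "lin b * f \<in> span ?Y" if "b \<in> B" "f \<in> span X" for b f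
    by (rule linear_image_span_subspace[OF linear_mult_fun subspace_span _ that(2)])
      (use that in \<open>auto intro!: span_base\<close>)
  have "lin u * f \<in> span ?Y" if u: "u \<in> span B" and f: "f \<in> span X" for u f
  proof -
    have "linear (\<lambda>u. lin u * f)"
      by (rule linearI) (simp_all add: lin_linear distrib_right fun_mult_scaleR)
    then show ?thesis
      by (rule linear_image_span_subspace[OF _ subspace_span _ u]) (use bX f in blast)
  qed
  then have "f \<in> span ?Y" if "f \<in> sym_power V (Suc k)" for f
    by (intro sym_power_Suc_induct[OF that, where P = "\<lambda>f. f \<in> span ?Y"]) (use X B in auto)
  then show ?case using X B by (intro exI[of _ ?Y]) auto
qed

lemma sym_algebra_continuous: "f \<in> sym_algebra V \<Longrightarrow> continuous_on UNIV f"
proof (induction rule: sym_algebra_induct)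
  case subspace
  show ?case by (rule subspaceI) (auto simp: plus_fun_def scaleR_fun_def zero_fun_def intro!: continuous_intros)
next
  case one
  show ?case by (auto simp: one_fun_def)
next
  case (mult u f)
  then show ?case by (auto simp: times_fun_def lin_def intro!: continuous_intros)
qed

text \<open>Polynomials are represented as functions, so cancellation is an analytic argument:
  \<open>g\<close> vanishes off the hyperplane orthogonal to \<open>\<alpha>\<close>, and continuity
  along the direction \<open>\<alpha>\<close> covers the hyperplane.\<close>

lemma lin_mult_cancel:
  assumes g: "g \<in> sym_algebra V" and a: "\<alpha> \<noteq> 0" and z: "lin \<alpha> * g = 0"
  shows "g = 0"
proof
  fix x
  let ?h = "\<lambda>t::real. g (x + t *\<^sub>R \<alpha>)"
  have "continuous_on UNIV ?h"
    by (rule continuous_on_compose2[OF sym_algebra_continuous[OF g]]) (auto intro!: continuous_intros)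
  then have "isCont ?h 0" by (simp add: continuous_on_eq_continuous_at)
  then have lim: "?h \<midarrow>0\<rightarrow> ?h 0" unfolding isCont_def .
  \<comment> \<open>The line through \<open>x\<close> meets the hyperplane at one parameter only. If
    that parameter is 0 any radius will do; otherwise the radius is its absolute value.\<close>
  let ?e = "if \<alpha> \<bullet> x = 0 then 1 else \<bar>\<alpha> \<bullet> x\<bar> / (\<alpha> \<bullet> \<alpha>)"
  have aa: "\<alpha> \<bullet> \<alpha> > 0" using a by simp
  have "?h t = 0" if t: "t \<noteq> 0" "\<bar>t\<bar> < ?e" for t
  proof -
    have "\<alpha> \<bullet> (x + t *\<^sub>R \<alpha>) \<noteq> 0"
    proof
      assume "\<alpha> \<bullet> (x + t *\<^sub>R \<alpha>) = 0"
      then have "\<alpha> \<bullet> x = - t * (\<alpha> \<bullet> \<alpha>)" by (simp add: inner_add_right)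
      then show False using t aa by (auto simp: abs_mult split: if_splits)
    qed
    moreover have "(lin \<alpha> * g) (x + t *\<^sub>R \<alpha>) = 0" using z by simp
    ultimately show ?thesis by (simp add: lin_def)
  qed
  moreover have "?e > 0" using aa by auto
  ultimately have "eventually (\<lambda>t. ?h t = 0) (at 0)"
    unfolding eventually_at by (intro exI[of _ ?e]) (auto simp: dist_real_def)
  then have "?h \<midarrow>0\<rightarrow> 0" by (simp add: tendsto_eventually)
  then show "g x = 0 x" using LIM_unique[OF lim] by simp
qed

section \<open>The group action on polynomial functions\<close>

lemma act_add: "act w (f + g) = act w f + act w g" "act w (f - g) = act w f - act w g"
  "act w (f * g) = act w f * act w g" "act w (c *\<^sub>R f) = c *\<^sub>R act w f" "act w 1 = 1" "act w 0 = 0"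
  by (simp_all add: act_def fun_eq_iff)

lemma linear_act: "linear (act w)" by (rule linearI) (simp_all add: act_add)

lemma act_id [simp]: "act id f = f" by (simp add: act_def)

lemma act_comp: "bij w \<Longrightarrow> bij u \<Longrightarrow> act (w \<circ> u) f = act w (act u f)"
  by (simp add: act_def o_inv_distrib comp_assoc)

lemma act_lin:
  assumes "bij w" "\<And>x y. w x \<bullet> w y = x \<bullet> y"
  shows "act w (lin u) = lin (w u)"
proof
  fix x
  have "u \<bullet> inv' w x = w u \<bullet> w (inv' w x)" using assms by simp
  then show "act w (lin u) x = lin (w u) x"
    using assms(1) by (simp add: act_def lin_def bij_is_surj surj_f_inv_f)
qed

lemma act_sym_power:
  assumes w: "bij w" "\<And>x y. w x \<bullet> w y = x \<bullet> y" "w ` V \<subseteq> V" and f: "f \<in> sym_power V k"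
  shows "act w f \<in> sym_power V k"
  using f
proof (induction k arbitrary: f)
  case 0
  then show ?case by (auto simp: sym_power_0 act_def fun_eq_iff)
next
  case (Suc k)
  from Suc.prems show ?case
  proof (induction rule: sym_power_Suc_induct)
    case subspace
    show ?case using subspace_linear_preimage[OF linear_act subspace_sym_power] .
  next
    case (mult u f)
    then have "lin (w u) * act w f \<in> sym_power V (Suc k)" using Suc.IH w by (intro lin_sym_power) auto
    then show ?case unfolding act_add act_lin[OF w(1,2)] .
  qed
qed

lemma act_sym_algebra:
  assumes w: "bij w" "\<And>x y. w x \<bullet> w y = x \<bullet> y" "w ` V \<subseteq> V" and f: "f \<in> sym_algebra V"
  shows "act w f \<in> sym_algebra V"
  by (rule sym_algebra_sym_power_induct[OF f subspace_linear_preimage[OF linear_act subspace_sym_algebra]])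
    (use act_sym_power[OF w] sym_power_algebra in blast)

section \<open>Divided differences\<close>

context based_roots begin

abbreviation V where "V \<equiv> span \<Phi>"
abbreviation A where "A \<equiv> sym_algebra V"
abbreviation P where "P \<equiv> sym_power V"

lemma WG_V: "w \<in> WG \<Longrightarrow> w ` V \<subseteq> V"
  using WG_root span_mono[of "w ` \<Phi>" \<Phi>] linear_span_image[OF WG_linear, of w \<Phi>] by blast

lemma WG_act_P: "w \<in> WG \<Longrightarrow> f \<in> P k \<Longrightarrow> act w f \<in> P k"
  by (intro act_sym_power WG_V WG_bij WG_inner)

lemma WG_act_A: "w \<in> WG \<Longrightarrow> f \<in> A \<Longrightarrow> act w f \<in> A"
  by (intro act_sym_algebra WG_V WG_bij WG_inner)

lemma WG_act_lin: "w \<in> WG \<Longrightarrow> act w (lin u) = lin (w u)"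
  by (intro act_lin WG_bij WG_inner)

lemma WG_act_comp: "w \<in> WG \<Longrightarrow> w' \<in> WG \<Longrightarrow> act (w \<circ> w') f = act w (act w' f)"
  by (intro act_comp WG_bij)

lemmas A_closed = subspace_add[OF subspace_sym_algebra] subspace_scale[OF subspace_sym_algebra]
  subspace_diff[OF subspace_sym_algebra] subspace_0[OF subspace_sym_algebra]
  mult_sym_algebra lin_sym_algebra one_sym_algebra

abbreviation ref where "ref \<alpha> \<equiv> act (reflection \<alpha>)"

abbreviation pair :: "'a \<Rightarrow> 'a \<Rightarrow> real" where "pair u \<alpha> \<equiv> 2 * (u \<bullet> \<alpha>) / (\<alpha> \<bullet> \<alpha>)"

text \<open>The operator that divides \<open>f - ref \<alpha> f\<close> by \<open>\<alpha>\<close>.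
  The description is meaningful for a root \<open>\<alpha>\<close> and \<open>f \<in> A\<close>, by
  \<open>dd_exists\<close> and \<open>dd_unique\<close>.\<close>

definition dd :: "'a \<Rightarrow> ('a \<Rightarrow> real) \<Rightarrow> 'a \<Rightarrow> real" where
  "dd \<alpha> f = (THE g. g \<in> A \<and> lin \<alpha> * g = f - ref \<alpha> f)"

lemma ref_lin: "ref \<alpha> (lin u) = lin (reflection \<alpha> u)"
  using act_lin[of "reflection \<alpha>"] reflection_inner[of \<alpha>] reflection_involution[of \<alpha>] o_bij by blast

lemma reflection_V: "\<alpha> \<in> \<Phi> \<Longrightarrow> u \<in> V \<Longrightarrow> reflection \<alpha> u \<in> V"
  using WG_V reflection_WG by blast

text \<open>The twisted product rule, kept multiplied by \<open>lin \<alpha>\<close> so that it can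
  serve in proving that the quotient exists.\<close>

lemma dd_leibniz_step:
  assumes "lin \<alpha> * g = f - ref \<alpha> f"
  shows "lin \<alpha> * (pair u \<alpha> *\<^sub>R f + lin (reflection \<alpha> u) * g) = lin u * f - ref \<alpha> (lin u * f)"
proof -
  have u: "lin u = lin (reflection \<alpha> u) + pair u \<alpha> *\<^sub>R lin \<alpha>"
    by (simp add: reflection_def flip: lin_linear)
  have "lin u * f - ref \<alpha> (lin u * f) = lin u * f - lin (reflection \<alpha> u) * ref \<alpha> f"
    by (simp add: act_add ref_lin)
  also have "\<dots> = pair u \<alpha> *\<^sub>R (lin \<alpha> * f) + lin (reflection \<alpha> u) * (f - ref \<alpha> f)"
    by (subst (1) u) (simp add: algebra_simps fun_mult_scaleR)
  also have "\<dots> = lin \<alpha> * (pair u \<alpha> *\<^sub>R f + lin (reflection \<alpha> u) * g)"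
    unfolding assms[symmetric] by (simp add: algebra_simps fun_mult_scaleR)
  finally show ?thesis ..
qed

lemma dd_unique:
  assumes "\<alpha> \<in> \<Phi>" "g \<in> A" "h \<in> A" "lin \<alpha> * g = lin \<alpha> * h" shows "g = h"
proof -
  have "lin \<alpha> * (g - h) = 0" using assms(4) by (simp add: right_diff_distrib)
  then have "g - h = 0"
    using lin_mult_cancel[OF subspace_diff[OF subspace_sym_algebra assms(2,3)]] assms(1) zero_not_root by metis
  then show ?thesis by simp
qed

lemma dd_exists:
  assumes a: "\<alpha> \<in> \<Phi>" and f: "f \<in> A" shows "\<exists>g. g \<in> A \<and> lin \<alpha> * g = f - ref \<alpha> f"
  using f
proof (induction rule: sym_algebra_induct)
  case subspace
  show ?case
  proof (rule subspaceI, goal_cases)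
    case 1
    have "lin \<alpha> * 0 = 0 - ref \<alpha> 0" unfolding act_add by (metis diff_self mult_zero_right)
    then show ?case using A_closed(4) by blast
  next
    case (2 f f')
    then obtain g g' where "g \<in> A" "lin \<alpha> * g = f - ref \<alpha> f" "g' \<in> A" "lin \<alpha> * g' = f' - ref \<alpha> f'"
      unfolding mem_Collect_eq by metis
    then have "g + g' \<in> A" "lin \<alpha> * (g + g') = f + f' - ref \<alpha> (f + f')"
      by (auto intro: A_closed simp: act_add distrib_left)
    then show ?case by blast
  next
    case (3 c f)
    then obtain g where "g \<in> A" "lin \<alpha> * g = f - ref \<alpha> f" unfolding mem_Collect_eq by metis
    then have "c *\<^sub>R g \<in> A" "lin \<alpha> * (c *\<^sub>R g) = c *\<^sub>R f - ref \<alpha> (c *\<^sub>R f)"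
      by (auto intro: A_closed simp: act_add fun_mult_scaleR scaleR_diff_right)
    then show ?case by blast
  qed
next
  case one
  have "lin \<alpha> * 0 = (1 :: 'a \<Rightarrow> real) - ref \<alpha> 1" unfolding act_add by (metis diff_self mult_zero_right)
  then show ?case using A_closed(4) by blast
next
  case (mult u f)
  then obtain g where g: "g \<in> A" "lin \<alpha> * g = f - ref \<alpha> f" by blast
  have "pair u \<alpha> *\<^sub>R f + lin (reflection \<alpha> u) * g \<in> A"
    using mult g reflection_V[OF a] by (intro A_closed) auto
  then show ?case using dd_leibniz_step[OF g(2)] by blast
qed

lemma dd_spec: "\<alpha> \<in> \<Phi> \<Longrightarrow> f \<in> A \<Longrightarrow> dd \<alpha> f \<in> A \<and> lin \<alpha> * dd \<alpha> f = f - ref \<alpha> f"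
proof -
  assume a: "\<alpha> \<in> \<Phi>" "f \<in> A"
  have "\<exists>!g. g \<in> A \<and> lin \<alpha> * g = f - ref \<alpha> f"
    by (rule ex_ex1I[OF dd_exists[OF a]], rule dd_unique[OF a(1)]) auto
  from theI'[OF this] show ?thesis unfolding dd_def .
qed

lemma dd_A: "\<alpha> \<in> \<Phi> \<Longrightarrow> f \<in> A \<Longrightarrow> dd \<alpha> f \<in> A" using dd_spec by blast

lemma dd_eqI:
  "\<alpha> \<in> \<Phi> \<Longrightarrow> f \<in> A \<Longrightarrow> g \<in> A \<Longrightarrow> lin \<alpha> * g = f - ref \<alpha> f \<Longrightarrow> dd \<alpha> f = g"
  using dd_spec dd_unique by metis

lemma dd_add: "\<alpha> \<in> \<Phi> \<Longrightarrow> f \<in> A \<Longrightarrow> g \<in> A \<Longrightarrow> dd \<alpha> (f + g) = dd \<alpha> f + dd \<alpha> g"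
  using dd_spec by (intro dd_eqI A_closed) (auto simp: act_add distrib_left)

lemma dd_scale: "\<alpha> \<in> \<Phi> \<Longrightarrow> f \<in> A \<Longrightarrow> dd \<alpha> (c *\<^sub>R f) = c *\<^sub>R dd \<alpha> f"
  using dd_spec by (intro dd_eqI A_closed) (auto simp: act_add fun_mult_scaleR scaleR_diff_right)

lemma dd_lin_mult:
  assumes "\<alpha> \<in> \<Phi>" "f \<in> A" "u \<in> V"
  shows "dd \<alpha> (lin u * f) = pair u \<alpha> *\<^sub>R f + lin (reflection \<alpha> u) * dd \<alpha> f"
  using dd_spec[OF assms(1,2)] assms reflection_V
  by (intro dd_eqI dd_leibniz_step A_closed) auto

lemma dd_invariant_mult:
  assumes "\<alpha> \<in> \<Phi>" "f \<in> A" "p \<in> A" "ref \<alpha> p = p"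
  shows "dd \<alpha> (p * f) = p * dd \<alpha> f"
proof (rule dd_eqI)
  have "lin \<alpha> * (p * dd \<alpha> f) = p * (lin \<alpha> * dd \<alpha> f)" by (simp add: ac_simps)
  also have "\<dots> = p * f - ref \<alpha> (p * f)" using dd_spec[OF assms(1,2)] assms(4) by (simp add: act_add right_diff_distrib)
  finally show "lin \<alpha> * (p * dd \<alpha> f) = p * f - ref \<alpha> (p * f)" .
qed (use assms dd_A in \<open>auto intro: A_closed\<close>)

lemma dd_eq_0_iff: "\<alpha> \<in> \<Phi> \<Longrightarrow> f \<in> A \<Longrightarrow> dd \<alpha> f = 0 \<longleftrightarrow> ref \<alpha> f = f"
  using dd_spec[of \<alpha> f] dd_eqI[of \<alpha> f 0] A_closed(4) by (metis eq_iff_diff_eq_0 mult_zero_right)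

lemma dd_0: "\<alpha> \<in> \<Phi> \<Longrightarrow> dd \<alpha> 0 = 0" by (subst dd_eq_0_iff) (auto simp: act_add A_closed)

lemma dd_degree_0: "\<alpha> \<in> \<Phi> \<Longrightarrow> f \<in> P 0 \<Longrightarrow> dd \<alpha> f = 0"
  by (subst dd_eq_0_iff) (auto simp: sym_power_algebra, auto simp: sym_power_0 act_def fun_eq_iff)

text \<open>Applying the reflection changes the sign of both \<open>lin \<alpha>\<close> and
  \<open>f - ref \<alpha> f\<close>. Their quotient is therefore invariant and is killed by a second
  application.\<close>

lemma dd_dd:
  assumes "\<alpha> \<in> \<Phi>" "f \<in> A" shows "dd \<alpha> (dd \<alpha> f) = 0"
proof -
  have "lin \<alpha> * ref \<alpha> (dd \<alpha> f) = - ref \<alpha> (lin \<alpha> * dd \<alpha> f)"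
  proof -
    have "\<alpha> \<noteq> 0" using assms zero_not_root by blast
    then show ?thesis unfolding act_add ref_lin reflection_self[OF \<open>\<alpha> \<noteq> 0\<close>] lin_linear by simp
  qed
  also have "\<dots> = f - ref \<alpha> f"
    using dd_spec[OF assms] WG_act_comp[of "reflection \<alpha>" "reflection \<alpha>" f] assms(1)
    by (simp add: act_add reflection_WG reflection_involution)
  finally have "ref \<alpha> (dd \<alpha> f) = dd \<alpha> f"
    using dd_eqI[OF assms] dd_A[OF assms] WG_act_A reflection_WG assms(1) by metis
  then show ?thesis using dd_eq_0_iff dd_A assms by blast
qed

lemma dd_lin_on: "\<alpha> \<in> \<Phi> \<Longrightarrow> lin_on A (dd \<alpha>)"
  by (simp add: lin_on_def dd_add dd_scale)

lemma dd_degree: "\<alpha> \<in> \<Phi> \<Longrightarrow> f \<in> P (Suc k) \<Longrightarrow> dd \<alpha> f \<in> P k"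
proof (induction k arbitrary: f)
  case 0
  have "f \<in> A \<and> dd \<alpha> f \<in> P 0" using 0(2)
  proof (induction rule: sym_power_Suc_induct)
    case subspace
    show ?case by (rule subspace_lin_on_preimage[OF dd_lin_on[OF 0(1)] subspace_sym_algebra subspace_sym_power])
  next
    case (mult u f)
    then have f: "f \<in> A" using sym_power_algebra by blast
    have "dd \<alpha> (lin u * f) = pair u \<alpha> *\<^sub>R f"
      using dd_lin_mult[OF 0(1) f mult(1)] dd_degree_0[OF 0(1) mult(2)] by simp
    then show ?case using subspace_scale[OF subspace_sym_power mult(2)] A_closed(5)[OF A_closed(6)[OF mult(1)] f] by metis
  qed
  then show ?case by simp
next
  case (Suc k)
  have "f \<in> A \<and> dd \<alpha> f \<in> P (Suc k)" using Suc(3)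
  proof (induction rule: sym_power_Suc_induct)
    case subspace
    show ?case by (rule subspace_lin_on_preimage[OF dd_lin_on[OF Suc(2)] subspace_sym_algebra subspace_sym_power])
  next
    case (mult u f)
    then have f: "f \<in> A" using sym_power_algebra by blast
    have "pair u \<alpha> *\<^sub>R f + lin (reflection \<alpha> u) * dd \<alpha> f \<in> P (Suc k)"
      using mult Suc.IH[OF Suc(2)] reflection_V[OF Suc(2)]
      by (intro subspace_add[OF subspace_sym_power] subspace_scale[OF subspace_sym_power] lin_sym_power) auto
    then show ?case using dd_lin_mult[OF Suc(2) f mult(1)] A_closed(5)[OF A_closed(6)[OF mult(1)] f] by metis
  qed
  then show ?case by simp
qed

end

lemma sum_fun_apply: "(\<Sum>i\<in>I. F i) x = (\<Sum>i\<in>I. F i x)"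
  for F :: "'i \<Rightarrow> 'a \<Rightarrow> real"
  by (induction I rule: infinite_finite_induct) auto

section \<open>The nil Hecke operators\<close>

context based_roots begin

definition dd_word :: "'a list \<Rightarrow> ('a \<Rightarrow> real) \<Rightarrow> 'a \<Rightarrow> real" where
  "dd_word as f = foldr dd as f"

lemma dd_word_simps: "dd_word [] f = f" "dd_word (\<alpha> # as) f = dd \<alpha> (dd_word as f)" "dd_word (as @ bs) f = dd_word as (dd_word bs f)"
  by (simp_all add: dd_word_def)

lemma dd_word_A: "set as \<subseteq> \<Delta> \<Longrightarrow> f \<in> A \<Longrightarrow> dd_word as f \<in> A"
  by (induction as) (auto simp: dd_word_simps dd_A simple_root)

lemma dd_word_add: "set as \<subseteq> \<Delta> \<Longrightarrow> f \<in> A \<Longrightarrow> g \<in> A \<Longrightarrow> dd_word as (f + g) = dd_word as f + dd_word as g"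
proof (induction as)
  case (Cons a as)
  have a: "a \<in> \<Phi>" "set as \<subseteq> \<Delta>" using Cons.prems simple_root by auto
  have "dd a (dd_word as (f + g)) = dd a (dd_word as f) + dd a (dd_word as g)"
    using Cons.IH[OF a(2) Cons.prems(2,3)] dd_add[OF a(1) dd_word_A[OF a(2) Cons.prems(2)] dd_word_A[OF a(2) Cons.prems(3)]]
    by (rule trans[OF arg_cong[where f = "dd a"]])
  then show ?case unfolding dd_word_simps .
qed (simp only: dd_word_simps)

lemma dd_word_scale: "set as \<subseteq> \<Delta> \<Longrightarrow> f \<in> A \<Longrightarrow> dd_word as (c *\<^sub>R f) = c *\<^sub>R dd_word as f"
proof (induction as)
  case (Cons a as)
  have a: "a \<in> \<Phi>" "set as \<subseteq> \<Delta>" using Cons.prems simple_root by auto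
  have "dd a (dd_word as (c *\<^sub>R f)) = c *\<^sub>R dd a (dd_word as f)"
    using Cons.IH[OF a(2) Cons.prems(2)] dd_scale[OF a(1) dd_word_A[OF a(2) Cons.prems(2)], of c]
    by (rule trans[OF arg_cong[where f = "dd a"]])
  then show ?case unfolding dd_word_simps .
qed (simp only: dd_word_simps)

lemma dd_word_zero: assumes "set as \<subseteq> \<Delta>" shows "dd_word as 0 = 0"
  using dd_word_scale[OF assms A_closed(4), of 0] by simp

lemma dd_word_lin_on: "set as \<subseteq> \<Delta> \<Longrightarrow> lin_on A (dd_word as)"
  by (simp add: lin_on_def dd_word_add dd_word_scale)

lemma dd_word_degree: "set as \<subseteq> \<Delta> \<Longrightarrow> f \<in> P k \<Longrightarrow>
    (length as \<le> k \<longrightarrow> dd_word as f \<in> P (k - length as)) \<and> (k < length as \<longrightarrow> dd_word as f = 0)"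
proof (induction as)
  case (Cons a as)
  then have a: "a \<in> \<Phi>" using simple_root by auto
  have IH: "length as \<le> k \<Longrightarrow> dd_word as f \<in> P (k - length as)" "k < length as \<Longrightarrow> dd_word as f = 0"
    using Cons by auto
  consider "length as < k" | "length as = k" | "k < length as" by linarith
  then show ?case
  proof cases
    case 1
    then have "dd_word as f \<in> P (Suc (k - length (a # as)))" using IH(1) by (simp add: Suc_diff_Suc)
    then have "dd_word (a # as) f \<in> P (k - length (a # as))" using dd_degree[OF a] 1 by (simp add: dd_word_simps)
    then show ?thesis using 1 by auto
  next
    case 2
    then have "dd_word as f \<in> P 0" using IH by simp
    then have "dd_word (a # as) f = 0" using dd_degree_0[OF a] 2 by (simp add: dd_word_simps)
    then show ?thesis using 2 by auto
  next
    case 3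
    have "dd_word (a # as) f = 0" unfolding dd_word_simps(2) IH(2)[OF 3] dd_0[OF a] ..
    then show ?thesis using 3 by auto
  qed
qed (simp add: dd_word_simps)

text \<open>The correction terms in the product rule for a word: each way to delete a letter, paired
  with the root of that letter pulled back through the letters to its right. Deleting the letter
  amounts to right multiplication by the reflection in this root.\<close>

fun omit :: "'a list \<Rightarrow> ('a \<times> 'a list) list" where
  "omit [] = []"
| "omit (\<alpha> # bs) = (inv' (simple_word bs) \<alpha>, bs) # map (\<lambda>(\<beta>, c). (\<beta>, \<alpha> # c)) (omit bs)"

lemma omit_props:
  "set as \<subseteq> \<Delta> \<Longrightarrow> (\<beta>, c) \<in> set (omit as) \<Longrightarrow>
    set c \<subseteq> \<Delta> \<and> Suc (length c) = length as \<and> simple_word c = simple_word as \<circ> reflection \<beta>"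
proof (induction as arbitrary: \<beta> c)
  case (Cons \<alpha> bs)
  let ?w = "simple_word bs"
  have w: "?w \<in> WG" using Cons.prems simple_word_WG by simp
  have "(\<beta>, c) = (inv' ?w \<alpha>, bs) \<or> (\<exists>d. (\<beta>, d) \<in> set (omit bs) \<and> c = \<alpha> # d)"
    using Cons.prems(2) unfolding omit.simps by auto
  then consider "\<beta> = inv' ?w \<alpha>" "c = bs" | d where "(\<beta>, d) \<in> set (omit bs)" "c = \<alpha> # d"
    by blast
  then show ?case
  proof cases
    case 1
    have "?w (reflection \<beta> x) = reflection \<alpha> (?w x)" for x
      using reflection_conj[OF WG_linear[OF w] WG_inner[OF w], of \<beta> x] 1 WG_bij[OF w]
      by (simp add: bij_is_surj surj_f_inv_f)
    then have e: "simple_word c = simple_word (\<alpha> # bs) \<circ> reflection \<beta>" using 1(2) by (simp add: fun_eq_iff)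
    have m: "set c \<subseteq> \<Delta>" "Suc (length c) = length (\<alpha> # bs)" using 1 Cons.prems by simp_all
    show ?thesis by (intro conjI m e)
  next
    case 2
    have "set bs \<subseteq> \<Delta>" using Cons.prems by simp
    then have d: "set d \<subseteq> \<Delta>" "Suc (length d) = length bs" "simple_word d = ?w \<circ> reflection \<beta>"
      using Cons.IH[OF _ 2(1)] by blast+
    have e: "simple_word c = simple_word (\<alpha> # bs) \<circ> reflection \<beta>"
      unfolding 2(2) list.map prod_fun_simps d(3) comp_assoc ..
    have m: "set c \<subseteq> \<Delta>" "Suc (length c) = length (\<alpha> # bs)" using d 2 Cons.prems by simp_all
    show ?thesis by (intro conjI m e)
  qed
qed simp

text \<open>The left-handed companion of \<open>N_comp_simple\<close>: no transport is required,
  exactly one new inversion appears.\<close>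

lemma N_simple_comp:
  assumes w: "w \<in> WG" and a: "\<alpha> \<in> \<Delta>" and p: "inv' w \<alpha> \<in> Pos"
  shows "N (reflection \<alpha> \<circ> w) = insert (inv' w \<alpha>) (N w)" "inv' w \<alpha> \<notin> N w"
proof -
  have wi: "w (inv' w \<alpha>) = \<alpha>" using WG_bij[OF w] by (simp add: bij_is_surj surj_f_inv_f)
  then show "inv' w \<alpha> \<notin> N w" using simple_Pos[OF a] by (simp add: N_def)
  have "reflection \<alpha> (w \<beta>) \<notin> Pos \<longleftrightarrow> w \<beta> \<notin> Pos \<or> \<beta> = inv' w \<alpha>" if b: "\<beta> \<in> Pos" for \<beta>
  proof (cases "w \<beta> \<in> Pos")
    case True
    have "w \<beta> = \<alpha> \<longleftrightarrow> \<beta> = inv' w \<alpha>" using wi WG_bij[OF w] by (metis bij_inv_eq_iff)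
    moreover have "reflection \<alpha> \<alpha> \<notin> Pos" using reflection_simple_self[OF a] Pos_not_neg simple_Pos[OF a] by simp
    ultimately show ?thesis using True reflection_simple_Pos[OF a True] by auto
  next
    case False
    have r: "w \<beta> \<in> \<Phi>" using WG_root[OF w] b Pos_root by blast
    have n: "- w \<beta> \<in> Pos" using r False Pos_iff by blast
    have "- w \<beta> \<noteq> \<alpha>"
    proof
      assume "- w \<beta> = \<alpha>"
      then have "w (- \<beta>) = \<alpha>" using WG_neg[OF w] by simp
      then have "inv' w \<alpha> = - \<beta>" using WG_bij[OF w] by (metis bij_inv_eq_iff)
      then show False using p b Pos_not_neg by simp
    qed
    then have "reflection \<alpha> (- w \<beta>) \<in> Pos" using reflection_simple_Pos[OF a n] by simp
    then have "- reflection \<alpha> (w \<beta>) \<in> Pos" using linear_neg[OF reflection_linear] by metis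
    then show ?thesis using False Pos_not_neg by (metis minus_minus)
  qed
  then show "N (reflection \<alpha> \<circ> w) = insert (inv' w \<alpha>) (N w)"
    using p by (auto simp: N_def)
qed

lemma reduced_tail:
  assumes "set (\<alpha> # bs) \<subseteq> \<Delta>" "length (\<alpha> # bs) = len (simple_word (\<alpha> # bs))"
  shows "length bs = len (simple_word bs)" "inv' (simple_word bs) \<alpha> \<in> Pos"
proof -
  have w: "simple_word bs \<in> WG" "len (simple_word bs) \<le> length bs"
    using assms simple_word_WG len_simple_word by auto
  have eq: "len (reflection \<alpha> \<circ> simple_word bs) = Suc (length bs)" using assms by simp
  then show "inv' (simple_word bs) \<alpha> \<in> Pos" "length bs = len (simple_word bs)"
    using len_simple_comp(1)[OF w(1), of \<alpha>] assms(1) w(2) by (auto split: if_splits)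
qed

text \<open>For a reduced word the pulled-back roots are the inversions, each occurring once. A sum
  over deleted letters thus becomes a sum over \<open>N\<close>, which depends on the group element
  alone.\<close>

lemma omit_reduced:
  "set as \<subseteq> \<Delta> \<Longrightarrow> length as = len (simple_word as) \<Longrightarrow>
    distinct (map fst (omit as)) \<and> set (map fst (omit as)) = N (simple_word as)"
proof (induction as)
  case Nil
  then show ?case by (simp add: N_def)
next
  case (Cons \<alpha> bs)
  let ?w = "simple_word bs"
  note red = reduced_tail[OF Cons.prems]
  have a: "\<alpha> \<in> \<Delta>" and w: "?w \<in> WG" using Cons.prems simple_word_WG by auto
  have IH: "distinct (map fst (omit bs))" "set (map fst (omit bs)) = N ?w" using Cons.IH Cons.prems red by auto
  have map: "map fst (omit (\<alpha> # bs)) = inv' ?w \<alpha> # map fst (omit bs)"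
    by (simp add: case_prod_unfold comp_def)
  have "N (simple_word (\<alpha> # bs)) = insert (inv' ?w \<alpha>) (N ?w)"
    using N_simple_comp(1)[OF w a red(2)] by simp
  moreover have "distinct (map fst (omit (\<alpha> # bs)))" "set (map fst (omit (\<alpha> # bs))) = insert (inv' ?w \<alpha>) (N ?w)"
    unfolding map using IH N_simple_comp(2)[OF w a red(2)] by simp_all
  ultimately show ?case by metis
qed

lemma dd_sum_list:
  assumes "\<alpha> \<in> \<Phi>" "\<And>x. x \<in> set xs \<Longrightarrow> g x \<in> A"
  shows "dd \<alpha> (\<Sum>x\<leftarrow>xs. g x) = (\<Sum>x\<leftarrow>xs. dd \<alpha> (g x)) \<and> (\<Sum>x\<leftarrow>xs. g x) \<in> A"
  using assms(2)
proof (induction xs)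
  case Nil
  have "sum_list (map g []) = 0" "sum_list (map (\<lambda>x. dd \<alpha> (g x)) []) = 0" by simp_all
  then show ?case using dd_0[OF assms(1)] A_closed(4) by metis
next
  case (Cons x xs)
  then have IH: "dd \<alpha> (\<Sum>x\<leftarrow>xs. g x) = (\<Sum>x\<leftarrow>xs. dd \<alpha> (g x))" "(\<Sum>x\<leftarrow>xs. g x) \<in> A" "g x \<in> A" by auto
  have "(\<Sum>x\<leftarrow>x # xs. g x) = g x + (\<Sum>x\<leftarrow>xs. g x)" by simp
  then show ?case using dd_add[OF assms(1) IH(3,2)] IH A_closed(1)[OF IH(3,2)] by (metis list.simps(9) sum_list.Cons)
qed

text \<open>Each letter either reflects the linear form and differentiates the rest, or consumes the
  linear form and disappears from the word. Orthogonality rewrites the resulting scalar as a pairing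
  of the original \<open>u\<close> with the pulled-back root.\<close>

lemma dd_word_lin_mult:
  assumes "set as \<subseteq> \<Delta>" "u \<in> V" "f \<in> A"
  shows "dd_word as (lin u * f) = lin (simple_word as u) * dd_word as f + (\<Sum>(\<beta>, c)\<leftarrow>omit as. pair u \<beta> *\<^sub>R dd_word c f)"
  using assms(1)
proof (induction as)
  case Nil
  then show ?case by (simp add: dd_word_simps fun_eq_iff)
next
  case (Cons \<alpha> bs)
  let ?w = "simple_word bs"
  let ?g = "\<lambda>(\<beta>, c). pair u \<beta> *\<^sub>R dd_word c f"
  have a: "\<alpha> \<in> \<Phi>" "set bs \<subseteq> \<Delta>" and w: "?w \<in> WG" using Cons.prems simple_word_WG simple_root by auto
  have wu: "?w u \<in> V" using WG_V[OF w] assms(2) by blast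
  have gA: "?g x \<in> A" if "x \<in> set (omit bs)" for x
    using that omit_props[OF a(2), of "fst x" "snd x"] dd_word_A[OF _ assms(3), of "snd x"] A_closed(2)
    by (auto simp: case_prod_unfold)
  have gsum: "dd \<alpha> (\<Sum>x\<leftarrow>omit bs. ?g x) = (\<Sum>x\<leftarrow>omit bs. dd \<alpha> (?g x))" "(\<Sum>x\<leftarrow>omit bs. ?g x) \<in> A"
    using dd_sum_list[of \<alpha> "omit bs" ?g, OF a(1) gA] by blast+
  have DA: "dd_word bs f \<in> A" using dd_word_A[OF a(2) assms(3)] .
  have inner: "pair (?w u) \<alpha> = pair u (inv' ?w \<alpha>)"
  proof -
    have wi: "?w (inv' ?w \<alpha>) = \<alpha>" using WG_bij[OF w] by (simp add: bij_is_surj surj_f_inv_f)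
    show ?thesis using WG_inner[OF w, of u "inv' ?w \<alpha>"] WG_inner[OF w, of "inv' ?w \<alpha>" "inv' ?w \<alpha>"]
      unfolding wi by simp
  qed
  have "dd_word (\<alpha> # bs) (lin u * f) = dd \<alpha> (lin (?w u) * dd_word bs f + (\<Sum>x\<leftarrow>omit bs. ?g x))"
    using Cons.IH[OF a(2)] unfolding dd_word_simps by (rule arg_cong)
  also have "\<dots> = dd \<alpha> (lin (?w u) * dd_word bs f) + dd \<alpha> (\<Sum>x\<leftarrow>omit bs. ?g x)"
    by (rule dd_add[OF a(1) A_closed(5)[OF A_closed(6)[OF wu] DA] gsum(2)])
  also have "dd \<alpha> (\<Sum>x\<leftarrow>omit bs. ?g x) = (\<Sum>x\<leftarrow>omit bs. dd \<alpha> (?g x))"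
    by (rule gsum(1))
  also have "\<dots> = (\<Sum>x\<leftarrow>map (\<lambda>(\<beta>, c). (\<beta>, \<alpha> # c)) (omit bs). ?g x)"
    unfolding map_map
  proof (rule arg_cong[where f = sum_list], rule map_cong[OF refl])
    fix x assume x: "x \<in> set (omit bs)"
    then have "set (snd x) \<subseteq> \<Delta>" using omit_props[OF a(2), of "fst x" "snd x"] by simp
    then show "dd \<alpha> (?g x) = (?g \<circ> (\<lambda>(\<beta>, c). (\<beta>, \<alpha> # c))) x"
      using dd_scale[OF a(1) dd_word_A[OF _ assms(3)], of "snd x"] by (simp add: case_prod_unfold dd_word_simps)
  qed
  also have "dd \<alpha> (lin (?w u) * dd_word bs f) = pair u (inv' ?w \<alpha>) *\<^sub>R dd_word bs f + lin (reflection \<alpha> (?w u)) * dd \<alpha> (dd_word bs f)"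
    using dd_lin_mult[OF a(1) DA wu] unfolding inner .
  finally show ?case by (simp add: dd_word_simps fun_eq_iff)
qed

section \<open>Operators indexed by group elements\<close>

definition bgg :: "('a \<Rightarrow> 'a) \<Rightarrow> ('a \<Rightarrow> real) \<Rightarrow> 'a \<Rightarrow> real" where
  "bgg w f = dd_word (SOME as. set as \<subseteq> \<Delta> \<and> w = simple_word as \<and> length as = len w) f"

lemma bgg_word:
  assumes "w \<in> WG"
  obtains as where "set as \<subseteq> \<Delta>" "w = simple_word as" "length as = len w" "bgg w = dd_word as"
proof -
  have "\<exists>as. set as \<subseteq> \<Delta> \<and> w = simple_word as \<and> length as = len w" using reduced_word[OF assms] by metis
  from someI_ex[OF this]
  show ?thesis using that[of "SOME as. set as \<subseteq> \<Delta> \<and> w = simple_word as \<and> length as = len w"]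
    unfolding bgg_def by blast
qed

text \<open>Commuting past multiplication by a linear form shortens words by one letter, in a way that
  depends only on the group element; this gives independence of the reduced word by induction.\<close>
lemma dd_word_eq_bgg_aux:
  assumes "length as = k" "set as \<subseteq> \<Delta>" "f \<in> A"
  shows "dd_word as f = (if k = len (simple_word as) then bgg (simple_word as) f else 0)"
  using assms
proof (induction k arbitrary: as f)
  case 0
  then have "as = []" by simp
  obtain bs where "length bs = len (id :: 'a \<Rightarrow> 'a)" "bgg id = dd_word bs" using bgg_word[OF WG_id] by metis
  then have "bgg id = dd_word []" by (simp add: len_id)
  moreover have "simple_word as = id" using \<open>as = []\<close> by simp
  ultimately show ?case using \<open>as = []\<close> len_id by metis
next
  case (Suc k)
  then obtain \<alpha> bs where as: "as = \<alpha> # bs" "length bs = k" by (cases as) auto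
  have a: "\<alpha> \<in> \<Delta>" "set bs \<subseteq> \<Delta>" "\<alpha> \<in> \<Phi>" using Suc.prems as simple_root by auto
  let ?w = "simple_word bs"
  have w: "?w \<in> WG" using simple_word_WG[OF a(2)] .
  have was: "simple_word as = reflection \<alpha> \<circ> ?w" by (simp add: as)
  consider (1) "k \<noteq> len ?w" | (2) "k = len ?w" "Suc k \<noteq> len (simple_word as)" | (3) "Suc k = len (simple_word as)"
    by blast
  then show ?case
  proof cases
    case 1
    have "Suc k \<noteq> len (simple_word as)" using reduced_tail(1)[of \<alpha> bs] Suc.prems as 1 by auto
    moreover have "dd_word as f = 0" using Suc.IH[OF as(2) a(2) Suc.prems(3)] 1 dd_0[OF a(3)] by (metis as(1) dd_word_simps(2))
    ultimately show ?thesis by metis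
  next
    case 2
    have n: "inv' ?w \<alpha> \<notin> Pos" using len_simple_comp(1)[OF w a(1)] 2 was by auto
    have l: "Suc (len (simple_word as)) = k"
      using len_simple_comp[OF w a(1)] n 2 was by simp
    obtain cs where cs: "set cs \<subseteq> \<Delta>" "simple_word as = simple_word cs" "length cs = len (simple_word as)"
      using reduced_word[OF simple_word_WG[OF Suc.prems(2)]] .
    \<comment> \<open>Prepending \<open>\<alpha>\<close> shortens the tail's element, so that
      element has another reduced word beginning with \<open>\<alpha>\<close>. Switching to it by
      the induction hypothesis puts two equal letters side by side, and these annihilate.\<close>
    have "simple_word (\<alpha> # cs) = ?w"
      using cs(2) was comp_reflection_reflection(2)[of \<alpha> ?w] by (metis list.map(2) prod_fun_simps(2))
    moreover have "set (\<alpha> # cs) \<subseteq> \<Delta>" "length (\<alpha> # cs) = k" using cs l a by auto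
    ultimately have "dd_word (\<alpha> # cs) f = bgg ?w f" using Suc.IH[of "\<alpha> # cs" f] Suc.prems(3) 2(1) by metis
    moreover have "dd_word bs f = bgg ?w f" using Suc.IH[OF as(2) a(2) Suc.prems(3)] 2(1) by metis
    ultimately have "dd_word as f = dd \<alpha> (dd \<alpha> (dd_word cs f))" by (metis as(1) dd_word_simps(2))
    also have "\<dots> = 0" using dd_dd[OF a(3)] dd_word_A[OF cs(1) Suc.prems(3)] by simp
    finally show ?thesis using 2 by metis
  next
    case 3
    let ?x = "simple_word as"
    let ?G = "\<lambda>\<beta> f. if k = len (?x \<circ> reflection \<beta>) then bgg (?x \<circ> reflection \<beta>) f else 0"
    \<comment> \<open>Every reduced word of \<open>?x\<close> satisfies the same product rule, with
      correction terms fixed by the induction hypothesis. Two such operators agree on 1, which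
      positive length kills, and hence on all polynomials.\<close>
    have formula: "dd_word cs (lin u * f) = lin (?x u) * dd_word cs f + (\<Sum>\<beta>\<in>N ?x. pair u \<beta> *\<^sub>R ?G \<beta> f)"
      if cs: "set cs \<subseteq> \<Delta>" "simple_word cs = ?x" "length cs = Suc k" and u: "u \<in> V" and f: "f \<in> A" for cs u f
    proof -
      have "(\<Sum>(\<beta>, c)\<leftarrow>omit cs. pair u \<beta> *\<^sub>R dd_word c f) = (\<Sum>(\<beta>, c)\<leftarrow>omit cs. pair u \<beta> *\<^sub>R ?G \<beta> f)"
      proof (rule arg_cong[where f = sum_list], rule map_cong[OF refl], clarify)
        fix \<beta> c assume "(\<beta>, c) \<in> set (omit cs)"
        from omit_props[OF cs(1) this] have c: "set c \<subseteq> \<Delta>" "length c = k" "simple_word c = ?x \<circ> reflection \<beta>"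
          using cs by auto
        show "pair u \<beta> *\<^sub>R dd_word c f = pair u \<beta> *\<^sub>R ?G \<beta> f"
          using Suc.IH[OF c(2,1) f] unfolding c(3) by metis
      qed
      also have "\<dots> = (\<Sum>\<beta>\<leftarrow>map fst (omit cs). pair u \<beta> *\<^sub>R ?G \<beta> f)"
        by (simp add: case_prod_unfold comp_def)
      also have "\<dots> = (\<Sum>\<beta>\<in>N ?x. pair u \<beta> *\<^sub>R ?G \<beta> f)"
      proof -
        have d: "distinct (map fst (omit cs))" and e: "set (map fst (omit cs)) = N ?x"
          using omit_reduced[OF cs(1)] cs(2,3) 3 by metis+
        show ?thesis unfolding sum_list_distinct_conv_sum_set[OF d] e ..
      qed
      finally show ?thesis using dd_word_lin_mult[OF cs(1) u f] cs(2) by simp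
    qed
    have xW: "?x \<in> WG" using simple_word_WG[OF Suc.prems(2)] .
    obtain cs where cs: "set cs \<subseteq> \<Delta>" "?x = simple_word cs" "length cs = len ?x" "bgg ?x = dd_word cs"
      using bgg_word[OF xW] .
    have "f \<in> A \<and> dd_word as f = dd_word cs f" using Suc.prems(3)
    proof (induction rule: sym_algebra_induct)
      case subspace
      show ?case
        by (rule subspace_lin_on_equalizer[OF dd_word_lin_on[OF Suc.prems(2)] dd_word_lin_on[OF cs(1)] subspace_sym_algebra])
    next
      case one
      have "dd_word as 1 = 0" "dd_word cs 1 = 0"
        using dd_word_degree[OF Suc.prems(2) one_sym_power] dd_word_degree[OF cs(1) one_sym_power] Suc.prems(1) cs(3) 3 by auto
      then show ?case using A_closed(7)[of V] by metis
    next
      case (mult u f)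
      have "length cs = Suc k" using cs(3) 3 by simp
      then have "dd_word as (lin u * f) = dd_word cs (lin u * f)"
        using formula[OF Suc.prems(2) refl Suc.prems(1) mult(1,2)]
          formula[OF cs(1) cs(2)[symmetric] _ mult(1,2)] mult(3) by metis
      then show ?case using A_closed(5)[OF A_closed(6)[OF mult(1)] mult(2)] by blast
    qed
    then show ?thesis using 3 cs(4) by metis
  qed
qed

lemma dd_word_eq_bgg:
  "set as \<subseteq> \<Delta> \<Longrightarrow> f \<in> A \<Longrightarrow> dd_word as f = (if length as = len (simple_word as) then bgg (simple_word as) f else 0)"
  using dd_word_eq_bgg_aux[OF refl] .

lemma bgg_A: "w \<in> WG \<Longrightarrow> f \<in> A \<Longrightarrow> bgg w f \<in> A"
  by (rule bgg_word[of w]) (simp_all add: dd_word_A)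

lemma bgg_add: "w \<in> WG \<Longrightarrow> f \<in> A \<Longrightarrow> g \<in> A \<Longrightarrow> bgg w (f + g) = bgg w f + bgg w g"
  by (rule bgg_word[of w]) (simp_all add: dd_word_add)

lemma bgg_scale: "w \<in> WG \<Longrightarrow> f \<in> A \<Longrightarrow> bgg w (c *\<^sub>R f) = c *\<^sub>R bgg w f"
  by (rule bgg_word[of w]) (simp_all add: dd_word_scale)

lemma bgg_zero: "w \<in> WG \<Longrightarrow> bgg w 0 = 0"
  by (rule bgg_word[of w]) (simp_all add: dd_word_zero)

lemma bgg_lin_on: "w \<in> WG \<Longrightarrow> lin_on A (bgg w)"
  by (simp add: lin_on_def bgg_add bgg_scale)

lemma bgg_sum:
  assumes "w \<in> WG" "\<And>i. i \<in> I \<Longrightarrow> F i \<in> A"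
  shows "bgg w (\<Sum>i\<in>I. F i) = (\<Sum>i\<in>I. bgg w (F i))"
  using lin_on_sum[OF bgg_lin_on[OF assms(1)] subspace_sym_algebra, of I F "\<lambda>_. 1"] assms(2) by simp

lemma bgg_diff: "w \<in> WG \<Longrightarrow> f \<in> A \<Longrightarrow> g \<in> A \<Longrightarrow> bgg w (f - g) = bgg w f - bgg w g"
  using lin_on_diff[OF bgg_lin_on subspace_sym_algebra] by blast

lemma bgg_id: "bgg id f = f"
proof -
  obtain bs where "length bs = len (id :: 'a \<Rightarrow> 'a)" "bgg id = dd_word bs" using bgg_word[OF WG_id] by metis
  then show ?thesis by (simp add: len_id dd_word_simps)
qed

lemma bgg_degree:
  "w \<in> WG \<Longrightarrow> f \<in> P k \<Longrightarrow> len w \<le> k \<Longrightarrow> bgg w f \<in> P (k - len w)"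
  "w \<in> WG \<Longrightarrow> f \<in> P k \<Longrightarrow> k < len w \<Longrightarrow> bgg w f = 0"
  by (rule bgg_word[of w], use dd_word_degree in metis, use dd_word_degree in metis)+

text \<open>The nil Hecke relation: concatenated reduced words either stay reduced or give the zero
  operator.\<close>

lemma bgg_op:
  assumes "w \<in> WG" "v \<in> WG" "f \<in> A"
  shows "bgg w (bgg v f) = (if len (w \<circ> v) = len w + len v then bgg (w \<circ> v) f else 0)"
proof -
  obtain as where as: "set as \<subseteq> \<Delta>" "w = simple_word as" "length as = len w" "bgg w = dd_word as"
    using bgg_word[OF assms(1)] .
  obtain bs where bs: "set bs \<subseteq> \<Delta>" "v = simple_word bs" "length bs = len v" "bgg v = dd_word bs"
    using bgg_word[OF assms(2)] .
  have "simple_word (as @ bs) = w \<circ> v" using as bs by simp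
  moreover have "set (as @ bs) \<subseteq> \<Delta>" "length (as @ bs) = len w + len v" using as bs by auto
  moreover have "bgg w (bgg v f) = dd_word (as @ bs) f" using as bs by (simp add: dd_word_simps)
  ultimately show ?thesis using dd_word_eq_bgg[of "as @ bs" f] assms(3) by metis
qed

lemma dd_bgg:
  assumes "\<alpha> \<in> \<Delta>" "w \<in> WG" "f \<in> A"
  shows "dd \<alpha> (bgg w f) = (if inv' w \<alpha> \<in> Pos then bgg (reflection \<alpha> \<circ> w) f else 0)"
proof -
  obtain as where as: "set as \<subseteq> \<Delta>" "w = simple_word as" "length as = len w" "bgg w = dd_word as"
    using bgg_word[OF assms(2)] .
  have "simple_word (\<alpha> # as) = reflection \<alpha> \<circ> w" using as by simp
  moreover have "set (\<alpha> # as) \<subseteq> \<Delta>" "length (\<alpha> # as) = Suc (len w)" using as assms by auto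
  moreover have "dd \<alpha> (bgg w f) = dd_word (\<alpha> # as) f" using as by (simp add: dd_word_simps)
  ultimately have "dd \<alpha> (bgg w f) = (if len (reflection \<alpha> \<circ> w) = Suc (len w) then bgg (reflection \<alpha> \<circ> w) f else 0)"
    using dd_word_eq_bgg[of "\<alpha> # as" f] assms(3) by metis
  moreover have "len (reflection \<alpha> \<circ> w) = Suc (len w) \<longleftrightarrow> inv' w \<alpha> \<in> Pos"
    using len_simple_comp(1)[OF assms(2,1)] by auto
  ultimately show ?thesis by metis
qed

text \<open>A Chevalley-type formula: after multiplication by a linear form, only reflections that
  shorten \<open>w\<close> by exactly one contribute corrections.\<close>

lemma bgg_lin_mult:
  assumes w: "w \<in> WG" and u: "u \<in> V" and f: "f \<in> A"
  shows "bgg w (lin u * f) = lin (w u) * bgg w f + (\<Sum>\<beta>\<in>N w. pair u \<beta> *\<^sub>R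
    (if Suc (len (w \<circ> reflection \<beta>)) = len w then bgg (w \<circ> reflection \<beta>) f else 0))" (is "_ = _ + (\<Sum>\<beta>\<in>N w. pair u \<beta> *\<^sub>R ?G \<beta>)")
proof -
  obtain as where as: "set as \<subseteq> \<Delta>" "w = simple_word as" "length as = len w" "bgg w = dd_word as"
    using bgg_word[OF w] .
  have "(\<Sum>(\<beta>, c)\<leftarrow>omit as. pair u \<beta> *\<^sub>R dd_word c f) = (\<Sum>(\<beta>, c)\<leftarrow>omit as. pair u \<beta> *\<^sub>R ?G \<beta>)"
  proof (rule arg_cong[where f = sum_list], rule map_cong[OF refl], clarify)
    fix \<beta> c assume "(\<beta>, c) \<in> set (omit as)"
    from omit_props[OF as(1) this] have c: "set c \<subseteq> \<Delta>" "Suc (length c) = len w" "simple_word c = w \<circ> reflection \<beta>"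
      using as by auto
    have "length c = len (w \<circ> reflection \<beta>) \<longleftrightarrow> Suc (len (w \<circ> reflection \<beta>)) = len w" using c(2) by auto
    then have "dd_word c f = ?G \<beta>" using dd_word_eq_bgg[OF c(1) f] unfolding c(3) by metis
    then show "pair u \<beta> *\<^sub>R dd_word c f = pair u \<beta> *\<^sub>R ?G \<beta>" by (rule arg_cong)
  qed
  also have "\<dots> = (\<Sum>\<beta>\<leftarrow>map fst (omit as). pair u \<beta> *\<^sub>R ?G \<beta>)"
    by (simp add: case_prod_unfold comp_def)
  also have "\<dots> = (\<Sum>\<beta>\<in>N w. pair u \<beta> *\<^sub>R ?G \<beta>)"
  proof -
    have d: "distinct (map fst (omit as))" and e: "set (map fst (omit as)) = N w"
      using omit_reduced[OF as(1)] as(2,3) by metis+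
    show ?thesis unfolding sum_list_distinct_conv_sum_set[OF d] e ..
  qed
  finally show ?thesis using dd_word_lin_mult[OF as(1) u f] as(2,4) by metis
qed

definition inv_poly :: "('a \<Rightarrow> real) \<Rightarrow> bool" where
  "inv_poly p \<longleftrightarrow> p \<in> A \<and> (\<forall>w\<in>WG. act w p = p)"

lemma inv_polyI:
  assumes "p \<in> A" "\<And>\<alpha>. \<alpha> \<in> \<Delta> \<Longrightarrow> dd \<alpha> p = 0" shows "inv_poly p"
proof -
  have "act w p = p" if "w \<in> generated_group (reflection ` \<Delta>)" for w
    using that
  proof (induction rule: generated_group_induct)
    case id
    show ?case by (rule act_id)
  next
    case (comp s w)
    then obtain \<alpha> where a: "\<alpha> \<in> \<Delta>" "s = reflection \<alpha>" by blast
    have "ref \<alpha> p = p" using dd_eq_0_iff[OF simple_root[OF a(1)] assms(1)] assms(2)[OF a(1)] by blast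
    then have "act (s \<circ> w) p = p"
      using WG_act_comp[OF WG_simple[OF a(1)], of w p] comp a unfolding WG_def by metis
    then show ?case .
  qed
  then show ?thesis using assms by (auto simp: inv_poly_def WG_def)
qed

lemma bgg_inv_mult:
  assumes w: "w \<in> WG" and p: "inv_poly p" and f: "f \<in> A"
  shows "bgg w (p * f) = p * bgg w f"
proof -
  obtain as where as: "set as \<subseteq> \<Delta>" "bgg w = dd_word as" using bgg_word[OF w] by metis
  have "dd_word as (p * f) = p * dd_word as f" using as(1)
  proof (induction as)
    case Nil
    then show ?case by (simp only: dd_word_simps)
  next
    case (Cons a as)
    have a: "a \<in> \<Phi>" "set as \<subseteq> \<Delta>" using Cons.prems simple_root by auto
    have "ref a p = p" using p reflection_WG[OF a(1)] by (simp add: inv_poly_def)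
    then have "dd a (p * dd_word as f) = p * dd a (dd_word as f)"
      using dd_invariant_mult[OF a(1) dd_word_A[OF a(2) f]] p by (simp add: inv_poly_def)
    then show ?case unfolding dd_word_simps Cons.IH[OF a(2)] .
  qed
  then show ?thesis using as(2) by metis
qed

section \<open>The top class and the Schubert basis\<close>

definition rho2 :: 'a where "rho2 = \<Sum>Pos"

lemma rho2_V: "rho2 \<in> V"
  unfolding rho2_def using Pos_root by (intro span_sum span_base)

text \<open>\<open>rho2\<close> is twice the Weyl vector. The reflection in \<open>\<alpha>\<close>
  permutes the other positive roots, so their sum is orthogonal to \<open>\<alpha>\<close> and only
  \<open>\<alpha> \<bullet> \<alpha>\<close> remains.\<close>

lemma rho2_simple: assumes a: "\<alpha> \<in> \<Delta>" shows "rho2 \<bullet> \<alpha> > 0"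
proof -
  have aP: "\<alpha> \<in> Pos" by (rule simple_Pos[OF a])
  have img: "reflection \<alpha> ` (Pos - {\<alpha>}) = Pos - {\<alpha>}"
  proof (rule endo_inj_surj)
    show "finite (Pos - {\<alpha>})" using finite_Pos by simp
    show "reflection \<alpha> ` (Pos - {\<alpha>}) \<subseteq> Pos - {\<alpha>}"
    proof
      fix x assume "x \<in> reflection \<alpha> ` (Pos - {\<alpha>})"
      then obtain \<beta> where b: "\<beta> \<in> Pos" "\<beta> \<noteq> \<alpha>" "x = reflection \<alpha> \<beta>" by blast
      have "x \<noteq> \<alpha>"
      proof
        assume "x = \<alpha>"
        then have "\<beta> = - \<alpha>" using b reflection_simple_self[OF a] by (metis reflection_reflection)
        then show False using b(1) aP Pos_not_neg by blast
      qed
      then show "x \<in> Pos - {\<alpha>}" using reflection_simple_Pos[OF a b(1,2)] b(3) by simp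
    qed
    show "inj_on (reflection \<alpha>) (Pos - {\<alpha>})" by (metis inj_on_inverseI reflection_reflection)
  qed
  have inj: "inj_on (reflection \<alpha>) (Pos - {\<alpha>})" by (metis inj_on_inverseI reflection_reflection)
  define s where "s = \<Sum>(Pos - {\<alpha>})"
  have "reflection \<alpha> s = (\<Sum>x\<in>Pos - {\<alpha>}. reflection \<alpha> x)"
    unfolding s_def by (rule linear_sum[OF reflection_linear])
  also have "\<dots> = (\<Sum>x\<in>reflection \<alpha> ` (Pos - {\<alpha>}). x)" using inj by (simp add: sum.reindex)
  also have "\<dots> = s" unfolding img s_def ..
  finally have "reflection \<alpha> s = s" .
  then have "s \<bullet> \<alpha> = s \<bullet> reflection \<alpha> \<alpha>" using reflection_inner[of \<alpha> s \<alpha>] by simp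
  then have "s \<bullet> \<alpha> = 0" using reflection_simple_self[OF a] by simp
  moreover have "rho2 = \<alpha> + s" unfolding rho2_def s_def using finite_Pos aP by (simp add: sum.remove)
  moreover have "\<alpha> \<bullet> \<alpha> > 0" using simple_root[OF a] zero_not_root by auto
  ultimately show ?thesis by (simp add: inner_add_left)
qed

lemma pair_rho2: assumes b: "\<beta> \<in> Pos" shows "pair rho2 \<beta> > 0"
proof -
  have "rho2 \<bullet> \<beta> = (\<Sum>\<alpha>\<in>\<Delta>. coeff \<beta> \<alpha> * (rho2 \<bullet> \<alpha>))"
    using coeff_sum[OF root_span[OF Pos_root[OF b]]]
      inner_sum_right[of rho2 "\<lambda>\<alpha>. coeff \<beta> \<alpha> *\<^sub>R \<alpha>" \<Delta>] by simp
  moreover obtain \<alpha> where a: "\<alpha> \<in> \<Delta>" "coeff \<beta> \<alpha> \<noteq> 0"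
    using root_nonzero_coeff[OF Pos_root[OF b]] by blast
  moreover have "coeff \<beta> \<alpha> * (rho2 \<bullet> \<alpha>) > 0"
    using a b rho2_simple[OF a(1)] by (force simp: Pos_def)
  moreover have "coeff \<beta> \<gamma> * (rho2 \<bullet> \<gamma>) \<ge> 0" if "\<gamma> \<in> \<Delta>" for \<gamma>
    using that b rho2_simple[OF that] by (auto simp: Pos_def)
  ultimately have "rho2 \<bullet> \<beta> > 0"
    using sum_pos2[OF finite_base a(1), of "\<lambda>\<alpha>. coeff \<beta> \<alpha> * (rho2 \<bullet> \<alpha>)"] by simp
  moreover have "\<beta> \<noteq> 0" using b Pos_root zero_not_root by blast
  ultimately show ?thesis by simp
qed

lemma power_lin_P: "u \<in> V \<Longrightarrow> lin u ^ k \<in> P k"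
proof (induction k)
  case 0
  then show ?case using one_sym_power by (metis power_0)
next
  case (Suc k)
  then show ?case using lin_sym_power[of u V "lin u ^ k" k] by (metis power_Suc)
qed

text \<open>Supplies a polynomial of degree \<open>len w\<close> on which \<open>bgg w\<close> does
  not vanish. At the point \<open>0\<close> the leading term of \<open>bgg_lin_mult\<close>
  disappears; the corrections carry the positive factors \<open>pair rho2 \<beta>\<close>, so
  nothing can cancel.\<close>

lemma bgg_power_pos: "w \<in> WG \<Longrightarrow> len w = k \<Longrightarrow> 0 < bgg w (lin rho2 ^ k) 0"
proof (induction k arbitrary: w)
  case 0
  then have "w = id" using len_eq_0 by simp
  then have "bgg w (lin rho2 ^ 0) 0 = 1" by (simp add: bgg_id)
  then show ?case by (metis zero_less_one)
next
  case (Suc k)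
  note w = Suc.prems
  let ?f = "lin rho2 ^ k"
  let ?G = "\<lambda>\<beta>. if Suc (len (w \<circ> reflection \<beta>)) = len w then bgg (w \<circ> reflection \<beta>) ?f else 0"
  have fA: "?f \<in> A" using power_lin_P[OF rho2_V] sym_power_algebra by blast
  have "bgg w (lin rho2 * ?f) 0 = (lin (w rho2) * bgg w ?f + (\<Sum>\<beta>\<in>N w. pair rho2 \<beta> *\<^sub>R ?G \<beta>)) 0"
    by (rule fun_cong[OF bgg_lin_mult[OF w(1) rho2_V fA]])
  then have eq: "bgg w (lin rho2 ^ Suc k) 0 = (\<Sum>\<beta>\<in>N w. pair rho2 \<beta> * ?G \<beta> 0)"
    by (simp add: sum_fun_apply lin_def)
  have pos: "0 < ?G \<beta> 0" if "\<beta> \<in> N w" "Suc (len (w \<circ> reflection \<beta>)) = len w" for \<beta>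
  proof -
    have b: "\<beta> \<in> \<Phi>" using that(1) Pos_root by (simp add: N_def)
    have "len (w \<circ> reflection \<beta>) = k" using that(2) w(2) by simp
    then have "0 < bgg (w \<circ> reflection \<beta>) ?f 0" using Suc.IH[OF WG_comp[OF w(1) reflection_WG[OF b]]] by blast
    then show ?thesis using that(2) by simp
  qed
  have nonneg: "0 \<le> pair rho2 \<beta> * ?G \<beta> 0" if "\<beta> \<in> N w" for \<beta>
  proof (rule mult_nonneg_nonneg)
    show "0 \<le> pair rho2 \<beta>" using that by (intro less_imp_le pair_rho2) (simp add: N_def)
    show "0 \<le> ?G \<beta> 0"
      using pos[OF that] by (cases "Suc (len (w \<circ> reflection \<beta>)) = len w") simp_all
  qed
  \<comment> \<open>The last letter of a reduced word is a descent, which makes at least one summand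
    strictly positive.\<close>
  have "\<exists>\<alpha>\<in>\<Delta>. w \<alpha> \<notin> Pos"
  proof -
    obtain as where as: "set as \<subseteq> \<Delta>" "w = simple_word as" "length as = len w" using reduced_word[OF w(1)] .
    have "length as = Suc k" using as(3) w(2) by (rule trans)
    then have "as \<noteq> []" by auto
    then obtain bs \<alpha> where ba: "as = bs @ [\<alpha>]" by (metis rev_exhaust)
    have a: "\<alpha> \<in> \<Delta>" "set bs \<subseteq> \<Delta>" using as ba by auto
    have "w \<circ> reflection \<alpha> = simple_word bs"
      using as(2) ba comp_reflection_reflection(1) by simp
    then have "len (w \<circ> reflection \<alpha>) \<le> length bs" using len_simple_word[OF a(2)] by simp
    then show ?thesis using len_comp_simple(1)[OF w(1) a(1)] as(3) ba a(1) by (auto split: if_splits)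
  qed
  then obtain \<alpha> where a: "\<alpha> \<in> \<Delta>" "w \<alpha> \<notin> Pos" by blast
  then have aN: "\<alpha> \<in> N w" using simple_Pos by (simp add: N_def)
  have "Suc (len (w \<circ> reflection \<alpha>)) = len w"
    using len_comp_simple[OF w(1) a(1)] a(2) by simp
  then have "0 < pair rho2 \<alpha> * ?G \<alpha> 0" using pos[OF aN] pair_rho2[OF simple_Pos[OF a(1)]] by (intro mult_pos_pos) auto
  then have "0 < (\<Sum>\<beta>\<in>N w. pair rho2 \<beta> * ?G \<beta> 0)"
    by (rule sum_pos2[OF finite_N aN]) (rule nonneg)
  then show ?case unfolding eq .
qed

text \<open>Normalised so that \<open>bgg w0\<close> sends it to 1; the denominator is positive by
  \<open>bgg_power_pos\<close>.\<close>

definition top_class :: "'a \<Rightarrow> real" where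
  "top_class = (1 / bgg w0 (lin rho2 ^ card Pos) 0) *\<^sub>R lin rho2 ^ card Pos"

lemma P0_const: "f \<in> P 0 \<Longrightarrow> f = f 0 *\<^sub>R 1"
  by (auto simp: sym_power_0 fun_eq_iff)

lemma top_class_P: "top_class \<in> P (card Pos)"
  unfolding top_class_def by (intro subspace_scale[OF subspace_sym_power] power_lin_P rho2_V)

lemma bgg_top_class: "bgg w0 top_class = 1"
proof -
  have "bgg w0 top_class \<in> P 0" using bgg_degree(1)[OF w0(1) top_class_P] w0(2) by simp
  moreover have "bgg w0 top_class 0 = 1"
    using bgg_power_pos[OF w0(1,2)] bgg_scale[OF w0(1) sym_power_algebra[OF power_lin_P[OF rho2_V]]]
    by (simp add: top_class_def)
  ultimately show ?thesis using P0_const by (metis scaleR_one)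
qed

text \<open>The index has length \<open>card Pos - len w\<close>, which brings the degree down from
  \<open>card Pos\<close> to \<open>len w\<close>. These are the Schubert polynomials of Bernstein,
  Gelfand and Gelfand.\<close>

definition schubert :: "('a \<Rightarrow> 'a) \<Rightarrow> 'a \<Rightarrow> real" where
  "schubert w = bgg (inv' w \<circ> w0) top_class"

lemma len_inv_w0: "w \<in> WG \<Longrightarrow> len (inv' w \<circ> w0) + len w = card Pos"
  using len_comp_w0[OF WG_inv] len_inv by metis

lemma schubert_P: assumes "w \<in> WG" shows "schubert w \<in> P (len w)"
proof -
  have "len (inv' w \<circ> w0) \<le> card Pos" "card Pos - len (inv' w \<circ> w0) = len w"
    using len_inv_w0[OF assms] by linarith+
  then show ?thesis unfolding schubert_def
    using bgg_degree(1)[OF WG_comp[OF WG_inv[OF assms] w0(1)] top_class_P] by metis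
qed

lemma schubert_A: "w \<in> WG \<Longrightarrow> schubert w \<in> A"
  using schubert_P sym_power_algebra by blast

lemma bgg_schubert_high: "u \<in> WG \<Longrightarrow> w \<in> WG \<Longrightarrow> len w < len u \<Longrightarrow> bgg u (schubert w) = 0"
  using bgg_degree(2) schubert_P by blast

text \<open>The lengths of \<open>u\<close> and of \<open>inv' w \<circ> w0\<close> add up to
  \<open>card Pos\<close>. By \<open>bgg_op\<close> the result is nonzero only if their product has
  that length too, that is, equals the unique longest element, which means
  \<open>u = w\<close>.\<close>

lemma bgg_schubert_eq:
  assumes u: "u \<in> WG" and w: "w \<in> WG" and l: "len u = len w"
  shows "bgg u (schubert w) = (if u = w then 1 else 0)"
proof -
  have iw: "inv' w \<circ> w0 \<in> WG" using WG_comp WG_inv w w0(1) by blast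
  have L: "len u + len (inv' w \<circ> w0) = card Pos" using len_inv_w0[OF w] l by linarith
  have "u \<circ> (inv' w \<circ> w0) = w0 \<longleftrightarrow> u = w"
  proof
    assume "u = w"
    then show "u \<circ> (inv' w \<circ> w0) = w0"
      using WG_bij[OF w] by (simp add: fun_eq_iff bij_is_surj surj_f_inv_f)
  next
    assume "u \<circ> (inv' w \<circ> w0) = w0"
    then have "u (inv' w (w0 (w0 x))) = w0 (w0 x)" for x by (metis comp_apply)
    then have e: "u (inv' w x) = x" for x using w0_involution by (metis comp_apply id_apply)
    show "u = w"
    proof
      fix x show "u x = w x" using e[of "w x"] WG_bij[OF w] by (simp add: bij_is_inj)
    qed
  qed
  moreover have "len (u \<circ> (inv' w \<circ> w0)) = card Pos \<longleftrightarrow> u \<circ> (inv' w \<circ> w0) = w0"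
    using w0_unique[OF WG_comp[OF u iw]] w0(2) by metis
  ultimately show ?thesis unfolding schubert_def
    using bgg_op[OF u iw sym_power_algebra[OF top_class_P]] L bgg_top_class by metis
qed

end

section \<open>The polynomial ring as a free module over the invariants\<close>

context based_roots begin

definition invP :: "nat \<Rightarrow> ('a \<Rightarrow> real) set" where "invP d = {p \<in> P d. inv_poly p}"

lemma P_closed: "0 \<in> P k" "f \<in> P k \<Longrightarrow> g \<in> P k \<Longrightarrow> f + g \<in> P k" "f \<in> P k \<Longrightarrow> c *\<^sub>R f \<in> P k"
  using subspace_sym_power by (auto intro: subspace_0 subspace_add subspace_scale)

lemma inv_poly_A: "inv_poly p \<Longrightarrow> p \<in> A" by (simp add: inv_poly_def)

lemma inv_poly_closed:
  "inv_poly 0" "inv_poly p \<Longrightarrow> inv_poly q \<Longrightarrow> inv_poly (p + q)"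
  "inv_poly p \<Longrightarrow> inv_poly q \<Longrightarrow> inv_poly (p - q)"
  "inv_poly p \<Longrightarrow> inv_poly (c *\<^sub>R p)" "inv_poly p \<Longrightarrow> inv_poly q \<Longrightarrow> inv_poly (p * q)"
  by (simp_all add: inv_poly_def A_closed act_add)

lemma subspace_invP: "subspace (invP d)"
proof (rule subspaceI)
  show "0 \<in> invP d" unfolding invP_def using inv_poly_closed(1) P_closed(1) by blast
  fix f g c assume f: "f \<in> invP d"
  show "c *\<^sub>R f \<in> invP d" using f inv_poly_closed(4) P_closed(3) unfolding invP_def by blast
  assume "g \<in> invP d"
  then show "f + g \<in> invP d" using f inv_poly_closed(2) P_closed(2) unfolding invP_def by blast
qed

text \<open>Applying a further \<open>dd \<alpha>\<close> gives zero or an operator one step longer,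
  which kills \<open>f\<close> by assumption; vanishing of all \<open>dd \<alpha>\<close> is
  invariance.\<close>

lemma bgg_inv_poly:
  assumes w: "w \<in> WG" and f: "f \<in> A" and z: "\<And>u. u \<in> WG \<Longrightarrow> len u = Suc (len w) \<Longrightarrow> bgg u f = 0"
  shows "inv_poly (bgg w f)"
proof (rule inv_polyI[OF bgg_A[OF w f]])
  fix \<alpha> assume a: "\<alpha> \<in> \<Delta>"
  show "dd \<alpha> (bgg w f) = 0"
  proof (cases "inv' w \<alpha> \<in> Pos")
    case True
    then have "len (reflection \<alpha> \<circ> w) = Suc (len w)" using len_simple_comp(1)[OF w a] by simp
    then have "bgg (reflection \<alpha> \<circ> w) f = 0" by (rule z[OF WG_comp[OF WG_simple[OF a] w]])
    then show ?thesis using dd_bgg[OF a w f] by metis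
  next
    case False
    then show ?thesis using dd_bgg[OF a w f] by metis
  qed
qed

text \<open>The degree of each coefficient is prescribed, and coefficients at elements longer than
  \<open>k\<close> vanish; without this a graded trace could not be read off.\<close>

definition expansion :: "nat \<Rightarrow> ('a \<Rightarrow> real) \<Rightarrow> (('a \<Rightarrow> 'a) \<Rightarrow> 'a \<Rightarrow> real) \<Rightarrow> bool" where
  "expansion k f p \<longleftrightarrow> (\<forall>w\<in>WG. inv_poly (p w) \<and> (len w \<le> k \<longrightarrow> p w \<in> P (k - len w)) \<and> (k < len w \<longrightarrow> p w = 0)) \<and>
     f = (\<Sum>w\<in>WG. p w * schubert w)"

lemma bgg_sum_schubert:
  assumes u: "u \<in> WG" and p: "\<And>w. w \<in> WG \<Longrightarrow> inv_poly (p w)"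
  shows "bgg u (\<Sum>w\<in>WG. p w * schubert w) = (\<Sum>w\<in>WG. p w * bgg u (schubert w))"
proof -
  have "bgg u (\<Sum>w\<in>WG. p w * schubert w) = (\<Sum>w\<in>WG. bgg u (p w * schubert w))"
    by (rule bgg_sum[OF u]) (intro A_closed(5) inv_poly_A p schubert_A)
  also have "\<dots> = (\<Sum>w\<in>WG. p w * bgg u (schubert w))"
    by (rule sum.cong[OF refl], rule bgg_inv_mult[OF u p schubert_A])
  finally show ?thesis .
qed

text \<open>Induction on a bound \<open>m\<close> beyond which all operators kill \<open>f\<close>.
  The values \<open>bgg w f\<close> on the layer just below the bound are invariant; subtracting
  them times the Schubert classes of that layer lowers the bound by one.\<close>

lemma expansion_aux:
  assumes "f \<in> P k" "\<And>w. w \<in> WG \<Longrightarrow> m \<le> len w \<Longrightarrow> bgg w f = 0"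
  shows "\<exists>p. expansion k f p"
  using assms
proof (induction m arbitrary: f)
  case 0
  then have "f = 0" using bgg_id[of f] WG_id by (metis le0)
  have "expansion k 0 (\<lambda>_. 0)"
    unfolding expansion_def using inv_poly_closed(1) P_closed(1) by simp
  then show ?case using \<open>f = 0\<close> by blast
next
  case (Suc m)
  have fA: "f \<in> A" using Suc.prems(1) sym_power_algebra by blast
  define p where "p w = (if len w = m then bgg w f else 0)" for w
  have p_inv: "inv_poly (p w)" if "w \<in> WG" for w
  proof (cases "len w = m")
    case True
    have "inv_poly (bgg w f)" by (rule bgg_inv_poly[OF that fA]) (use Suc.prems(2) True in auto)
    then show ?thesis using True by (simp add: p_def)
  next
    case False
    then show ?thesis using inv_poly_closed(1) by (simp add: p_def)
  qed
  have p_deg: "(len w \<le> k \<longrightarrow> p w \<in> P (k - len w)) \<and> (k < len w \<longrightarrow> p w = 0)" if "w \<in> WG" for w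
    using bgg_degree[OF that Suc.prems(1)] P_closed(1) by (cases "len w = m") (auto simp: p_def)
  let ?s = "\<Sum>w\<in>WG. p w * schubert w"
  have "p w * schubert w \<in> P k" if w: "w \<in> WG" for w
  proof (cases "len w \<le> k")
    case True
    then have "p w * schubert w \<in> P (k - len w + len w)" using p_deg[OF w] schubert_P[OF w] mult_sym_power by blast
    then show ?thesis using True by simp
  next
    case False
    then show ?thesis using p_deg[OF w] P_closed(1) by simp
  qed
  then have s: "?s \<in> P k" by (intro subspace_sum[OF subspace_sym_power])
  have zero: "bgg u (f - ?s) = 0" if u: "u \<in> WG" "m \<le> len u" for u
  proof -
    have "(\<Sum>w\<in>WG. p w * bgg u (schubert w)) = (\<Sum>w\<in>WG. if w = u then bgg u f else 0)"
    proof (rule sum.cong[OF refl])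
      fix w assume w: "w \<in> WG"
      consider "len w \<noteq> m" "w \<noteq> u" | "len w \<noteq> m" "w = u" | "len w = m" "m < len u" | "len w = m" "len u = m"
        using u(2) by linarith
      then show "p w * bgg u (schubert w) = (if w = u then bgg u f else 0)"
      proof cases
        case 1
        then show ?thesis by (simp add: p_def)
      next
        case 2
        then have "Suc m \<le> len u" using u(2) by simp
        then have "bgg u f = 0" by (rule Suc.prems(2)[OF u(1)])
        then show ?thesis using 2 by (simp add: p_def)
      next
        case 3
        then show ?thesis using bgg_schubert_high[OF u(1) w] by auto
      next
        case 4
        then show ?thesis using bgg_schubert_eq[OF u(1) w] by (simp add: p_def)
      qed
    qed
    also have "\<dots> = bgg u f" using finite_WG u by simp
    finally show ?thesis
      using bgg_diff[OF u(1) fA sym_power_algebra[OF s]] bgg_sum_schubert[OF u(1), of p] p_inv by simp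
  qed
  obtain q where q: "expansion k (f - ?s) q"
    using Suc.IH[OF subspace_diff[OF subspace_sym_power Suc.prems(1) s] zero] by blast
  have "f - ?s = (\<Sum>w\<in>WG. q w * schubert w)" using q unfolding expansion_def by blast
  then have "f = (\<Sum>w\<in>WG. q w * schubert w) + ?s" by (simp only: diff_eq_eq)
  also have "\<dots> = (\<Sum>w\<in>WG. (p w + q w) * schubert w)" by (simp add: sum.distrib distrib_right)
  finally have "f = (\<Sum>w\<in>WG. (p w + q w) * schubert w)" .
  then have "expansion k f (\<lambda>w. p w + q w)"
    using q p_inv p_deg inv_poly_closed(2) P_closed(2)
    unfolding expansion_def by simp
  then show ?case by blast
qed

lemma expansion_exists: "f \<in> P k \<Longrightarrow> \<exists>p. expansion k f p"
proof (rule expansion_aux[where m = "Suc (card Pos)"])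
  fix w assume w: "w \<in> WG" "Suc (card Pos) \<le> len w"
  then show "bgg w f = 0" using len_comp_w0[OF w(1)] by linarith
qed

text \<open>The matrix of \<open>bgg u (schubert w)\<close> is triangular with respect to length and
  has unit diagonal.\<close>

lemma expansion_unique:
  assumes p: "\<And>w. w \<in> WG \<Longrightarrow> inv_poly (p w)" and z: "(\<Sum>w\<in>WG. p w * schubert w) = 0" and u: "u \<in> WG"
  shows "p u = 0"
proof -
  \<comment> \<open>The measure makes the induction run from the longest elements downwards.\<close>
  have "\<forall>u\<in>WG. card Pos - len u = n \<longrightarrow> p u = 0" for n
  proof (induction n rule: less_induct)
    case (less n)
    have "p u = 0" if u: "u \<in> WG" "card Pos - len u = n" for u
    proof -
      have "(\<Sum>w\<in>WG. p w * bgg u (schubert w)) = (\<Sum>w\<in>WG. if w = u then p u else 0)"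
      proof (rule sum.cong[OF refl])
        fix w assume w: "w \<in> WG"
        consider "len w < len u" | "len w = len u" | "len w > len u" by linarith
        then show "p w * bgg u (schubert w) = (if w = u then p u else 0)"
        proof cases
          case 1
          then show ?thesis using bgg_schubert_high[OF u(1) w] by auto
        next
          case 2
          then show ?thesis using bgg_schubert_eq[OF u(1) w] by simp
        next
          case 3
          then have "card Pos - len w < n" using u(2) len_comp_w0[OF w] by linarith
          then have "p w = 0" using less w by blast
          moreover have "w \<noteq> u" using 3 by auto
          ultimately show ?thesis by simp
        qed
      qed
      also have "\<dots> = p u" using finite_WG u by simp
      finally show ?thesis using bgg_sum_schubert[OF u(1), of p] p z bgg_zero[OF u(1)] by simp
    qed
    then show ?case by blast
  qed
  then show ?thesis using u by blast
qed

definition module_coord :: "nat \<Rightarrow> ('a \<Rightarrow> real) \<Rightarrow> ('a \<Rightarrow> 'a) \<Rightarrow> 'a \<Rightarrow> real" where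
  "module_coord k f = (SOME p. expansion k f p)"

lemma module_coord: "f \<in> P k \<Longrightarrow> expansion k f (module_coord k f)"
  unfolding module_coord_def by (rule someI_ex[OF expansion_exists])

lemma module_coord_props:
  assumes "f \<in> P k" "w \<in> WG"
  shows "inv_poly (module_coord k f w)" "len w \<le> k \<Longrightarrow> module_coord k f w \<in> P (k - len w)" "k < len w \<Longrightarrow> module_coord k f w = 0"
  using module_coord[OF assms(1)] assms(2) unfolding expansion_def by blast+

lemma module_coord_sum: "f \<in> P k \<Longrightarrow> (\<Sum>w\<in>WG. module_coord k f w * schubert w) = f"
  using module_coord[of f k] unfolding expansion_def by metis

lemma module_coord_eqI:
  assumes f: "f \<in> P k" and p: "\<And>w. w \<in> WG \<Longrightarrow> inv_poly (p w)" "(\<Sum>w\<in>WG. p w * schubert w) = f" and w: "w \<in> WG"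
  shows "module_coord k f w = p w"
proof -
  have "(\<Sum>w\<in>WG. (module_coord k f w - p w) * schubert w) = 0"
    using module_coord_sum[OF f] p(2) by (simp add: left_diff_distrib sum_subtractf)
  then have "module_coord k f w - p w = 0"
    using expansion_unique[of "\<lambda>w. module_coord k f w - p w"] module_coord_props(1)[OF f] p(1) inv_poly_closed(3) w by blast
  then show ?thesis by simp
qed

lemma module_coord_lin: assumes w: "w \<in> WG" shows "lin_on (P k) (\<lambda>f. module_coord k f w)"
  unfolding lin_on_def
proof (intro conjI ballI allI)
  fix f g assume fg: "f \<in> P k" "g \<in> P k"
  show "module_coord k (f + g) w = module_coord k f w + module_coord k g w"
  proof (rule module_coord_eqI[OF subspace_add[OF subspace_sym_power fg] _ _ w])
    show "(\<Sum>w\<in>WG. (module_coord k f w + module_coord k g w) * schubert w) = f + g"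
      using module_coord_sum fg by (simp add: distrib_right sum.distrib)
  qed (use module_coord_props(1) fg inv_poly_closed(2) in blast)
next
  fix c f assume f: "f \<in> P k"
  show "module_coord k (c *\<^sub>R f) w = c *\<^sub>R module_coord k f w"
  proof (rule module_coord_eqI[OF subspace_scale[OF subspace_sym_power f] _ _ w])
    show "(\<Sum>w\<in>WG. c *\<^sub>R module_coord k f w * schubert w) = c *\<^sub>R f"
      using module_coord_sum[OF f] by (simp add: fun_mult_scaleR(1) flip: scaleR_sum_right)
  qed (use module_coord_props(1) f inv_poly_closed(4) in blast)
qed

text \<open>Applying \<open>bgg w\<close> to the expansion kills shorter Schubert classes and
  separates those of equal length, while longer ones have coefficient zero in degree
  \<open>k\<close>. The surviving coefficient has degree 0, hence is its value at
  \<open>0\<close>.\<close>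

lemma module_coord_top:
  assumes f: "f \<in> P k" and w: "w \<in> WG" "len w = k"
  shows "module_coord k f w = bgg w f 0 *\<^sub>R 1"
proof -
  have c: "module_coord k f w \<in> P 0" using module_coord_props(2)[OF f w(1)] w(2) by simp
  have "bgg w f = (\<Sum>v\<in>WG. module_coord k f v * bgg w (schubert v))"
    using bgg_sum_schubert[OF w(1), of "module_coord k f"] module_coord_props(1)[OF f] module_coord_sum[OF f] by simp
  also have "\<dots> = (\<Sum>v\<in>WG. if v = w then module_coord k f w else 0)"
  proof (rule sum.cong[OF refl])
    fix v assume v: "v \<in> WG"
    consider "len v < len w" | "len v = len w" | "len v > len w" by linarith
    then show "module_coord k f v * bgg w (schubert v) = (if v = w then module_coord k f w else 0)"
    proof cases
      case 1
      then show ?thesis using bgg_schubert_high[OF w(1) v] by auto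
    next
      case 2
      then show ?thesis using bgg_schubert_eq[OF w(1) v] by simp
    next
      case 3
      then show ?thesis using module_coord_props(3)[OF f v] w(2) by auto
    qed
  qed
  also have "\<dots> = module_coord k f w" using finite_WG w by simp
  finally show ?thesis using P0_const[OF c] by metis
qed

section \<open>The coinvariant algebra and its Schubert basis\<close>

abbreviation coideal where "coideal \<equiv> coinvariant_ideal WG V"

lemma subspace_coideal: "subspace coideal" by (simp add: coinvariant_ideal_def)

lemma coidealI: "g \<in> A \<Longrightarrow> 0 < d \<Longrightarrow> f \<in> invP d \<Longrightarrow> g * f \<in> coideal"
  unfolding coinvariant_ideal_def invP_def inv_poly_def by (rule span_base) blast

lemma coideal_induct:
  assumes h: "h \<in> coideal" and sub: "subspace {h. Q h}"
    and gen: "\<And>g f d. g \<in> A \<Longrightarrow> 0 < d \<Longrightarrow> f \<in> invP d \<Longrightarrow> Q (g * f)"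
  shows "Q h"
proof -
  have "{g * f | g f d. g \<in> A \<and> 0 < d \<and> f \<in> P d \<and> (\<forall>w\<in>WG. act w f = f)} \<subseteq> {h. Q h}"
  proof clarify
    fix g f :: "'a \<Rightarrow> real" and d :: nat
    assume "g \<in> A" "0 < d" "f \<in> P d" "\<forall>w\<in>WG. act w f = f"
    then have "f \<in> invP d" using sym_power_algebra unfolding invP_def inv_poly_def by blast
    then show "Q (g * f)" using gen[OF \<open>g \<in> A\<close> \<open>0 < d\<close>] by blast
  qed
  then show ?thesis using h span_minimal[OF _ sub] unfolding coinvariant_ideal_def by blast
qed

text \<open>The operators are linear over the invariants, and an invariant of positive degree
  vanishes at \<open>0\<close>.\<close>

lemma bgg_coideal: "w \<in> WG \<Longrightarrow> h \<in> coideal \<Longrightarrow> h \<in> A \<and> bgg w h 0 = 0"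
proof -
  assume w: "w \<in> WG" and h: "h \<in> coideal"
  show ?thesis
  proof (rule coideal_induct[OF h])
    show "subspace {h. h \<in> A \<and> bgg w h 0 = 0}"
      by (rule subspaceI) (auto simp: A_closed bgg_zero[OF w] bgg_add[OF w] bgg_scale[OF w])
    fix g f d assume gf: "g \<in> A" "0 < d" "f \<in> invP d"
    have f0: "f 0 = 0" using sym_power_at_0 gf unfolding invP_def by blast
    have f: "f \<in> A" "inv_poly f" using gf inv_poly_A unfolding invP_def by blast+
    have "bgg w (g * f) = f * bgg w g" using bgg_inv_mult[OF w f(2) gf(1)] by (simp add: mult.commute)
    then show "g * f \<in> A \<and> bgg w (g * f) 0 = 0" using f0 A_closed(5)[OF gf(1) f(1)] by simp
  qed
qed

lemma act_coideal: "v \<in> WG \<Longrightarrow> h \<in> coideal \<Longrightarrow> act v h \<in> coideal"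
proof -
  assume v: "v \<in> WG" and h: "h \<in> coideal"
  show ?thesis
  proof (rule coideal_induct[OF h subspace_linear_preimage[OF linear_act subspace_coideal]])
    fix g f d assume gf: "g \<in> A" "0 < d" "f \<in> invP d"
    have "act v f = f" using gf(3) v by (simp add: invP_def inv_poly_def)
    then have "act v (g * f) = act v g * f" by (simp add: act_add)
    then show "act v (g * f) \<in> coideal" using coidealI[OF WG_act_A[OF v gf(1)] gf(2,3)] by simp
  qed
qed

text \<open>In the expansion of \<open>f\<close>, coefficients at elements shorter than
  \<open>k\<close> have positive degree, so their terms lie in the ideal; modulo it only the
  Schubert classes of length \<open>k\<close> remain. The functionals are well defined modulo the
  ideal by \<open>bgg_coideal\<close>.\<close>

lemma dual_coinvariants:
  "dual_mod (P k) coideal {w \<in> WG. len w = k} schubert (\<lambda>w f. bgg w f 0)"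
  unfolding dual_mod_def
proof (intro conjI ballI)
  show "finite {w \<in> WG. len w = k}" using finite_WG by simp
  fix f assume f: "f \<in> P k"
  have "f - (\<Sum>w | w \<in> WG \<and> len w = k. bgg w f 0 *\<^sub>R schubert w) = (\<Sum>w\<in>WG. if len w = k then 0 else module_coord k f w * schubert w)"
  proof -
    have eq: "bgg w f 0 *\<^sub>R schubert w = module_coord k f w * schubert w" if "w \<in> WG" "len w = k" for w
      unfolding module_coord_top[OF f that] by (simp add: fun_mult_scaleR)
    have e1: "(\<Sum>w | w \<in> WG \<and> len w = k. bgg w f 0 *\<^sub>R schubert w) = (\<Sum>w\<in>WG. if len w = k then module_coord k f w * schubert w else 0)"
      unfolding sum.inter_filter[OF finite_WG, symmetric] by (rule sum.cong) (use eq in auto)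
    have e2: "f - (\<Sum>w\<in>WG. if len w = k then module_coord k f w * schubert w else 0) =
       (\<Sum>w\<in>WG. module_coord k f w * schubert w - (if len w = k then module_coord k f w * schubert w else 0))"
      unfolding sum_subtractf module_coord_sum[OF f] ..
    have e3: "\<dots> = (\<Sum>w\<in>WG. if len w = k then 0 else module_coord k f w * schubert w)"
      by (rule sum.cong) auto
    show ?thesis unfolding e1 e2 e3 ..
  qed
  also have "\<dots> \<in> coideal"
  proof (rule subspace_sum[OF subspace_coideal])
    fix w assume w: "w \<in> WG"
    consider "len w = k" | "len w < k" | "k < len w" by linarith
    then show "(if len w = k then 0 else module_coord k f w * schubert w) \<in> coideal"
    proof cases
      case 2
      then have "module_coord k f w \<in> invP (k - len w)" using module_coord_props[OF f w] by (simp add: invP_def)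
      then have "schubert w * module_coord k f w \<in> coideal" using coidealI[OF schubert_A[OF w], of "k - len w"] 2 by simp
      then show ?thesis using 2 by (simp add: mult.commute)
    next
      case 3
      then show ?thesis using module_coord_props(3)[OF f w] subspace_0[OF subspace_coideal] by simp
    qed (simp add: subspace_0[OF subspace_coideal])
  qed
  finally show "f - (\<Sum>w | w \<in> WG \<and> len w = k. bgg w f 0 *\<^sub>R schubert w) \<in> coideal" .
next
  fix w assume w: "w \<in> {w \<in> WG. len w = k}"
  show "schubert w \<in> P k" using schubert_P w by auto
  show "lin_on (P k) (\<lambda>f. bgg w f 0)"
    using w by (auto simp: lin_on_def bgg_add bgg_scale sym_power_algebra)
  fix f assume "f \<in> P k \<inter> coideal"
  then show "bgg w f 0 = 0" using bgg_coideal w by blast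
next
  fix w u assume "w \<in> {w \<in> WG. len w = k}" "u \<in> {w \<in> WG. len w = k}"
  then show "bgg w (schubert u) 0 = (if w = u then 1 else 0)" using bgg_schubert_eq[of w u] by auto
qed (simp_all add: subspace_sym_power subspace_coideal)

lemma lin_on_act: "lin_on U (act v)" by (simp add: lin_on_def act_add)

lemma coinvariant_character_eq:
  assumes v: "v \<in> WG"
  shows "coinvariant_character \<Phi> k v = (\<Sum>w | w \<in> WG \<and> len w = k. bgg w (act v (schubert w)) 0)"
  unfolding coinvariant_character_def weyl_group_eq
  by (rule trace_mod_eq[OF dual_coinvariants lin_on_act]) (use v WG_act_P act_coideal in blast)+

text \<open>Here polynomial degree meets length: the dimension in degree \<open>k\<close> is the
  number of elements of length \<open>k\<close>.\<close>

lemma coinvariant_character_id: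
  "coinvariant_character \<Phi> k id = card {w \<in> WG. len w = k}"
proof -
  have "coinvariant_character \<Phi> k id = (\<Sum>w | w \<in> WG \<and> len w = k. bgg w (schubert w) 0)"
    using coinvariant_character_eq[OF WG_id] by simp
  also have "\<dots> = (\<Sum>w | w \<in> WG \<and> len w = k. 1)"
    by (rule sum.cong) (auto simp: bgg_schubert_eq)
  finally show ?thesis by simp
qed

section \<open>Graded traces on the symmetric algebra\<close>

definition inv_basis :: "nat \<Rightarrow> ('a \<Rightarrow> real) set" where
  "inv_basis d = (SOME B. independent B \<and> finite B \<and> span B = invP d)"

lemma inv_basis: "independent (inv_basis d)" "finite (inv_basis d)" "span (inv_basis d) = invP d"
proof -
  obtain X where X: "finite X" "P d \<subseteq> span X" using sym_power_finite_dim[OF subspace_span] by blast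
  have "invP d \<subseteq> span X" using X(2) unfolding invP_def by blast
  then obtain B where "independent B \<and> finite B \<and> span B = invP d"
    using finite_dim_basis[OF subspace_invP X(1)] by metis
  from someI[where P = "\<lambda>B. independent B \<and> finite B \<and> span B = invP d", OF this]
  show "independent (inv_basis d)" "finite (inv_basis d)" "span (inv_basis d) = invP d"
    unfolding inv_basis_def by blast+
qed

definition sym_trace :: "nat \<Rightarrow> ('a \<Rightarrow> 'a) \<Rightarrow> real" where
  "sym_trace k v = trace_mod (P k) {0} (act v)"

text \<open>Freeness over the invariants in coordinates: an invariant basis element times a Schubert
  class of complementary degree. A coordinate is taken first in the module expansion and then in the
  basis of invariants.\<close>

lemma dual_sym_power:
  "dual_mod (P k) {0} (SIGMA w:{w \<in> WG. len w \<le> k}. inv_basis (k - len w)) (\<lambda>(w, g). g * schubert w)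
     (\<lambda>(w, g) f. representation (inv_basis (k - len w)) (module_coord k f w) g)"
  (is "dual_mod _ _ ?I ?e ?phi")
  unfolding dual_mod_def
proof (intro conjI ballI)
  have gb: "g \<in> invP (k - len w)" if "g \<in> inv_basis (k - len w)" for g w
    using that inv_basis(3) span_base by blast
  show "finite ?I" using finite_WG inv_basis(2) by (intro finite_SigmaI) auto
  fix i assume i: "i \<in> ?I"
  obtain w g where wg: "i = (w, g)" "w \<in> WG" "len w \<le> k" "g \<in> inv_basis (k - len w)" using i by auto
  have gi: "inv_poly g" "g \<in> P (k - len w)" using gb[OF wg(4)] by (auto simp: invP_def)
  have "g * schubert w \<in> P (k - len w + len w)" using mult_sym_power[OF gi(2) schubert_P[OF wg(2)]] .
  then show e: "?e i \<in> P k" using wg by simp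
  have sp: "module_coord k f w \<in> span (inv_basis (k - len w))" if "f \<in> P k" for f
    using module_coord_props[OF that wg(2)] wg(3) unfolding inv_basis(3) invP_def by blast
  show "lin_on (P k) (?phi i)"
    using lin_onD[OF module_coord_lin[OF wg(2)]] sp representation_add[OF inv_basis(1)] representation_scale[OF inv_basis(1)]
    by (simp add: lin_on_def wg(1))
  show "?phi i f = 0" if "f \<in> P k \<inter> {0}" for f
    using that lin_on_zero[OF module_coord_lin[OF wg(2)] subspace_sym_power] by (simp add: wg(1) representation_zero)
  fix j assume j: "j \<in> ?I"
  obtain u h where uh: "j = (u, h)" "u \<in> WG" "len u \<le> k" "h \<in> inv_basis (k - len u)" using j by auto
  have hi: "inv_poly h" "h \<in> P (k - len u)" using gb[OF uh(4)] by (auto simp: invP_def)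
  have hP: "h * schubert u \<in> P k" using mult_sym_power[OF hi(2) schubert_P[OF uh(2)]] uh(3) by simp
  have "(\<Sum>w\<in>WG. (if w = u then h else 0) * schubert w) = (\<Sum>w\<in>WG. if w = u then h * schubert u else 0)"
    by (rule sum.cong) auto
  also have "\<dots> = h * schubert u" using finite_WG uh(2) by simp
  finally have "module_coord k (h * schubert u) w = (if w = u then h else 0)"
    using module_coord_eqI[OF hP _ _ wg(2), of "\<lambda>w. if w = u then h else 0"] hi(1) inv_poly_closed(1) by simp
  then show "?phi i (?e j) = (if i = j then 1 else 0)"
    using wg uh representation_basis[OF inv_basis(1) uh(4)] by (auto simp: representation_zero)
next
  fix f assume f: "f \<in> P k"
  have "(\<Sum>i\<in>?I. ?phi i f *\<^sub>R ?e i) =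
     (\<Sum>w | w \<in> WG \<and> len w \<le> k. \<Sum>g\<in>inv_basis (k - len w). representation (inv_basis (k - len w)) (module_coord k f w) g *\<^sub>R (g * schubert w))"
    using finite_WG inv_basis(2) by (subst sum.Sigma) (auto simp: case_prod_unfold)
  also have "\<dots> = (\<Sum>w | w \<in> WG \<and> len w \<le> k. module_coord k f w * schubert w)"
  proof (rule sum.cong[OF refl])
    fix w assume "w \<in> {w \<in> WG. len w \<le> k}"
    then have "module_coord k f w \<in> span (inv_basis (k - len w))"
      using module_coord_props[OF f] unfolding inv_basis(3) invP_def by blast
    then have "(\<Sum>g\<in>inv_basis (k - len w). representation (inv_basis (k - len w)) (module_coord k f w) g *\<^sub>R g) = module_coord k f w"
      using sum_representation_eq[OF inv_basis(1)] inv_basis(2) by blast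
    then show "(\<Sum>g\<in>inv_basis (k - len w). representation (inv_basis (k - len w)) (module_coord k f w) g *\<^sub>R (g * schubert w)) = module_coord k f w * schubert w"
      by (simp only: fun_mult_scaleR(1)[symmetric] sum_distrib_right[symmetric])
  qed
  also have "\<dots> = (\<Sum>w\<in>WG. module_coord k f w * schubert w)"
    using finite_WG module_coord_props(3)[OF f] by (intro sum.mono_neutral_left) auto
  also have "\<dots> = f" by (rule module_coord_sum[OF f])
  finally show "f - (\<Sum>i\<in>?I. ?phi i f *\<^sub>R ?e i) \<in> {0}" by simp
qed (simp_all add: subspace_sym_power)

text \<open>The part of \<open>act v (schubert w)\<close> in the augmentation ideal has coefficients of positive degree, so
  it does not contribute to the diagonal.\<close>
lemma sym_trace_eq:
  assumes v: "v \<in> WG"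
  shows "sym_trace k v = (\<Sum>m\<le>k. card (inv_basis (k - m)) * coinvariant_character \<Phi> m v)"
proof -
  let ?I = "SIGMA w:{w \<in> WG. len w \<le> k}. inv_basis (k - len w)"
  have "sym_trace k v = (\<Sum>(w, g)\<in>?I. representation (inv_basis (k - len w)) (module_coord k (act v (g * schubert w)) w) g)"
    unfolding sym_trace_def
    by (subst trace_mod_eq[OF dual_sym_power lin_on_act]) (use WG_act_P[OF v] in \<open>auto simp: act_add case_prod_unfold\<close>)
  also have "\<dots> = (\<Sum>(w, g)\<in>?I. bgg w (act v (schubert w)) 0)"
  proof (rule sum.cong[OF refl], clarify)
    fix w g assume w: "w \<in> WG" "len w \<le> k" and g: "g \<in> inv_basis (k - len w)"
    have gi: "inv_poly g" "g \<in> P (k - len w)" using g inv_basis(3) span_base unfolding invP_def by blast+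
    have gP: "g * schubert w \<in> P k" using mult_sym_power[OF gi(2) schubert_P[OF w(1)]] w(2) by simp
    let ?c = "module_coord (len w) (act v (schubert w))"
    have vb: "act v (schubert w) \<in> P (len w)" using WG_act_P[OF v schubert_P[OF w(1)]] .
    have "act v (g * schubert w) = g * act v (schubert w)" using gi(1) v by (simp add: act_add inv_poly_def)
    also have "\<dots> = g * (\<Sum>u\<in>WG. ?c u * schubert u)" unfolding module_coord_sum[OF vb] ..
    also have "\<dots> = (\<Sum>u\<in>WG. g * ?c u * schubert u)" by (simp only: sum_distrib_left mult.assoc)
    finally have "module_coord k (act v (g * schubert w)) w = g * ?c w"
      using module_coord_eqI[OF WG_act_P[OF v gP], of "\<lambda>u. g * ?c u" w] inv_poly_closed(5)[OF gi(1) module_coord_props(1)[OF vb]] w(1)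
      by simp
    also have "\<dots> = bgg w (act v (schubert w)) 0 *\<^sub>R g"
      unfolding module_coord_top[OF vb w(1) refl] by (simp add: fun_mult_scaleR)
    finally show "representation (inv_basis (k - len w)) (module_coord k (act v (g * schubert w)) w) g = bgg w (act v (schubert w)) 0"
      using representation_scale[OF inv_basis(1) span_base[OF g]] representation_basis[OF inv_basis(1) g] by simp
  qed
  also have "\<dots> = (\<Sum>w | w \<in> WG \<and> len w \<le> k. card (inv_basis (k - len w)) * bgg w (act v (schubert w)) 0)"
    using finite_WG inv_basis(2) by (subst sum.Sigma[symmetric]) auto
  also have "\<dots> = (\<Sum>m\<le>k. \<Sum>w | w \<in> {w \<in> WG. len w \<le> k} \<and> len w = m. card (inv_basis (k - len w)) * bgg w (act v (schubert w)) 0)"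
    using finite_WG by (intro sum.group[symmetric]) auto
  also have "\<dots> = (\<Sum>m\<le>k. card (inv_basis (k - m)) * coinvariant_character \<Phi> m v)"
    unfolding coinvariant_character_eq[OF v] sum_distrib_left
    by (intro sum.cong) auto
  finally show ?thesis .
qed

text \<open>Only constants occur in degree 0; this keeps the Hilbert series of the invariants
  nonzero, so that it can be cancelled at the end.\<close>

lemma card_inv_basis_0: "card (inv_basis 0) = 1"
proof -
  have "invP 0 = span {1}"
  proof -
    have "act w f = f" if "f \<in> P 0" for w :: "'a \<Rightarrow> 'a" and f
      using that by (auto simp: sym_power_0 act_def fun_eq_iff)
    then have "invP 0 = P 0" unfolding invP_def inv_poly_def using sym_power_algebra by blast
    also have "\<dots> = span {1}" by (simp add: sym_power_def one_fun_def)
    finally show ?thesis .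
  qed
  moreover have "independent {1 :: 'a \<Rightarrow> real}" by (simp add: fun_eq_iff)
  ultimately have "card (inv_basis 0) = card {1 :: 'a \<Rightarrow> real}"
    using inv_basis(1,3)[of 0] by (metis dim_eq_card dim_span)
  then show ?thesis by simp
qed

end

section \<open>Newton's identities for symmetric powers\<close>

lemma lin_on_compose: "lin_on U T \<Longrightarrow> T ` U \<subseteq> U' \<Longrightarrow> lin_on U' S \<Longrightarrow> lin_on U (\<lambda>u. S (T u))"
  unfolding lin_on_def image_subset_iff by simp

lemma comb_image:
  assumes "subspace U" "S ` X \<subseteq> U" "T ` X \<subseteq> U"
  shows "(\<lambda>u. c *\<^sub>R S u + T u) ` X \<subseteq> U"
proof (rule image_subsetI)
  fix x assume "x \<in> X"
  then have "S x \<in> U" "T x \<in> U" using assms by auto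
  then show "c *\<^sub>R S x + T x \<in> U" using assms(1) by (intro subspace_add subspace_scale)
qed

lemma trace_mod_add:
  assumes d: "dual_mod U N I e \<phi>"
    and S: "lin_on U S" "S ` U \<subseteq> U" "S ` (U \<inter> N) \<subseteq> N"
    and T: "lin_on U T" "T ` U \<subseteq> U" "T ` (U \<inter> N) \<subseteq> N"
  shows "trace_mod U N (\<lambda>u. c *\<^sub>R S u + T u) = c * trace_mod U N S + trace_mod U N T"
proof -
  note D = d[unfolded dual_mod_def]
  have sub: "subspace U" "subspace N" using D by blast+
  have "trace_mod U N (\<lambda>u. c *\<^sub>R S u + T u) = (\<Sum>i\<in>I. \<phi> i (c *\<^sub>R S (e i) + T (e i)))"
  proof (rule trace_mod_eq[OF d])
    show "lin_on U (\<lambda>u. c *\<^sub>R S u + T u)"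
      using S(1) T(1) by (simp add: lin_on_def algebra_simps)
    show "(\<lambda>u. c *\<^sub>R S u + T u) ` U \<subseteq> U"
      by (rule comb_image[OF sub(1) S(2) T(2)])
    show "(\<lambda>u. c *\<^sub>R S u + T u) ` (U \<inter> N) \<subseteq> N"
      by (rule comb_image[OF sub(2) S(3) T(3)])
  qed
  also have "\<dots> = (\<Sum>i\<in>I. c * \<phi> i (S (e i)) + \<phi> i (T (e i)))"
  proof (rule sum.cong[OF refl])
    fix i assume i: "i \<in> I"
    then have m: "lin_on U (\<phi> i)" "S (e i) \<in> U" "T (e i) \<in> U" using D S(2) T(2) by auto
    then have m4: "c *\<^sub>R S (e i) \<in> U" using sub(1) by (intro subspace_scale)
    show "\<phi> i (c *\<^sub>R S (e i) + T (e i)) = c * \<phi> i (S (e i)) + \<phi> i (T (e i))"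
      using lin_onD(1)[OF m(1) m4 m(3)] lin_onD(2)[OF m(1,2), of c] by simp
  qed
  also have "\<dots> = c * trace_mod U N S + trace_mod U N T"
    unfolding trace_mod_eq[OF d S] trace_mod_eq[OF d T] by (simp add: sum.distrib sum_distrib_left)
  finally show ?thesis .
qed

lemma trace_mod_cong:
  assumes d: "dual_mod U N I e \<phi>" and S: "lin_on U S" "S ` U \<subseteq> U" "S ` (U \<inter> N) \<subseteq> N"
    and eq: "\<And>u. u \<in> U \<Longrightarrow> T u = S u"
  shows "trace_mod U N T = trace_mod U N S"
proof -
  note D = d[unfolded dual_mod_def]
  have "T ` U \<subseteq> U" "T ` (U \<inter> N) \<subseteq> N" using S eq by auto
  moreover have "lin_on U T"
    using S(1) D eq by (auto simp: lin_on_def subspace_add subspace_scale)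
  ultimately have "trace_mod U N T = (\<Sum>i\<in>I. \<phi> i (T (e i)))" using trace_mod_eq[OF d] by blast
  also have "\<dots> = (\<Sum>i\<in>I. \<phi> i (S (e i)))" using D eq by (intro sum.cong) auto
  finally show ?thesis unfolding trace_mod_eq[OF d S] .
qed

section \<open>Directional derivatives of polynomial functions\<close>

definition dir_deriv :: "'a::euclidean_space \<Rightarrow> ('a \<Rightarrow> real) \<Rightarrow> 'a \<Rightarrow> real" where
  "dir_deriv y f x = deriv (\<lambda>t. f (x + t *\<^sub>R y)) 0"

lemma dir_deriv_exists:
  "f \<in> sym_algebra V \<Longrightarrow> \<forall>x. \<exists>d. ((\<lambda>t. f (x + t *\<^sub>R y)) has_field_derivative d) (at (0::real))"
proof (induction rule: sym_algebra_induct)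
  case subspace
  show ?case
  proof (rule subspaceI, goal_cases)
    case 1
    show ?case by (auto intro!: exI derivative_intros)
  next
    case (2 f g)
    show ?case
    proof (intro CollectI allI)
      fix x
      obtain d e where "((\<lambda>t. f (x + t *\<^sub>R y)) has_field_derivative d) (at 0)"
        "((\<lambda>t. g (x + t *\<^sub>R y)) has_field_derivative e) (at 0)" using 2 by blast
      from DERIV_add[OF this] show "\<exists>d. ((\<lambda>t. (f + g) (x + t *\<^sub>R y)) has_field_derivative d) (at 0)"
        by auto
    qed
  next
    case (3 c f)
    show ?case
    proof (intro CollectI allI)
      fix x
      obtain d where "((\<lambda>t. f (x + t *\<^sub>R y)) has_field_derivative d) (at 0)" using 3 by blast
      from DERIV_cmult[OF this, of c] show "\<exists>d. ((\<lambda>t. (c *\<^sub>R f) (x + t *\<^sub>R y)) has_field_derivative d) (at 0)"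
        by auto
    qed
  qed
next
  case one
  show ?case by (auto intro!: exI derivative_intros)
next
  case (mult u f)
  show ?case
  proof
    fix x
    obtain d where d: "((\<lambda>t. f (x + t *\<^sub>R y)) has_field_derivative d) (at 0)" using mult by blast
    have "((\<lambda>t. u \<bullet> x + t * (u \<bullet> y)) has_field_derivative (u \<bullet> y)) (at 0)"
      by (auto intro!: derivative_eq_intros)
    from DERIV_mult[OF this d] show "\<exists>d. ((\<lambda>t. (lin u * f) (x + t *\<^sub>R y)) has_field_derivative d) (at 0)"
      by (auto simp: lin_def inner_add_right)
  qed
qed

lemma dir_deriv:
  "f \<in> sym_algebra V \<Longrightarrow> ((\<lambda>t. f (x + t *\<^sub>R y)) has_field_derivative dir_deriv y f x) (at 0)"
  using dir_deriv_exists[of f V y] DERIV_imp_deriv unfolding dir_deriv_def by metis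

lemma dir_deriv_eqI: "((\<lambda>t. f (x + t *\<^sub>R y)) has_field_derivative d) (at 0) \<Longrightarrow> dir_deriv y f x = d"
  unfolding dir_deriv_def by (rule DERIV_imp_deriv)

lemma dir_deriv_add:
  assumes "f \<in> sym_algebra V" "g \<in> sym_algebra V"
  shows "dir_deriv y (f + g) = dir_deriv y f + dir_deriv y g"
proof
  fix x
  show "dir_deriv y (f + g) x = (dir_deriv y f + dir_deriv y g) x"
    using DERIV_add[OF dir_deriv[OF assms(1)] dir_deriv[OF assms(2)], of x y x y]
    by (intro dir_deriv_eqI) simp
qed

lemma dir_deriv_scale:
  assumes "f \<in> sym_algebra V"
  shows "dir_deriv y (c *\<^sub>R f) = c *\<^sub>R dir_deriv y f"
proof
  fix x
  show "dir_deriv y (c *\<^sub>R f) x = (c *\<^sub>R dir_deriv y f) x"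
    using DERIV_cmult[OF dir_deriv[OF assms(1)], of c x y]
    by (intro dir_deriv_eqI) simp
qed

lemma dir_deriv_lin_mult:
  assumes "f \<in> sym_algebra V"
  shows "dir_deriv y (lin u * f) = (u \<bullet> y) *\<^sub>R f + lin u * dir_deriv y f"
proof
  fix x
  have "((\<lambda>t. u \<bullet> x + t * (u \<bullet> y)) has_field_derivative (u \<bullet> y)) (at 0)"
    by (auto intro!: derivative_eq_intros)
  from DERIV_mult[OF this dir_deriv[OF assms, of x y]]
  show "dir_deriv y (lin u * f) x = ((u \<bullet> y) *\<^sub>R f + lin u * dir_deriv y f) x"
    by (intro dir_deriv_eqI) (simp add: lin_def inner_add_right mult.commute add.commute)
qed

lemma dir_deriv_degree_0: "f \<in> sym_power V 0 \<Longrightarrow> dir_deriv y f = 0"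
proof
  fix x assume "f \<in> sym_power V 0"
  then obtain c where "f = (\<lambda>_. c)" by (auto simp: sym_power_0)
  then show "dir_deriv y f x = 0 x" by (intro dir_deriv_eqI) (auto intro!: derivative_eq_intros)
qed

lemma dir_deriv_lin_on: "lin_on (sym_algebra V) (dir_deriv y)"
  by (simp add: lin_on_def dir_deriv_add dir_deriv_scale)

lemma dir_deriv_degree: "f \<in> sym_power V (Suc k) \<Longrightarrow> dir_deriv y f \<in> sym_power V k"
proof (induction k arbitrary: f)
  case 0
  have "f \<in> sym_algebra V \<and> dir_deriv y f \<in> sym_power V 0" using 0
  proof (induction rule: sym_power_Suc_induct)
    case subspace
    show ?case by (rule subspace_lin_on_preimage[OF dir_deriv_lin_on subspace_sym_algebra subspace_sym_power])
  next
    case (mult u f)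
    have f: "f \<in> sym_algebra V" using mult(2) by (rule sym_power_algebra)
    have e: "dir_deriv y (lin u * f) = (u \<bullet> y) *\<^sub>R f"
      unfolding dir_deriv_lin_mult[OF f] dir_deriv_degree_0[OF mult(2)] by simp
    show ?case unfolding e
      using subspace_scale[OF subspace_sym_power mult(2)] mult_sym_algebra[OF lin_sym_algebra[OF mult(1)] f] by blast
  qed
  then show ?case by blast
next
  case (Suc k)
  have "f \<in> sym_algebra V \<and> dir_deriv y f \<in> sym_power V (Suc k)" using Suc.prems
  proof (induction rule: sym_power_Suc_induct)
    case subspace
    show ?case by (rule subspace_lin_on_preimage[OF dir_deriv_lin_on subspace_sym_algebra subspace_sym_power])
  next
    case (mult u f)
    have f: "f \<in> sym_algebra V" using mult(2) by (rule sym_power_algebra)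
    have "(u \<bullet> y) *\<^sub>R f + lin u * dir_deriv y f \<in> sym_power V (Suc k)"
      by (intro subspace_add[OF subspace_sym_power] subspace_scale[OF subspace_sym_power] lin_sym_power mult Suc.IH)
    then show ?case unfolding dir_deriv_lin_mult[OF f]
      using mult_sym_algebra[OF lin_sym_algebra[OF mult(1)] f] by blast
  qed
  then show ?case by blast
qed

context based_roots begin

section \<open>The Euler operator and cyclicity of the trace\<close>

definition onb :: "'a set" where
  "onb = (SOME B. B \<subseteq> V \<and> pairwise orthogonal B \<and> (\<forall>x\<in>B. norm x = 1) \<and> independent B \<and> span B = V)"

lemma onb: "onb \<subseteq> V" "finite onb" "x \<in> onb \<Longrightarrow> y \<in> onb \<Longrightarrow> x \<bullet> y = (if x = y then 1 else 0)"
  "u \<in> V \<Longrightarrow> (\<Sum>y\<in>onb. (u \<bullet> y) *\<^sub>R y) = u"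
proof -
  have "\<exists>B. B \<subseteq> V \<and> pairwise orthogonal B \<and> (\<forall>x\<in>B. norm x = 1) \<and> independent B \<and> span B = V"
    using orthonormal_basis_subspace[OF subspace_span] by metis
  from someI_ex[OF this] have b: "onb \<subseteq> V" "pairwise orthogonal onb" "\<forall>x\<in>onb. norm x = 1" "independent onb" "span onb = V"
    unfolding onb_def by blast+
  show "onb \<subseteq> V" "finite onb" using b finiteI_independent by auto
  have o: "x \<bullet> y = (if x = y then 1 else 0)" if "x \<in> onb" "y \<in> onb" for x y
    using b(2,3) that by (auto simp: pairwise_def orthogonal_def norm_eq_1)
  then show "x \<in> onb \<Longrightarrow> y \<in> onb \<Longrightarrow> x \<bullet> y = (if x = y then 1 else 0)" .
  have "linear (\<lambda>u. (\<Sum>y\<in>onb. (u \<bullet> y) *\<^sub>R y) - u)"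
    by (rule linearI) (simp_all add: inner_add_left scaleR_add_left sum.distrib scaleR_sum_right algebra_simps)
  moreover have "(\<Sum>y\<in>onb. (x \<bullet> y) *\<^sub>R y) - x \<in> {0}" if x: "x \<in> onb" for x
  proof -
    have "(\<Sum>y\<in>onb. (x \<bullet> y) *\<^sub>R y) = (\<Sum>y\<in>onb. if y = x then x else 0)"
      using o[OF x] by (intro sum.cong) auto
    then show ?thesis using x \<open>finite onb\<close> by simp
  qed
  moreover assume "u \<in> V"
  ultimately have "(\<Sum>y\<in>onb. (u \<bullet> y) *\<^sub>R y) - u \<in> {0}"
    using linear_image_span_subspace[of "\<lambda>u. (\<Sum>y\<in>onb. (u \<bullet> y) *\<^sub>R y) - u" "{0}" onb u] b(5) subspace_single_0 by blast
  then show "(\<Sum>y\<in>onb. (u \<bullet> y) *\<^sub>R y) = u" by simp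
qed

definition vtrace :: "('a \<Rightarrow> 'a) \<Rightarrow> real" where "vtrace w = (\<Sum>y\<in>onb. w y \<bullet> y)"

text \<open>Euler's identity wants an orthonormal basis, the permutation action wants simple roots;
  \<open>dual_mod_swap\<close> allows the passage.\<close>

lemma vtrace_base:
  assumes w: "w \<in> WG" shows "vtrace w = (\<Sum>\<alpha>\<in>\<Delta>. coeff (w \<alpha>) \<alpha>)"
proof -
  have d: "dual_mod V {0} onb (\<lambda>y. y) (\<lambda>y u. u \<bullet> y)"
    unfolding dual_mod_def using onb
    by (auto simp: subspace_single_0 lin_on_def inner_add_left)
  have d': "dual_mod V {0} \<Delta> (\<lambda>b. b) (\<lambda>b u. coeff u b)"
    using dual_mod_representation[OF independent_base finite_base] unfolding span_roots .
  have lin: "lin_on V w" using WG_linear[OF w] by (simp add: lin_on_def linear_add linear_cmul)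
  have "(\<Sum>y\<in>onb. w (id y) \<bullet> y) = (\<Sum>\<alpha>\<in>\<Delta>. coeff (id (w \<alpha>)) \<alpha>)"
    by (rule dual_mod_swap[OF d d' lin]) (use WG_V[OF w] linear_0[OF WG_linear[OF w]] in \<open>auto simp: lin_on_def\<close>)
  then show ?thesis by (simp add: vtrace_def)
qed

lemma euler_lin_on:
  "lin_on A (\<lambda>f. \<Sum>y\<in>onb. lin y * dir_deriv y f)"
proof -
  note l = lin_onD[OF dir_deriv_lin_on]
  show ?thesis unfolding lin_on_def
    by (simp add: l distrib_left sum.distrib fun_mult_scaleR scaleR_sum_right)
qed

text \<open>By induction through the product rule: differentiating the linear factor in all
  orthonormal directions and multiplying back rebuilds that factor.\<close>

lemma euler: "f \<in> P k \<Longrightarrow> (\<Sum>y\<in>onb. lin y * dir_deriv y f) = real k *\<^sub>R f"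
proof (induction k arbitrary: f)
  case 0
  have "(\<Sum>y\<in>onb. lin y * dir_deriv y f) = real 0 *\<^sub>R f"
    unfolding dir_deriv_degree_0[OF 0] by simp
  then show ?case .
next
  case (Suc k)
  have "f \<in> A \<and> (\<Sum>y\<in>onb. lin y * dir_deriv y f) = real (Suc k) *\<^sub>R f" using Suc.prems
  proof (induction rule: sym_power_Suc_induct)
    case subspace
    have "lin_on A (\<lambda>f. real (Suc k) *\<^sub>R f)" by (simp add: lin_on_def scaleR_add_right)
    then show ?case by (rule subspace_lin_on_equalizer[OF euler_lin_on _ subspace_sym_algebra])
  next
    case (mult u f)
    have f: "f \<in> A" using mult(2) by (rule sym_power_algebra)
    have "(\<Sum>y\<in>onb. lin y * dir_deriv y (lin u * f)) = (\<Sum>y\<in>onb. lin ((u \<bullet> y) *\<^sub>R y) * f + lin u * (lin y * dir_deriv y f))"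
      unfolding dir_deriv_lin_mult[OF f] by (intro sum.cong refl) (simp add: fun_eq_iff lin_def algebra_simps)
    also have "\<dots> = lin (\<Sum>y\<in>onb. (u \<bullet> y) *\<^sub>R y) * f + lin u * (\<Sum>y\<in>onb. lin y * dir_deriv y f)"
      unfolding linear_sum[OF linear_lin] sum.distrib sum_distrib_left sum_distrib_right ..
    also have "\<dots> = lin u * f + lin u * (real k *\<^sub>R f)" unfolding onb(4)[OF mult(1)] Suc.IH[OF mult(2)] ..
    also have "\<dots> = real (Suc k) *\<^sub>R (lin u * f)" by (simp add: fun_mult_scaleR scaleR_add_left)
    finally show ?case using mult_sym_algebra[OF lin_sym_algebra[OF mult(1)] f] by blast
  qed
  then show ?case by blast
qed

text \<open>For \<open>i = 1\<close>, summing over the orthonormal basis gives the degree times the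
  action of \<open>v\<close>, by Euler's identity. The exponent \<open>i\<close> is free because
  each commutation of the two factors raises it by one.\<close>

definition euler_op :: "('a \<Rightarrow> 'a) \<Rightarrow> nat \<Rightarrow> 'a \<Rightarrow> ('a \<Rightarrow> real) \<Rightarrow> 'a \<Rightarrow> real" where
  "euler_op v i y f = lin ((v ^^ i) y) * act v (dir_deriv y f)"

lemma funpow_WG: "v \<in> WG \<Longrightarrow> v ^^ i \<in> WG"
proof (induction i)
  case 0
  show ?case unfolding funpow.simps by (rule WG_id)
next
  case (Suc i)
  then show ?case unfolding funpow.simps by (intro WG_comp) blast+
qed

lemma dir_deriv_lin_on_P: "lin_on (P k) (dir_deriv y)"
  using dir_deriv_lin_on[of V y] sym_power_algebra[of _ V k] unfolding lin_on_def by blast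

lemma lin_act_on: "lin_on (P k) (\<lambda>f. act v (dir_deriv y f))"
  using dir_deriv_lin_on_P[of k y] by (simp add: lin_on_def act_add)

lemma euler_op_lin_on: "lin_on (P k) (euler_op v i y)"
  using lin_act_on[of k v y] by (simp add: lin_on_def euler_op_def distrib_left fun_mult_scaleR)

lemma euler_op_P:
  assumes v: "v \<in> WG" and y: "y \<in> onb" and f: "f \<in> P k" shows "euler_op v i y f \<in> P k"
proof (cases k)
  case 0
  then have "euler_op v i y f = 0"
    unfolding euler_op_def using dir_deriv_degree_0[of f V y] f by (simp add: act_add)
  then show ?thesis using P_closed(1) by simp
next
  case (Suc m)
  have "(v ^^ i) y \<in> V" using WG_V[OF funpow_WG[OF v]] onb(1) y by blast
  then show ?thesis unfolding euler_op_def Suc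
    using lin_sym_power WG_act_P[OF v dir_deriv_degree] f Suc by blast
qed

abbreviation ptrace where "ptrace k \<equiv> trace_mod (P k) {0}"

lemma lin_on_image_zero: "lin_on U T \<Longrightarrow> subspace U \<Longrightarrow> T ` (U \<inter> {0}) \<subseteq> {0}"
  using lin_on_zero by auto

text \<open>The operator is multiplication after a twisted derivative, passing through degree
  \<open>m\<close>. Cyclicity of the trace reverses the order; the product rule then yields a
  multiple of \<open>act v\<close> plus the same kind of operator with
  \<open>(v ^^ Suc i) y\<close>.\<close>

lemma ptrace_euler_op_step:
  assumes v: "v \<in> WG" and y: "y \<in> onb"
  shows "ptrace (Suc m) (euler_op v i y) = ((v ^^ i) y \<bullet> y) * sym_trace m v + ptrace m (euler_op v (Suc i) y)"
proof -
  let ?u = "(v ^^ i) y"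
  let ?M = "\<lambda>g. lin ?u * g" and ?D = "\<lambda>f. act v (dir_deriv y f)"
  have u: "?u \<in> V" using WG_V[OF funpow_WG[OF v]] onb(1) y by blast
  note d = dual_sym_power[of "Suc m"] and d' = dual_sym_power[of m]
  have M: "lin_on (P m) ?M" "?M ` P m \<subseteq> P (Suc m)" "?M ` (P m \<inter> {0}) \<subseteq> {0}"
    using lin_sym_power[OF u] by (auto simp: lin_on_def distrib_left fun_mult_scaleR)
  have D: "lin_on (P (Suc m)) ?D" "?D ` P (Suc m) \<subseteq> P m" "?D ` (P (Suc m) \<inter> {0}) \<subseteq> {0}"
    using WG_act_P[OF v dir_deriv_degree] lin_act_on lin_on_image_zero[OF lin_act_on subspace_sym_power] by blast+
  have E: "lin_on (P k) (euler_op v i y)" "euler_op v i y ` P k \<subseteq> P k" "euler_op v i y ` (P k \<inter> {0}) \<subseteq> {0}" for k i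
    using euler_op_lin_on euler_op_P[OF v y] lin_on_image_zero[OF euler_op_lin_on subspace_sym_power] by blast+
  have a: "lin_on (P k) (act v)" "act v ` P k \<subseteq> P k" "act v ` (P k \<inter> {0}) \<subseteq> {0}" for k
    using lin_on_act WG_act_P[OF v] lin_on_image_zero[OF lin_on_act subspace_sym_power] by blast+
  have DM: "?D (?M g) = (?u \<bullet> y) *\<^sub>R act v g + euler_op v (Suc i) y g" if g: "g \<in> P m" for g
    unfolding dir_deriv_lin_mult[OF sym_power_algebra[OF g]] act_add WG_act_lin[OF v] euler_op_def by simp
  have DMp: "(\<lambda>g. ?D (?M g)) ` P m \<subseteq> P m" using M(2) D(2) by blast
  have eo: "euler_op v i y = (\<lambda>f. ?M (?D f))" by (rule ext) (simp only: euler_op_def)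
  have swap: "ptrace (Suc m) (\<lambda>f. ?M (?D f)) = ptrace m (\<lambda>g. ?D (?M g))"
  proof -
    have 1: "lin_on (P (Suc m)) (\<lambda>f. ?M (?D f))" "(\<lambda>f. ?M (?D f)) ` P (Suc m) \<subseteq> P (Suc m)"
       "(\<lambda>f. ?M (?D f)) ` (P (Suc m) \<inter> {0}) \<subseteq> {0}"
      unfolding eo[symmetric] by (rule E)+
    have 2: "lin_on (P m) (\<lambda>g. ?D (?M g))"
      by (rule lin_on_compose[OF M(1,2) D(1)])
    then have 3: "(\<lambda>g. ?D (?M g)) ` (P m \<inter> {0}) \<subseteq> {0}" by (rule lin_on_image_zero[OF _ subspace_sym_power])
    show ?thesis unfolding trace_mod_eq[OF d 1] trace_mod_eq[OF d' 2 DMp 3]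
      by (rule dual_mod_swap[OF d d' M D])
  qed
  have S: "lin_on (P m) (\<lambda>g. (?u \<bullet> y) *\<^sub>R act v g + euler_op v (Suc i) y g)"
    using a(1)[of m] E(1)[of m "Suc i"] by (simp add: lin_on_def algebra_simps)
  have "ptrace m (\<lambda>g. ?D (?M g)) = ptrace m (\<lambda>g. (?u \<bullet> y) *\<^sub>R act v g + euler_op v (Suc i) y g)"
    by (rule trace_mod_cong[OF d' S comb_image[OF subspace_sym_power a(2) E(2)] lin_on_image_zero[OF S subspace_sym_power] DM])
  also have "\<dots> = (?u \<bullet> y) * sym_trace m v + ptrace m (euler_op v (Suc i) y)"
    unfolding sym_trace_def by (rule trace_mod_add[OF d' a E])
  finally show ?thesis unfolding eo swap .
qed

lemma ptrace_euler_op_0: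
  assumes v: "v \<in> WG" and y: "y \<in> onb" shows "ptrace 0 (euler_op v i y) = 0"
proof -
  have z: "euler_op v i y f = 0" if "f \<in> P 0" for f
    unfolding euler_op_def dir_deriv_degree_0[OF that] act_add by simp
  note d = dual_sym_power[of 0]
  have S: "lin_on (P 0) (\<lambda>f. 0 :: 'a \<Rightarrow> real)" "(\<lambda>f. 0 :: 'a \<Rightarrow> real) ` P 0 \<subseteq> P 0" "(\<lambda>f. 0 :: 'a \<Rightarrow> real) ` (P 0 \<inter> {0}) \<subseteq> {0}"
    using P_closed(1) by (auto simp: lin_on_def)
  have "ptrace 0 (euler_op v i y) = ptrace 0 (\<lambda>f. 0 :: 'a \<Rightarrow> real)"
    by (rule trace_mod_cong[OF d S z])
  also have "\<dots> = 0"
    using trace_mod_add[OF d S S, of "-1"] by simp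
  finally show ?thesis .
qed

text \<open>Iterates the commutation step down to degree 0, where derivatives vanish. Summed over
  the basis, each scalar \<open>(v ^^ i) y \<bullet> y\<close> becomes the trace of
  \<open>v ^^ i\<close>.\<close>

lemma sum_ptrace_euler_op:
  assumes v: "v \<in> WG"
  shows "(\<Sum>y\<in>onb. ptrace k (euler_op v i y)) = (\<Sum>j<k. vtrace (v ^^ (i + j)) * sym_trace (k - 1 - j) v)"
proof (induction k arbitrary: i)
  case 0
  have "(\<Sum>y\<in>onb. ptrace 0 (euler_op v i y)) = 0" using ptrace_euler_op_0[OF v] by (intro sum.neutral) blast
  then show ?case unfolding lessThan_0 sum.empty .
next
  case (Suc k)
  have "(\<Sum>y\<in>onb. ptrace (Suc k) (euler_op v i y)) = vtrace (v ^^ i) * sym_trace k v + (\<Sum>y\<in>onb. ptrace k (euler_op v (Suc i) y))"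
    using ptrace_euler_op_step[OF v] by (simp add: sum.distrib vtrace_def sum_distrib_right)
  also have "\<dots> = (\<Sum>j<Suc k. vtrace (v ^^ (i + j)) * sym_trace (Suc k - 1 - j) v)"
    unfolding Suc.IH by (subst sum.lessThan_Suc_shift) simp
  finally show ?case .
qed

text \<open>Newton's identity between complete symmetric functions and power sums of the eigenvalues
  of \<open>v\<close>. Both sides compute the trace of the summed operator
  \<open>euler_op v 1\<close>: once by Euler's identity, once by repeated commutation.\<close>

lemma newton:
  assumes v: "v \<in> WG"
  shows "real k * sym_trace k v = (\<Sum>j<k. vtrace (v ^^ Suc j) * sym_trace (k - 1 - j) v)"
proof -
  note d = dual_sym_power[of k]
  have sum_trace: "ptrace k (\<lambda>f. \<Sum>y\<in>Y. euler_op v 1 y f) = (\<Sum>y\<in>Y. ptrace k (euler_op v 1 y)) \<and>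
     lin_on (P k) (\<lambda>f. \<Sum>y\<in>Y. euler_op v 1 y f) \<and> (\<lambda>f. \<Sum>y\<in>Y. euler_op v 1 y f) ` P k \<subseteq> P k" if "finite Y" "Y \<subseteq> onb" for Y
    using that
  proof (induction Y rule: finite_induct)
    case empty
    have S: "lin_on (P k) (\<lambda>f. 0 :: 'a \<Rightarrow> real)" "(\<lambda>f. 0 :: 'a \<Rightarrow> real) ` P k \<subseteq> P k" "(\<lambda>f. 0 :: 'a \<Rightarrow> real) ` (P k \<inter> {0}) \<subseteq> {0}"
      using P_closed(1) by (auto simp: lin_on_def)
    have "ptrace k (\<lambda>f. 0 :: 'a \<Rightarrow> real) = 0" using trace_mod_add[OF d S S, of "-1"] by simp
    then show ?case unfolding sum.empty using S(1,2) by blast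
  next
    case (insert y Y)
    have E: "lin_on (P k) (euler_op v 1 y)" "euler_op v 1 y ` P k \<subseteq> P k" "euler_op v 1 y ` (P k \<inter> {0}) \<subseteq> {0}"
      using euler_op_lin_on euler_op_P[OF v] insert.prems lin_on_image_zero[OF euler_op_lin_on subspace_sym_power] by blast+
    let ?T = "\<lambda>f. \<Sum>y\<in>Y. euler_op v 1 y f"
    have T: "ptrace k ?T = (\<Sum>y\<in>Y. ptrace k (euler_op v 1 y))" "lin_on (P k) ?T" "?T ` P k \<subseteq> P k" "?T ` (P k \<inter> {0}) \<subseteq> {0}"
      using insert lin_on_image_zero[OF _ subspace_sym_power, of _ k] by blast+
    have eq: "(\<lambda>f. \<Sum>y\<in>insert y Y. euler_op v 1 y f) = (\<lambda>f. 1 *\<^sub>R euler_op v 1 y f + ?T f)"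
      using insert by simp
    have l: "lin_on (P k) (\<lambda>f. 1 *\<^sub>R euler_op v 1 y f + ?T f)"
      using E(1) T(2) by (simp add: lin_on_def algebra_simps)
    have p: "(\<lambda>f. 1 *\<^sub>R euler_op v 1 y f + ?T f) ` P k \<subseteq> P k"
      by (rule comb_image[OF subspace_sym_power E(2) T(3)])
    have t: "ptrace k (\<lambda>f. 1 *\<^sub>R euler_op v 1 y f + ?T f) = (\<Sum>y\<in>insert y Y. ptrace k (euler_op v 1 y))"
      unfolding trace_mod_add[OF d E T(2,3,4)] T(1) using insert by simp
    show ?case unfolding eq by (intro conjI t l p)
  qed
  have a: "lin_on (P k) (act v)" "act v ` P k \<subseteq> P k" "act v ` (P k \<inter> {0}) \<subseteq> {0}"
    using lin_on_act WG_act_P[OF v] lin_on_image_zero[OF lin_on_act subspace_sym_power] by blast+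
  have z: "lin_on (P k) (\<lambda>f. 0 :: 'a \<Rightarrow> real)" "(\<lambda>f. 0 :: 'a \<Rightarrow> real) ` P k \<subseteq> P k" "(\<lambda>f. 0 :: 'a \<Rightarrow> real) ` (P k \<inter> {0}) \<subseteq> {0}"
    using P_closed(1) by (auto simp: lin_on_def)
  have z0: "ptrace k (\<lambda>f. 0 :: 'a \<Rightarrow> real) = 0" using trace_mod_add[OF d z z, of "-1"] by simp
  \<comment> \<open>The trailing \<open>0\<close> puts the right-hand side into the shape
    \<open>c *\<^sub>R S u + T u\<close> expected by \<open>comb_image\<close> and
    \<open>trace_mod_add\<close>.\<close>
  have eul: "(\<Sum>y\<in>onb. euler_op v 1 y f) = real k *\<^sub>R act v f + 0" if f: "f \<in> P k" for f
  proof -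
    have "(\<Sum>y\<in>onb. euler_op v 1 y f) = (\<Sum>y\<in>onb. act v (lin y * dir_deriv y f))"
      unfolding euler_op_def act_add WG_act_lin[OF v] by simp
    also have "\<dots> = act v (\<Sum>y\<in>onb. lin y * dir_deriv y f)" by (rule linear_sum[OF linear_act, symmetric])
    also have "\<dots> = real k *\<^sub>R act v f" unfolding euler[OF f] act_add ..
    finally show ?thesis by simp
  qed
  have S: "lin_on (P k) (\<lambda>f. real k *\<^sub>R act v f + 0)" by (simp add: lin_on_def act_add algebra_simps)
  have "(\<Sum>y\<in>onb. ptrace k (euler_op v 1 y)) = ptrace k (\<lambda>f. \<Sum>y\<in>onb. euler_op v 1 y f)"
    using sum_trace[OF onb(2)] by simp
  also have "\<dots> = ptrace k (\<lambda>f. real k *\<^sub>R act v f + 0)"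
    by (rule trace_mod_cong[OF d S comb_image[OF subspace_sym_power a(2) z(2)] lin_on_image_zero[OF S subspace_sym_power] eul])
  also have "\<dots> = real k * sym_trace k v"
    unfolding sym_trace_def trace_mod_add[OF d a z] z0 by simp
  finally show ?thesis using sum_ptrace_euler_op[OF v, of k 1] by simp
qed

lemma sym_trace_0: assumes v: "v \<in> WG" shows "sym_trace 0 v = 1"
proof -
  have "{w \<in> WG. len w = 0} = {id}" using len_eq_0 WG_id len_id by auto
  moreover have "schubert id = 1" using bgg_schubert_eq[OF WG_id WG_id refl] by (simp add: bgg_id)
  ultimately have "coinvariant_character \<Phi> 0 v = 1"
    unfolding coinvariant_character_eq[OF v] by (simp add: bgg_id act_add)
  then show ?thesis using sym_trace_eq[OF v, of 0] card_inv_basis_0 by simp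
qed

end

section \<open>Inversions of permutations\<close>

definition inversions :: "nat \<Rightarrow> (nat \<Rightarrow> nat) \<Rightarrow> (nat \<times> nat) set" where
  "inversions n \<pi> = {(i, j). 1 \<le> i \<and> i < j \<and> j \<le> n \<and> \<pi> j < \<pi> i}"

definition invs :: "nat \<Rightarrow> (nat \<Rightarrow> nat) \<Rightarrow> nat" where "invs n \<pi> = card (inversions n \<pi>)"

abbreviation adj :: "nat \<Rightarrow> nat \<Rightarrow> nat" where "adj a \<equiv> Transposition.transpose a (Suc a)"

lemma finite_inversions: "finite (inversions n \<pi>)"
  by (rule finite_subset[of _ "{1..n} \<times> {1..n}"]) (auto simp: inversions_def)

lemma adj_permutes: "1 \<le> a \<Longrightarrow> a < n \<Longrightarrow> adj a permutes {1..n}"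
  by (rule permutes_swap_id) auto

lemma adj_less: "i < j \<Longrightarrow> (i, j) \<noteq> (a, Suc a) \<Longrightarrow> adj a i < adj a j"
  by (auto simp: Transposition.transpose_def)

lemma adj_involution: "adj a \<circ> adj a = id"
  by (simp add: fun_eq_iff)

text \<open>Exchanging the positions \<open>a\<close> and \<open>Suc a\<close> keeps the order of
  every other pair of positions, so away from that pair inversions correspond to inversions.\<close>

lemma invs_comp_adj_Diff:
  assumes a: "1 \<le> a" "a < n"
  shows "card (inversions n (\<pi> \<circ> adj a) - {(a, Suc a)}) = card (inversions n \<pi> - {(a, Suc a)})"
proof -
  let ?D = "\<lambda>\<pi>. inversions n \<pi> - {(a, Suc a)}"
  let ?f = "map_prod (adj a) (adj a)"
  have range: "adj a i \<in> {1..n} \<longleftrightarrow> i \<in> {1..n}" for i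
    using permutes_in_image[OF adj_permutes[OF a]] .
  have sub: "?f ` ?D (\<pi> \<circ> adj a) \<subseteq> ?D \<pi>" for \<pi>
  proof (rule image_subsetI)
    fix z assume z: "z \<in> ?D (\<pi> \<circ> adj a)"
    obtain i j where zij: "z = (i, j)" by (cases z)
    then have ij: "(i, j) \<in> inversions n (\<pi> \<circ> adj a)" "(i, j) \<noteq> (a, Suc a)" using z by auto
    then have "adj a i < adj a j" "adj a i \<in> {1..n}" "adj a j \<in> {1..n}"
      using adj_less range by (auto simp: inversions_def)
    moreover have "(adj a i, adj a j) \<noteq> (a, Suc a)"
    proof
      assume "(adj a i, adj a j) = (a, Suc a)"
      then have "i = Suc a" "j = a" by (auto simp: Transposition.transpose_def split: if_splits)
      then show False using ij by (simp add: inversions_def)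
    qed
    ultimately show "?f z \<in> ?D \<pi>" using ij zij by (auto simp: inversions_def)
  qed
  have sub': "?f ` ?D \<pi> \<subseteq> ?D (\<pi> \<circ> adj a)"
    using sub[of "\<pi> \<circ> adj a"] by (simp add: comp_assoc adj_involution)
  have "bij_betw ?f (?D (\<pi> \<circ> adj a)) (?D \<pi>)"
    by (rule bij_betw_byWitness[where f' = ?f]) (use sub sub' in auto)
  then show ?thesis by (rule bij_betw_same_card)
qed

lemma invs_comp_adj:
  assumes p: "\<pi> permutes {1..n}" and a: "1 \<le> a" "a < n"
  shows "\<pi> a < \<pi> (Suc a) \<Longrightarrow> invs n (\<pi> \<circ> adj a) = Suc (invs n \<pi>)"
    and "\<not> \<pi> a < \<pi> (Suc a) \<Longrightarrow> Suc (invs n (\<pi> \<circ> adj a)) = invs n \<pi>"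
proof -
  have neq: "\<pi> a \<noteq> \<pi> (Suc a)" using permutes_inj[OF p] by (simp add: inj_eq)
  have mem: "(a, Suc a) \<in> inversions n (\<pi> \<circ> adj a) \<longleftrightarrow> \<pi> a < \<pi> (Suc a)"
    "(a, Suc a) \<in> inversions n \<pi> \<longleftrightarrow> \<not> \<pi> a < \<pi> (Suc a)"
    using a neq by (auto simp: inversions_def)
  have c: "card (inversions n \<sigma>) = card (inversions n \<sigma> - {(a, Suc a)}) + (if (a, Suc a) \<in> inversions n \<sigma> then 1 else 0)" for \<sigma>
    using card.remove[OF finite_inversions, of "(a, Suc a)" n \<sigma>]
    by (cases "(a, Suc a) \<in> inversions n \<sigma>") simp_all
  show "\<pi> a < \<pi> (Suc a) \<Longrightarrow> invs n (\<pi> \<circ> adj a) = Suc (invs n \<pi>)"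
    unfolding invs_def c[of \<pi>] c[of "\<pi> \<circ> adj a"] invs_comp_adj_Diff[OF a] mem by simp
  show "\<not> \<pi> a < \<pi> (Suc a) \<Longrightarrow> Suc (invs n (\<pi> \<circ> adj a)) = invs n \<pi>"
    unfolding invs_def c[of \<pi>] c[of "\<pi> \<circ> adj a"] invs_comp_adj_Diff[OF a] mem by simp
qed

lemma increasing_chain:
  fixes f :: "nat \<Rightarrow> nat"
  assumes "\<And>a. l \<le> a \<Longrightarrow> a < u \<Longrightarrow> f a < f (Suc a)" "l \<le> i" "i < j" "j \<le> u"
  shows "f i < f j"
  using assms(3,4)
proof (induction j)
  case (Suc j)
  then show ?case using assms(1)[of j] assms(2) by (cases "i = j") auto
qed simp

lemma invs_eq_0:
  assumes p: "\<pi> permutes {1..n}" and z: "invs n \<pi> = 0" shows "\<pi> = id"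
proof (rule permutes_natset_ge[OF p], rule)
  have e: "inversions n \<pi> = {}" using z finite_inversions by (simp add: invs_def)
  have inc: "\<pi> i < \<pi> j" if "1 \<le> i" "i < j" "j \<le> n" for i j
  proof -
    have "(i, j) \<notin> inversions n \<pi>" using e by simp
    then have "\<pi> i \<le> \<pi> j" using that by (simp add: inversions_def)
    moreover have "\<pi> i \<noteq> \<pi> j" using that permutes_inj[OF p] by (simp add: inj_eq)
    ultimately show ?thesis by simp
  qed
  have "1 \<le> i \<Longrightarrow> i \<le> n \<Longrightarrow> i \<le> \<pi> i" for i
  proof (induction i)
    case (Suc i)
    show ?case
    proof (cases "i = 0")
      case True
      then have "\<pi> (Suc i) \<in> {1..n}" using permutes_in_image[OF p, of "Suc i"] Suc by simp
      then show ?thesis using True by simp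
    next
      case False
      then show ?thesis using Suc inc[of i "Suc i"] by simp
    qed
  qed simp
  then show "i \<le> \<pi> i" if "i \<in> {1..n}" for i using that by simp
qed

lemma invs_pos_descent:
  assumes p: "\<pi> permutes {1..n}" and z: "0 < invs n \<pi>"
  shows "\<exists>a. 1 \<le> a \<and> a < n \<and> \<not> \<pi> a < \<pi> (Suc a)"
proof (rule ccontr)
  assume n: "\<not> ?thesis"
  have "inversions n \<pi> = {}"
  proof (rule ccontr)
    assume "inversions n \<pi> \<noteq> {}"
    then obtain i j where ij: "1 \<le> i" "i < j" "j \<le> n" "\<pi> j < \<pi> i" by (auto simp: inversions_def)
    have "\<pi> i < \<pi> j"
    proof (rule increasing_chain[of 1 n \<pi> i j, OF _ ij(1,2,3)])
      show "\<pi> a < \<pi> (Suc a)" if "1 \<le> a" "a < n" for a using n that by blast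
    qed
    then show False using ij by simp
  qed
  then show False using z by (simp add: invs_def)
qed

lemma invs_id: "invs n id = 0"
proof -
  have "inversions n id = {}" by (auto simp: inversions_def)
  then show ?thesis by (simp add: invs_def)
qed

lemma sym_word_length:
  assumes "\<pi> permutes {1..n}"
  shows "word_length (adjacent_transpositions n) \<pi> = invs n \<pi>"
proof (rule word_length_eqI(1)[where G = "{\<pi>. \<pi> permutes {1..n}}"])
  show "id \<in> {\<pi>. \<pi> permutes {1..n}}" by (simp add: permutes_id)
  show "g \<circ> s \<in> {\<pi>. \<pi> permutes {1..n}}"
    if "g \<in> {\<pi>. \<pi> permutes {1..n}}" "s \<in> adjacent_transpositions n" for g s
  proof -
    note gs = that
    obtain a where "s = adj a" "1 \<le> a" "a < n" using gs(2) unfolding adjacent_transpositions_def by blast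
    then show ?thesis using gs(1) permutes_compose[OF adj_permutes] by blast
  qed
  show "s \<circ> s = id" if "s \<in> adjacent_transpositions n" for s
    using that by (auto simp: adjacent_transpositions_def)
  show "invs n id = 0" by (rule invs_id)
  show "\<pi> \<in> {\<pi>. \<pi> permutes {1..n}}" using assms by simp
  fix g assume "g \<in> {\<pi>. \<pi> permutes {1..n}}"
  then have g: "g permutes {1..n}" by simp
  show "g = id" if "invs n g = 0" by (rule invs_eq_0[OF g that])
  show "invs n (g \<circ> s) \<le> Suc (invs n g)" if "s \<in> adjacent_transpositions n" for s
  proof -
    note st = that
    obtain a where "s = adj a" "1 \<le> a" "a < n" using st unfolding adjacent_transpositions_def by blast
    then show ?thesis using invs_comp_adj[OF g, of a] by (cases "g a < g (Suc a)") auto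
  qed
  show "\<exists>s\<in>adjacent_transpositions n. Suc (invs n (g \<circ> s)) = invs n g" if "0 < invs n g"
  proof -
    note pos = that
    obtain a where "1 \<le> a" "a < n" "\<not> g a < g (Suc a)" using invs_pos_descent[OF g pos] by blast
    then show ?thesis using invs_comp_adj(2)[OF g] by (auto simp: adjacent_transpositions_def)
  qed
qed

section \<open>Young subgroups\<close>

lemma block_offset_Suc: "i < length \<mu> \<Longrightarrow> block_offset \<mu> (Suc i) = block_offset \<mu> i + \<mu> ! i"
  by (simp add: block_offset_def take_Suc_conv_app_nth)

lemma block_offset_mono: "i \<le> j \<Longrightarrow> block_offset \<mu> i \<le> block_offset \<mu> j"
proof -
  assume "i \<le> j"
  then have "take j \<mu> = take i \<mu> @ take (j - i) (drop i \<mu>)" by (metis le_add_diff_inverse take_add)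
  then show ?thesis by (simp add: block_offset_def)
qed

lemma block_offset_le: "block_offset \<mu> i \<le> sum_list \<mu>"
proof -
  have "sum_list \<mu> = sum_list (take i \<mu>) + sum_list (drop i \<mu>)" by (metis append_take_drop_id sum_list_append)
  then show ?thesis by (simp add: block_offset_def)
qed

lemma block_less: "x \<in> block \<mu> i \<Longrightarrow> y \<in> block \<mu> j \<Longrightarrow> i < j \<Longrightarrow> x < y"
  using block_offset_mono[of "Suc i" j \<mu>] by (auto simp: block_def)

lemma block_unique: "x \<in> block \<mu> i \<Longrightarrow> x \<in> block \<mu> j \<Longrightarrow> i = j"
  using block_less[of x \<mu> i x j] block_less[of x \<mu> j x i] by (metis less_irrefl nat_neq_iff)

lemma block_subset: "block \<mu> i \<subseteq> {1..sum_list \<mu>}"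
  using block_offset_le[of \<mu> "Suc i"] by (auto simp: block_def)

lemma block_exists: assumes "x \<in> {1..sum_list \<mu>}" shows "\<exists>i<length \<mu>. x \<in> block \<mu> i"
proof -
  define i where "i = (LEAST i. x \<le> block_offset \<mu> i)"
  have ex: "x \<le> block_offset \<mu> (length \<mu>)" using assms by (simp add: block_offset_def)
  then have i: "x \<le> block_offset \<mu> i" "i \<le> length \<mu>" unfolding i_def by (auto intro: LeastI Least_le)
  have "i \<noteq> 0" using i assms by (auto simp: block_offset_def intro!: Nat.gr0I)
  then obtain j where j: "i = Suc j" by (cases i) auto
  then have "\<not> x \<le> block_offset \<mu> j" using not_less_Least[of j "\<lambda>i. x \<le> block_offset \<mu> i"] i_def by simp
  then show ?thesis using i j by (auto simp: block_def intro!: exI[of _ j])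
qed

lemma mem_block_iff: "i < length \<mu> \<Longrightarrow> x \<in> block \<mu> i \<longleftrightarrow> block_offset \<mu> i < x \<and> x - block_offset \<mu> i \<in> {1..\<mu> ! i}"
  by (auto simp: block_def block_offset_Suc)

lemma young_permutes: "h \<in> young_subgroup \<mu> \<Longrightarrow> h permutes {1..sum_list \<mu>}"
  by (simp add: young_subgroup_def)

lemma young_block: "h \<in> young_subgroup \<mu> \<Longrightarrow> i < length \<mu> \<Longrightarrow> x \<in> block \<mu> i \<Longrightarrow> h x \<in> block \<mu> i"
  by (auto simp: young_subgroup_def)

lemma young_id: "id \<in> young_subgroup \<mu>"
  by (simp add: young_subgroup_def permutes_id)

lemma young_comp: "h \<in> young_subgroup \<mu> \<Longrightarrow> k \<in> young_subgroup \<mu> \<Longrightarrow> h \<circ> k \<in> young_subgroup \<mu>"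
proof -
  assume h: "h \<in> young_subgroup \<mu>" and k: "k \<in> young_subgroup \<mu>"
  have "(h \<circ> k) ` block \<mu> i = h ` k ` block \<mu> i" for i by (rule image_comp[symmetric])
  then show ?thesis using h k permutes_compose[of k _ h] by (simp add: young_subgroup_def)
qed

lemma young_inv: "h \<in> young_subgroup \<mu> \<Longrightarrow> inv' h \<in> young_subgroup \<mu>"
proof -
  assume h: "h \<in> young_subgroup \<mu>"
  have "inv' h ` block \<mu> i = block \<mu> i" if "i < length \<mu>" for i
  proof -
    have "inv' h ` (h ` block \<mu> i) = block \<mu> i"
      using permutes_inj[OF young_permutes[OF h]] by (simp add: image_comp)
    then show ?thesis using h that by (simp add: young_subgroup_def)
  qed
  then show ?thesis using h permutes_inv by (auto simp: young_subgroup_def)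
qed

lemma young_adj:
  assumes "i < length \<mu>" "a \<in> block \<mu> i" "Suc a \<in> block \<mu> i"
  shows "adj a \<in> young_subgroup \<mu>"
proof -
  have "a \<in> {1..sum_list \<mu>}" "Suc a \<in> {1..sum_list \<mu>}" using block_subset assms by blast+
  moreover have "adj a ` block \<mu> j = block \<mu> j" for j
  proof (cases "j = i")
    case True
    then show ?thesis using assms by (simp add: Transposition.transpose_image_eq)
  next
    case False
    then have "a \<notin> block \<mu> j" "Suc a \<notin> block \<mu> j" using assms block_unique by blast+
    then show ?thesis by (simp add: Transposition.transpose_image_eq)
  qed
  ultimately show ?thesis by (auto simp: young_subgroup_def intro!: permutes_swap_id)
qed

lemma young_different_blocks:
  assumes h: "h \<in> young_subgroup \<mu>" and x: "x \<in> block \<mu> i" "i < length \<mu>" and y: "y \<in> block \<mu> j" "j < length \<mu>" and "i \<noteq> j"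
  shows "h x < h y \<longleftrightarrow> x < y"
  using young_block[OF h x(2,1)] young_block[OF h y(2,1)] x y block_less \<open>i \<noteq> j\<close>
  by (metis less_asym nat_neq_iff)

text \<open>A minimal \<open>r\<close> increases on each block, because a descent inside a block
  could be removed by an adjacent transposition of the Young subgroup. Inversions of
  \<open>r \<circ> h\<close> within a block are therefore those of \<open>h\<close>; those across
  blocks correspond under \<open>h\<close> to the inversions of \<open>r\<close>.\<close>

lemma young_length_additive:
  assumes r: "r permutes {1..sum_list \<mu>}" and min: "\<forall>k\<in>young_subgroup \<mu>. invs (sum_list \<mu>) r \<le> invs (sum_list \<mu>) (r \<circ> k)"
    and h: "h \<in> young_subgroup \<mu>"
  shows "invs (sum_list \<mu>) (r \<circ> h) = invs (sum_list \<mu>) r + invs (sum_list \<mu>) h"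
proof -
  let ?n = "sum_list \<mu>"
  note hp = young_permutes[OF h]
  have step: "r a < r (Suc a)" if "i < length \<mu>" "a \<in> block \<mu> i" "Suc a \<in> block \<mu> i" for i a
  proof (rule ccontr)
    assume "\<not> r a < r (Suc a)"
    moreover have "1 \<le> a" "a < ?n" using that block_subset[of \<mu> i] by auto
    ultimately have "Suc (invs ?n (r \<circ> adj a)) = invs ?n r" using invs_comp_adj(2)[OF r] by simp
    then show False using min young_adj[OF that] by force
  qed
  have inc: "r x < r y" if "i < length \<mu>" "x \<in> block \<mu> i" "y \<in> block \<mu> i" "x < y" for i x y
  proof (rule increasing_chain[of x y r x y])
    fix a assume "x \<le> a" "a < y"
    then have "a \<in> block \<mu> i" "Suc a \<in> block \<mu> i" using that by (auto simp: block_def)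
    then show "r a < r (Suc a)" using step that by blast
  qed (use that in auto)
  have same: "r x < r y \<longleftrightarrow> x < y" if "i < length \<mu>" "x \<in> block \<mu> i" "y \<in> block \<mu> i" for i x y
    using inc that by (metis less_asym nat_neq_iff)
  have A: "inversions ?n h \<subseteq> inversions ?n (r \<circ> h)"
  proof (rule subrelI)
    fix x y assume xy: "(x, y) \<in> inversions ?n h"
    then have "x \<in> {1..?n}" "y \<in> {1..?n}" by (auto simp: inversions_def)
    then obtain i j where ij: "i < length \<mu>" "x \<in> block \<mu> i" "j < length \<mu>" "y \<in> block \<mu> j"
      using block_exists by meson
    have "i = j" using young_different_blocks[OF h ij(2,1,4,3)] xy by (auto simp: inversions_def)
    then have "r (h y) < r (h x)" using same[OF ij(1)] young_block[OF h] ij xy by (auto simp: inversions_def)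
    then show "(x, y) \<in> inversions ?n (r \<circ> h)" using xy by (simp add: inversions_def)
  qed
  have hin: "h x \<in> {1..?n} \<longleftrightarrow> x \<in> {1..?n}" for x using permutes_in_image[OF hp] .
  have B: "map_prod h h ` (inversions ?n (r \<circ> h) - inversions ?n h) \<subseteq> inversions ?n r"
  proof (rule image_subsetI)
    fix z assume z: "z \<in> inversions ?n (r \<circ> h) - inversions ?n h"
    obtain x y where zxy: "z = (x, y)" by (cases z)
    then have xy: "(x, y) \<in> inversions ?n (r \<circ> h)" "(x, y) \<notin> inversions ?n h" using z by auto
    then have "h x \<in> {1..?n}" "h y \<in> {1..?n}" "h x \<noteq> h y"
      using hin[of x] hin[of y] permutes_inj[OF hp] by (auto simp: inversions_def inj_eq)
    then show "map_prod h h z \<in> inversions ?n r" using xy zxy by (auto simp: inversions_def)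
  qed
  have C: "map_prod (inv' h) (inv' h) ` inversions ?n r \<subseteq> inversions ?n (r \<circ> h) - inversions ?n h"
  proof (rule image_subsetI)
    fix z assume z: "z \<in> inversions ?n r"
    obtain x y where zxy: "z = (x, y)" by (cases z)
    then have xy: "(x, y) \<in> inversions ?n r" using z by simp
    then have x: "x \<in> {1..?n}" "y \<in> {1..?n}" by (auto simp: inversions_def)
    then obtain i j where ij: "i < length \<mu>" "x \<in> block \<mu> i" "j < length \<mu>" "y \<in> block \<mu> j"
      using block_exists by meson
    have ne: "i \<noteq> j"
    proof
      assume "i = j"
      then show False using same[OF ij(1,2), of y] ij xy by (auto simp: inversions_def)
    qed
    then have lt: "inv' h x < inv' h y"
      using young_different_blocks[OF young_inv[OF h] ij(2,1,4,3)] xy by (simp add: inversions_def)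
    have hx: "h (inv' h x) = x" "h (inv' h y) = y" using permutes_inverses(1)[OF hp] by auto
    then have "inv' h x \<in> {1..?n}" "inv' h y \<in> {1..?n}" using hin x by metis+
    then show "map_prod (inv' h) (inv' h) z \<in> inversions ?n (r \<circ> h) - inversions ?n h"
      using lt xy hx zxy by (auto simp: inversions_def)
  qed
  have "bij_betw (map_prod h h) (inversions ?n (r \<circ> h) - inversions ?n h) (inversions ?n r)"
    by (rule bij_betw_byWitness[where f' = "map_prod (inv' h) (inv' h)"])
      (use B C permutes_inverses[OF hp] in auto)
  then have "card (inversions ?n (r \<circ> h) - inversions ?n h) = card (inversions ?n r)"
    by (rule bij_betw_same_card)
  moreover have "card (inversions ?n (r \<circ> h)) = card (inversions ?n h) + card (inversions ?n (r \<circ> h) - inversions ?n h)"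
    using A finite_inversions by (metis card_Diff_subset card_mono le_add_diff_inverse)
  ultimately show ?thesis by (simp add: invs_def)
qed

lemma young_component_permutes:
  assumes h: "h \<in> young_subgroup \<mu>" and i: "i < length \<mu>"
  shows "young_component \<mu> i h permutes {1..\<mu> ! i}"
proof -
  let ?o = "block_offset \<mu> i"
  have mem: "k + ?o \<in> block \<mu> i \<longleftrightarrow> k \<in> {1..\<mu> ! i}" for k
    using mem_block_iff[OF i, of "k + ?o"] by auto
  have bij: "bij_betw (young_component \<mu> i h) {1..\<mu> ! i} {1..\<mu> ! i}"
  proof (rule bij_betw_byWitness[where f' = "young_component \<mu> i (inv' h)"])
    have inv: "\<forall>k\<in>{1..\<mu> ! i}. young_component \<mu> i g (young_component \<mu> i h k) = k \<and> young_component \<mu> i h k \<in> {1..\<mu> ! i}"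
      if g: "g \<in> young_subgroup \<mu>" "h \<in> young_subgroup \<mu>" "\<And>x. g (h x) = x" for g h
    proof
      fix k assume k: "k \<in> {1..\<mu> ! i}"
      then have "h (k + ?o) \<in> block \<mu> i" using young_block[OF g(2) i] mem by simp
      then have b: "?o < h (k + ?o)" "h (k + ?o) - ?o \<in> {1..\<mu> ! i}" using mem_block_iff[OF i] by auto
      then show "young_component \<mu> i g (young_component \<mu> i h k) = k \<and> young_component \<mu> i h k \<in> {1..\<mu> ! i}"
        using k g(3) unfolding young_component_def by auto
    qed
    note hp = young_permutes[OF h]
    show "\<forall>a\<in>{1..\<mu> ! i}. young_component \<mu> i (inv' h) (young_component \<mu> i h a) = a"
      "young_component \<mu> i h ` {1..\<mu> ! i} \<subseteq> {1..\<mu> ! i}"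
      using inv[OF young_inv[OF h] h permutes_inverses(2)[OF hp]] by blast+
    show "\<forall>a\<in>{1..\<mu> ! i}. young_component \<mu> i h (young_component \<mu> i (inv' h) a) = a"
      "young_component \<mu> i (inv' h) ` {1..\<mu> ! i} \<subseteq> {1..\<mu> ! i}"
      using inv[OF h young_inv[OF h] permutes_inverses(1)[OF hp]] by blast+
  qed
  show ?thesis by (rule bij_imp_permutes[OF bij]) (unfold young_component_def, simp only: if_False)
qed

lemma young_component_apply:
  assumes h: "h \<in> young_subgroup \<mu>" and i: "i < length \<mu>" and k: "k \<in> {1..\<mu> ! i}"
  shows "h (k + block_offset \<mu> i) = young_component \<mu> i h k + block_offset \<mu> i"
proof -
  have "k + block_offset \<mu> i \<in> block \<mu> i" using mem_block_iff[OF i, of "k + block_offset \<mu> i"] k by auto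
  from young_block[OF h i this] have "block_offset \<mu> i < h (k + block_offset \<mu> i)" by (simp add: block_def)
  then show ?thesis using k by (simp add: young_component_def)
qed

text \<open>Blocks keep their order under \<open>h\<close>, so an inversion has both positions in
  one block and is an inversion of the corresponding component.\<close>

lemma young_invs:
  assumes h: "h \<in> young_subgroup \<mu>"
  shows "invs (sum_list \<mu>) h = (\<Sum>i<length \<mu>. invs (\<mu> ! i) (young_component \<mu> i h))"
proof -
  let ?o = "block_offset \<mu>" and ?c = "\<lambda>i. young_component \<mu> i h"
  let ?S = "SIGMA i:{..<length \<mu>}. inversions (\<mu> ! i) (?c i)"
  let ?f = "\<lambda>(i, x, y). (x + ?o i, y + ?o i)"
  have mem: "k + ?o i \<in> block \<mu> i \<longleftrightarrow> k \<in> {1..\<mu> ! i}" if "i < length \<mu>" for i k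
    using mem_block_iff[OF that, of "k + ?o i"] by auto
  have "bij_betw ?f ?S (inversions (sum_list \<mu>) h)"
    unfolding bij_betw_def
  proof
    show "inj_on ?f ?S"
    proof (rule inj_onI)
      fix z z' assume zz: "z \<in> ?S" "z' \<in> ?S" "?f z = ?f z'"
      obtain i x y where z: "z = (i, x, y)" by (cases z)
      obtain i' x' y' where z': "z' = (i', x', y')" by (cases z')
      have a: "i < length \<mu>" "(x, y) \<in> inversions (\<mu> ! i) (?c i)" "i' < length \<mu>"
        "(x', y') \<in> inversions (\<mu> ! i') (?c i')" "x + ?o i = x' + ?o i'" "y + ?o i = y' + ?o i'"
        using zz unfolding z z' by auto
      then have "x \<in> {1..\<mu> ! i}" "x' \<in> {1..\<mu> ! i'}" by (auto simp: inversions_def)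
      then have "x + ?o i \<in> block \<mu> i" "x' + ?o i' \<in> block \<mu> i'" using mem a(1,3) by blast+
      then have "i = i'" using a block_unique by metis
      then show "z = z'" using a z z' by simp
    qed
    show "?f ` ?S = inversions (sum_list \<mu>) h"
    proof (intro subset_antisym subsetI)
      fix z assume "z \<in> ?f ` ?S"
      then obtain i x y where z: "z = (x + ?o i, y + ?o i)" "i < length \<mu>" "(x, y) \<in> inversions (\<mu> ! i) (?c i)" by auto
      then have xy: "x \<in> {1..\<mu> ! i}" "y \<in> {1..\<mu> ! i}" by (auto simp: inversions_def)
      then have "y + ?o i \<le> sum_list \<mu>" using mem[OF z(2)] block_subset[of \<mu> i] by (meson atLeastAtMost_iff subsetD)
      then show "z \<in> inversions (sum_list \<mu>) h"
        using z young_component_apply[OF h z(2)] xy by (auto simp: inversions_def)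
    next
      fix z assume "z \<in> inversions (sum_list \<mu>) h"
      then obtain x y where z: "z = (x, y)" "1 \<le> x" "x < y" "y \<le> sum_list \<mu>" "h y < h x" by (auto simp: inversions_def)
      then obtain i j where ij: "i < length \<mu>" "x \<in> block \<mu> i" "j < length \<mu>" "y \<in> block \<mu> j"
        using block_exists[of x \<mu>] block_exists[of y \<mu>] by auto
      have "i = j" using young_different_blocks[OF h ij(2,1,4,3)] z by auto
      then have b: "?o i < x" "x - ?o i \<in> {1..\<mu> ! i}" "?o i < y" "y - ?o i \<in> {1..\<mu> ! i}"
        using ij mem_block_iff[OF ij(1)] by auto
      then have "(x - ?o i, y - ?o i) \<in> inversions (\<mu> ! i) (?c i)"
        using young_component_apply[OF h ij(1) b(2)] young_component_apply[OF h ij(1) b(4)] z by (auto simp: inversions_def)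
      then have "(i, x - ?o i, y - ?o i) \<in> ?S" using ij by simp
      then show "z \<in> ?f ` ?S" using z b by (intro image_eqI[of _ _ "(i, x - ?o i, y - ?o i)"]) auto
    qed
  qed
  then have "card ?S = card (inversions (sum_list \<mu>) h)" by (rule bij_betw_same_card)
  then show ?thesis unfolding invs_def using finite_inversions by simp
qed

text \<open>The inverse of taking components: it glues one permutation per block.\<close>

definition young_assemble :: "nat list \<Rightarrow> (nat \<Rightarrow> nat \<Rightarrow> nat) \<Rightarrow> nat \<Rightarrow> nat" where
  "young_assemble \<mu> g x = (if x \<in> {1..sum_list \<mu>}
     then let i = (THE i. i < length \<mu> \<and> x \<in> block \<mu> i) in g i (x - block_offset \<mu> i) + block_offset \<mu> i else x)"

lemma young_assemble_apply:
  assumes "i < length \<mu>" "x \<in> block \<mu> i"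
  shows "young_assemble \<mu> g x = g i (x - block_offset \<mu> i) + block_offset \<mu> i"
proof -
  have "(THE i. i < length \<mu> \<and> x \<in> block \<mu> i) = i" using assms block_unique by blast
  then show ?thesis using assms block_subset[of \<mu> i] by (auto simp: young_assemble_def Let_def)
qed

lemma young_assemble_block:
  assumes g: "g \<in> (\<Pi>\<^sub>E i\<in>{..<length \<mu>}. {\<pi>. \<pi> permutes {1..\<mu> ! i}})" and i: "i < length \<mu>" and x: "x \<in> block \<mu> i"
  shows "young_assemble \<mu> g x \<in> block \<mu> i"
proof -
  have "g i permutes {1..\<mu> ! i}" using g i by auto
  then have "g i (x - block_offset \<mu> i) \<in> {1..\<mu> ! i}"
    using mem_block_iff[OF i, of x] x permutes_in_image by metis
  then show ?thesis unfolding young_assemble_apply[OF i x] by (subst mem_block_iff[OF i]) auto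
qed

lemma young_assemble_young:
  assumes g: "g \<in> (\<Pi>\<^sub>E i\<in>{..<length \<mu>}. {\<pi>. \<pi> permutes {1..\<mu> ! i}})"
  shows "young_assemble \<mu> g \<in> young_subgroup \<mu>"
proof -
  let ?h = "young_assemble \<mu> g"
  have gp: "g i permutes {1..\<mu> ! i}" if "i < length \<mu>" for i using g that by auto
  have blk: "?h x \<in> block \<mu> i" if "i < length \<mu>" "x \<in> block \<mu> i" for i x
    using young_assemble_block[OF g that] .
  have inj: "inj_on ?h {1..sum_list \<mu>}"
  proof (rule inj_onI)
    fix x y assume xy: "x \<in> {1..sum_list \<mu>}" "y \<in> {1..sum_list \<mu>}" "?h x = ?h y"
    then obtain i j where ij: "i < length \<mu>" "x \<in> block \<mu> i" "j < length \<mu>" "y \<in> block \<mu> j"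
      using block_exists by meson
    then have "i = j" using blk xy(3) block_unique by metis
    then have "g i (x - block_offset \<mu> i) = g i (y - block_offset \<mu> i)"
      using xy(3) young_assemble_apply ij by auto
    then have "x - block_offset \<mu> i = y - block_offset \<mu> i" using permutes_inj[OF gp[OF ij(1)]] by (simp add: inj_eq)
    then show "x = y" using ij \<open>i = j\<close> by (auto simp: block_def)
  qed
  have sub: "?h ` {1..sum_list \<mu>} \<subseteq> {1..sum_list \<mu>}"
  proof
    fix z assume "z \<in> ?h ` {1..sum_list \<mu>}"
    then obtain x i where "z = ?h x" "i < length \<mu>" "x \<in> block \<mu> i" using block_exists by (metis imageE)
    then show "z \<in> {1..sum_list \<mu>}" using blk block_subset by blast
  qed
  have "?h permutes {1..sum_list \<mu>}"
    by (rule bij_imp_permutes)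
      (use inj sub endo_inj_surj[of "{1..sum_list \<mu>}" ?h] in \<open>auto simp: bij_betw_def young_assemble_def\<close>)
  moreover have "?h ` block \<mu> i = block \<mu> i" if i: "i < length \<mu>" for i
  proof (rule endo_inj_surj)
    show "finite (block \<mu> i)" by (simp add: block_def)
    show "?h ` block \<mu> i \<subseteq> block \<mu> i" using blk i by blast
    show "inj_on ?h (block \<mu> i)" using inj block_subset inj_on_subset by blast
  qed
  ultimately show ?thesis by (simp add: young_subgroup_def)
qed

lemma young_bij:
  "bij_betw (\<lambda>h. \<lambda>i\<in>{..<length \<mu>}. young_component \<mu> i h) (young_subgroup \<mu>)
     (\<Pi>\<^sub>E i\<in>{..<length \<mu>}. {\<pi>. \<pi> permutes {1..\<mu> ! i}})"
proof (rule bij_betw_byWitness[where f' = "young_assemble \<mu>"])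
  show "\<forall>h\<in>young_subgroup \<mu>. young_assemble \<mu> (\<lambda>i\<in>{..<length \<mu>}. young_component \<mu> i h) = h"
  proof (rule ballI, rule ext)
    fix h x assume h: "h \<in> young_subgroup \<mu>"
    show "young_assemble \<mu> (\<lambda>i\<in>{..<length \<mu>}. young_component \<mu> i h) x = h x"
    proof (cases "x \<in> {1..sum_list \<mu>}")
      case True
      then obtain i where i: "i < length \<mu>" "x \<in> block \<mu> i" using block_exists by blast
      then show ?thesis using young_component_apply[OF h i(1), of "x - block_offset \<mu> i"] mem_block_iff[OF i(1), of x]
        by (simp add: young_assemble_apply[OF i])
    next
      case False
      then show ?thesis using permutes_not_in[OF young_permutes[OF h]] by (auto simp: young_assemble_def)
    qed
  qed
  show "\<forall>g\<in>\<Pi>\<^sub>E i\<in>{..<length \<mu>}. {\<pi>. \<pi> permutes {1..\<mu> ! i}}.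
       (\<lambda>i\<in>{..<length \<mu>}. young_component \<mu> i (young_assemble \<mu> g)) = g"
  proof
    fix g assume g: "g \<in> (\<Pi>\<^sub>E i\<in>{..<length \<mu>}. {\<pi>. \<pi> permutes {1..\<mu> ! i}})"
    show "(\<lambda>i\<in>{..<length \<mu>}. young_component \<mu> i (young_assemble \<mu> g)) = g"
    proof (rule ext)
      fix i
      show "(\<lambda>i\<in>{..<length \<mu>}. young_component \<mu> i (young_assemble \<mu> g)) i = g i"
      proof (cases "i < length \<mu>")
        case i: True
        then have gp: "g i permutes {1..\<mu> ! i}" using g by auto
        have "young_component \<mu> i (young_assemble \<mu> g) k = g i k" for k
        proof (cases "k \<in> {1..\<mu> ! i}")
          case True
          then have "k + block_offset \<mu> i \<in> block \<mu> i" using mem_block_iff[OF i, of "k + block_offset \<mu> i"] by auto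
          then show ?thesis using True young_assemble_apply[OF i] by (simp add: young_component_def)
        next
          case False
          then show ?thesis using permutes_not_in[OF gp False] by (auto simp: young_component_def)
        qed
        then show ?thesis using i by auto
      next
        case False
        then show ?thesis using g by (auto simp: PiE_def extensional_def)
      qed
    qed
  qed
qed (use young_component_permutes young_assemble_young in \<open>auto simp: PiE_def extensional_def\<close>)

lemma young_sum:
  fixes q :: "'c::comm_semiring_1"
  shows "(\<Sum>h\<in>young_subgroup \<mu>. q ^ invs (sum_list \<mu>) h * (\<Prod>i<length \<mu>. G i (young_component \<mu> i h))) =
    (\<Prod>i<length \<mu>. \<Sum>\<pi> | \<pi> permutes {1..\<mu> ! i}. q ^ invs (\<mu> ! i) \<pi> * G i \<pi>)"
proof -
  have "(\<Prod>i<length \<mu>. \<Sum>\<pi> | \<pi> permutes {1..\<mu> ! i}. q ^ invs (\<mu> ! i) \<pi> * G i \<pi>) =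
     (\<Sum>g\<in>(\<Pi>\<^sub>E i\<in>{..<length \<mu>}. {\<pi>. \<pi> permutes {1..\<mu> ! i}}). \<Prod>i<length \<mu>. q ^ invs (\<mu> ! i) (g i) * G i (g i))"
    by (rule prod_sum_PiE) (auto simp: finite_permutations)
  also have "\<dots> = (\<Sum>h\<in>young_subgroup \<mu>. \<Prod>i<length \<mu>. q ^ invs (\<mu> ! i) (young_component \<mu> i h) * G i (young_component \<mu> i h))"
    by (subst sum.reindex_bij_betw[OF young_bij, symmetric]) (intro sum.cong prod.cong refl, simp)
  also have "\<dots> = (\<Sum>h\<in>young_subgroup \<mu>. q ^ invs (sum_list \<mu>) h * (\<Prod>i<length \<mu>. G i (young_component \<mu> i h)))"
    by (intro sum.cong refl) (simp add: young_invs prod.distrib power_sum)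
  finally show ?thesis ..
qed

section \<open>Unimodal permutations\<close>

text \<open>Composing \<open>\<sigma>\<close> with this cycle on the right inserts the value
  \<open>Suc p\<close> at position \<open>i\<close> and moves the later entries one place to the
  right.\<close>

definition insert_max :: "nat \<Rightarrow> nat \<Rightarrow> nat \<Rightarrow> nat" where
  "insert_max p i k = (if k < i then k else if k = i then Suc p else if k \<le> Suc p then k - 1 else k)"

lemma insert_max_permutes: "i \<in> {1..Suc p} \<Longrightarrow> insert_max p i permutes {1..Suc p}"
proof (rule bij_imp_permutes)
  assume i: "i \<in> {1..Suc p}"
  show "bij_betw (insert_max p i) {1..Suc p} {1..Suc p}"
    by (rule bij_betw_byWitness[where f' = "\<lambda>k. if k < i then k else if k = Suc p then i else Suc k"])
      (use i in \<open>auto simp: insert_max_def\<close>)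
qed (auto simp: insert_max_def)

lemma permutes_Suc: "\<sigma> permutes {1..p} \<Longrightarrow> \<sigma> permutes {1..Suc p}"
  by (erule permutes_subset) auto

text \<open>The position \<open>i\<close> is recovered as the place of the largest value, and
  \<open>\<sigma>\<close> by deleting that value.\<close>

lemma insert_max_bij:
  "bij_betw (\<lambda>(\<sigma>, i). \<sigma> \<circ> insert_max p i) ({\<sigma>. \<sigma> permutes {1..p}} \<times> {1..Suc p}) {\<pi>. \<pi> permutes {1..Suc p}}"
  unfolding bij_betw_def
proof
  have top: "(\<sigma> \<circ> insert_max p i) k = Suc p \<longleftrightarrow> k = i" if s: "\<sigma> permutes {1..p}" and i: "i \<in> {1..Suc p}" for \<sigma> i k
  proof -
    have "\<sigma> x = Suc p \<longleftrightarrow> x = Suc p" for x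
      using permutes_not_in[OF s, of "Suc p"] permutes_inj[OF s] by (metis atLeastAtMost_iff injD not_less_eq_eq order_refl)
    moreover have "insert_max p i k = Suc p \<longleftrightarrow> k = i"
      using i by (auto simp: insert_max_def)
    ultimately show ?thesis by simp
  qed
  show "inj_on (\<lambda>(\<sigma>, i). \<sigma> \<circ> insert_max p i) ({\<sigma>. \<sigma> permutes {1..p}} \<times> {1..Suc p})"
  proof (rule inj_onI, clarify)
    fix \<sigma> i \<tau> j assume a: "\<sigma> permutes {1..p}" "\<tau> permutes {1..p}" "i \<in> {1..Suc p}" "j \<in> {1..Suc p}"
      "\<sigma> \<circ> insert_max p i = \<tau> \<circ> insert_max p j"
    have ij: "i = j" using top[OF a(1,3), of i] top[OF a(2,4), of i] a(5) by simp
    then have "\<sigma> \<circ> (insert_max p i \<circ> inv' (insert_max p i)) = \<tau> \<circ> (insert_max p i \<circ> inv' (insert_max p i))"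
      using a(5) by (metis comp_assoc)
    then show "\<sigma> = \<tau> \<and> i = j" using ij permutes_inv_o(1)[OF insert_max_permutes[OF a(3)]] by simp
  qed
  show "(\<lambda>(\<sigma>, i). \<sigma> \<circ> insert_max p i) ` ({\<sigma>. \<sigma> permutes {1..p}} \<times> {1..Suc p}) = {\<pi>. \<pi> permutes {1..Suc p}}"
  proof (intro subset_antisym subsetI)
    fix \<pi> assume "\<pi> \<in> (\<lambda>(\<sigma>, i). \<sigma> \<circ> insert_max p i) ` ({\<sigma>. \<sigma> permutes {1..p}} \<times> {1..Suc p})"
    then show "\<pi> \<in> {\<pi>. \<pi> permutes {1..Suc p}}"
      using permutes_compose[OF insert_max_permutes permutes_Suc] by auto
  next
    fix \<pi> assume "\<pi> \<in> {\<pi>. \<pi> permutes {1..Suc p}}"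
    then have pp: "\<pi> permutes {1..Suc p}" by simp
    define i where "i = inv' \<pi> (Suc p)"
    have i: "i \<in> {1..Suc p}" using permutes_in_image[OF permutes_inv[OF pp], of "Suc p"] by (simp add: i_def)
    have pi_i: "\<pi> i = Suc p" using permutes_inverses(1)[OF pp] by (simp add: i_def)
    note c = insert_max_permutes[OF i]
    let ?s = "\<pi> \<circ> inv' (insert_max p i)"
    have "inv' (insert_max p i) (Suc p) = i"
      using permutes_inverses(2)[OF c, of i] by (simp add: insert_max_def)
    then have fixed: "?s (Suc p) = Suc p" using pi_i by simp
    have "?s permutes {1..Suc p}" using permutes_compose[OF permutes_inv[OF c] pp] .
    then have "?s permutes {1..p}"
      by (rule permutes_superset) (use fixed in \<open>auto simp: le_Suc_eq\<close>)
    moreover have "\<pi> = ?s \<circ> insert_max p i" using permutes_inv_o(2)[OF c] by (simp add: comp_assoc)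
    ultimately show "\<pi> \<in> (\<lambda>(\<sigma>, i). \<sigma> \<circ> insert_max p i) ` ({\<sigma>. \<sigma> permutes {1..p}} \<times> {1..Suc p})"
      using i by (intro image_eqI[of _ _ "(?s, i)"]) auto
  qed
qed

lemma permutes_bound: "\<sigma> permutes {1..p} \<Longrightarrow> k \<in> {1..p} \<Longrightarrow> \<sigma> k < Suc p \<and> 1 \<le> \<sigma> k"
  for k p :: nat
  using permutes_in_image[of \<sigma> "{1..p}" k] by auto

text \<open>The largest value forms an inversion with each of the \<open>Suc p - i\<close> positions
  after it; the relative order of the other entries is unchanged.\<close>

lemma insert_max_invs:
  assumes s: "\<sigma> permutes {1..p}" and i: "i \<in> {1..Suc p}"
  shows "invs (Suc p) (\<sigma> \<circ> insert_max p i) = invs p \<sigma> + (Suc p - i)"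
proof -
  let ?c = "insert_max p i"
  let ?B = "{i} \<times> {Suc i..Suc p}" and ?I = "inversions (Suc p) (\<sigma> \<circ> ?c)"
  have sp: "\<sigma> (Suc p) = Suc p" using permutes_not_in[OF s, of "Suc p"] by simp
  have low: "?c k \<in> {1..p}" if "k \<in> {1..Suc p}" "k \<noteq> i" for k
    using that i by (auto simp: insert_max_def)
  have mono: "?c k < ?c l \<longleftrightarrow> k < l" if "k \<in> {1..Suc p}" "l \<in> {1..Suc p}" "k \<noteq> i" "l \<noteq> i" for k l
    using that i by (auto simp: insert_max_def)
  have B: "?B \<subseteq> ?I"
  proof (rule subrelI)
    fix k l assume kl: "(k, l) \<in> ?B"
    then have l: "l \<in> {Suc i..Suc p}" and k: "k = i" by auto
    have "\<sigma> (?c l) < Suc p" using permutes_bound[OF s low[of l]] l i by auto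
    moreover have "?c i = Suc p" by (simp add: insert_max_def)
    ultimately show "(k, l) \<in> ?I" unfolding k using l i sp by (auto simp: inversions_def)
  qed
  have ne: "k \<noteq> i \<and> l \<noteq> i" if "(k, l) \<in> ?I - ?B" for k l
  proof -
    have "l \<noteq> i"
    proof
      assume li: "l = i"
      then have "\<sigma> (?c k) < Suc p" using that permutes_bound[OF s low[of k]] i by (auto simp: inversions_def)
      then show False using that li sp by (auto simp: inversions_def insert_max_def)
    qed
    then show ?thesis using that by (auto simp: inversions_def)
  qed
  have "bij_betw (map_prod ?c ?c) (?I - ?B) (inversions p \<sigma>)"
  proof (rule bij_betw_byWitness[where f' = "map_prod (inv' ?c) (inv' ?c)"])
    note cp = insert_max_permutes[OF i]
    show "\<forall>a\<in>?I - ?B. map_prod (inv' ?c) (inv' ?c) (map_prod ?c ?c a) = a"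
      using permutes_inverses[OF cp] by auto
    show "\<forall>a\<in>inversions p \<sigma>. map_prod ?c ?c (map_prod (inv' ?c) (inv' ?c) a) = a"
      using permutes_inverses[OF cp] by auto
    show "map_prod ?c ?c ` (?I - ?B) \<subseteq> inversions p \<sigma>"
    proof (rule image_subsetI)
      fix z assume z: "z \<in> ?I - ?B"
      obtain k l where kl: "z = (k, l)" by (cases z)
      have n: "k \<noteq> i" "l \<noteq> i" using ne z kl by blast+
      have m: "k \<in> {1..Suc p}" "l \<in> {1..Suc p}" "k < l" "\<sigma> (?c l) < \<sigma> (?c k)" using z kl by (auto simp: inversions_def)
      show "map_prod ?c ?c z \<in> inversions p \<sigma>"
        using low[OF m(1) n(1)] low[OF m(2) n(2)] mono[OF m(1,2) n] m kl by (auto simp: inversions_def)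
    qed
    show "map_prod (inv' ?c) (inv' ?c) ` inversions p \<sigma> \<subseteq> ?I - ?B"
    proof (rule image_subsetI)
      fix z assume z: "z \<in> inversions p \<sigma>"
      obtain k l where kl: "z = (k, l)" by (cases z)
      have m: "k \<in> {1..p}" "l \<in> {1..p}" "k < l" "\<sigma> l < \<sigma> k" using z kl by (auto simp: inversions_def)
      let ?k = "inv' ?c k" and ?l = "inv' ?c l"
      have e: "?c ?k = k" "?c ?l = l" using permutes_inverses(1)[OF cp] by auto
      have r: "?k \<in> {1..Suc p}" "?l \<in> {1..Suc p}"
        using permutes_in_image[OF permutes_inv[OF cp]] m by auto
      have n: "?k \<noteq> i" "?l \<noteq> i" using e m by (auto simp: insert_max_def split: if_splits)
      have "?k < ?l" using mono[OF r n] e m by simp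
      then show "map_prod (inv' ?c) (inv' ?c) z \<in> ?I - ?B" using r n e m kl by (auto simp: inversions_def)
    qed
  qed
  then have "card (?I - ?B) = invs p \<sigma>" unfolding invs_def by (rule bij_betw_same_card)
  moreover have "card ?I = card ?B + card (?I - ?B)"
    using B finite_inversions by (metis card_Diff_subset card_mono finite_subset le_add_diff_inverse)
  ultimately show ?thesis by (simp add: invs_def)
qed

lemma unimodal_at_unique: "unimodal_at n \<pi> m \<Longrightarrow> unimodal_at n \<pi> m' \<Longrightarrow> m = m'"
proof -
  have "False" if "unimodal_at n \<pi> m" "unimodal_at n \<pi> m'" "m < m'" for m m'
  proof -
    have "\<pi> (Suc m) > \<pi> (Suc (Suc m))" using that by (auto simp: unimodal_at_def)
    moreover have "\<pi> (Suc m) < \<pi> (Suc (Suc m))" using that by (auto simp: unimodal_at_def)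
    ultimately show False by simp
  qed
  then show "unimodal_at n \<pi> m \<Longrightarrow> unimodal_at n \<pi> m' \<Longrightarrow> m = m'" by (metis nat_neq_iff)
qed

lemma unimodal_sign_eq: "unimodal_at n \<pi> m \<Longrightarrow> unimodal_sign n \<pi> = (-1) ^ m"
  using unimodal_at_unique[of n \<pi>] by (auto simp: unimodal_sign_def intro!: arg_cong[where f = "\<lambda>m. (-1) ^ m"])

lemma unimodal_sign_cong:
  assumes "\<And>m. unimodal_at n \<pi> m \<longleftrightarrow> unimodal_at n' \<pi>' m" shows "unimodal_sign n \<pi> = unimodal_sign n' \<pi>'"
proof -
  have "unimodal_at n \<pi> = unimodal_at n' \<pi>'" using assms by blast
  then show ?thesis by (simp add: unimodal_sign_def)
qed

text \<open>A sequence that falls and then rises has its maximum at an end. At the right end it adds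
  an ascent, at the left end a descent and hence a sign; \<open>1 \<le> p\<close> keeps the two ends
  apart.\<close>

lemma unimodal_sign_insert_max:
  assumes s: "\<sigma> permutes {1..p}" and p: "1 \<le> p" and i: "i \<in> {1..Suc p}"
  shows "unimodal_sign (Suc p) (\<sigma> \<circ> insert_max p i) =
    (if i = Suc p then unimodal_sign p \<sigma> else if i = 1 then - unimodal_sign p \<sigma> else 0)"
proof -
  have sp: "\<sigma> (Suc p) = Suc p" using permutes_not_in[OF s, of "Suc p"] by simp
  have b: "\<sigma> k < Suc p" if "1 \<le> k" "k \<le> p" for k using permutes_bound[OF s, of k] that by simp
  let ?u = "\<sigma> \<circ> insert_max p i"
  consider "i = Suc p" | "i = 1" "i \<noteq> Suc p" | "1 < i" "i < Suc p" using i by fastforce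
  then show ?thesis
  proof cases
    case 1
    have u: "?u k = \<sigma> k" if "k \<le> Suc p" for k using that 1 by (auto simp: insert_max_def)
    have "unimodal_at (Suc p) ?u m \<longleftrightarrow> unimodal_at p \<sigma> m" for m
    proof
      assume m: "unimodal_at (Suc p) ?u m"
      have "m \<noteq> p"
      proof
        assume "m = p"
        then have "?u (Suc p) < ?u p" using m p unfolding unimodal_at_def by auto
        then show False using b[of p] p u[of p] u[of "Suc p"] sp by linarith
      qed
      moreover have "\<sigma> k > \<sigma> (Suc k)" if "k \<in> {1..m}" for k
      proof -
        have "?u k > ?u (Suc k)" "k \<le> p" using m that unfolding unimodal_at_def by auto
        then show ?thesis using u[of k] u[of "Suc k"] by simp
      qed
      moreover have "\<sigma> k < \<sigma> (Suc k)" if "k \<in> {Suc m..<p}" for k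
      proof -
        have "?u k < ?u (Suc k)" using m that unfolding unimodal_at_def by auto
        then show ?thesis using u[of k] u[of "Suc k"] that by simp
      qed
      ultimately show "unimodal_at p \<sigma> m" using m unfolding unimodal_at_def by auto
    next
      assume m: "unimodal_at p \<sigma> m"
      have "?u k > ?u (Suc k)" if "k \<in> {1..m}" for k
        using m that u[of k] u[of "Suc k"] unfolding unimodal_at_def by auto
      moreover have "?u k < ?u (Suc k)" if "k \<in> {Suc m..<Suc p}" for k
      proof (cases "k = p")
        case True
        then show ?thesis using u[of p] u[of "Suc p"] b[of p] p sp by simp
      next
        case False
        then show ?thesis using m that u[of k] u[of "Suc k"] unfolding unimodal_at_def by auto
      qed
      ultimately show "unimodal_at (Suc p) ?u m" using m unfolding unimodal_at_def by auto
    qed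
    then have "unimodal_sign (Suc p) ?u = unimodal_sign p \<sigma>" by (rule unimodal_sign_cong)
    then show ?thesis using 1 by simp
  next
    case 2
    have u1: "?u 1 = Suc p" using 2 sp by (simp add: insert_max_def)
    have u: "?u (Suc k) = \<sigma> k" if "1 \<le> k" "k \<le> p" for k using that 2 by (auto simp: insert_max_def)
    have iff: "unimodal_at (Suc p) ?u m \<longleftrightarrow> (\<exists>m'. m = Suc m' \<and> unimodal_at p \<sigma> m')" for m
    proof
      assume m: "unimodal_at (Suc p) ?u m"
      have "m \<noteq> 0"
      proof
        assume "m = 0"
        then have "?u 1 < ?u (Suc 1)" using m p unfolding unimodal_at_def by auto
        then show False using u1 u[of 1] b[of 1] p by simp
      qed
      then obtain m' where m': "m = Suc m'" by (cases m) auto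
      have "\<sigma> k > \<sigma> (Suc k)" if "k \<in> {1..m'}" for k
      proof -
        have "?u (Suc k) > ?u (Suc (Suc k))" using m m' that unfolding unimodal_at_def by auto
        moreover have "k \<le> p" "Suc k \<le> p" using m m' that unfolding unimodal_at_def by auto
        ultimately show ?thesis using u[of k] u[of "Suc k"] that by simp
      qed
      moreover have "\<sigma> k < \<sigma> (Suc k)" if "k \<in> {Suc m'..<p}" for k
      proof -
        have "?u (Suc k) < ?u (Suc (Suc k))" using m m' that unfolding unimodal_at_def by auto
        then show ?thesis using u[of k] u[of "Suc k"] that by simp
      qed
      ultimately have "unimodal_at p \<sigma> m'" using m m' unfolding unimodal_at_def by auto
      then show "\<exists>m'. m = Suc m' \<and> unimodal_at p \<sigma> m'" using m' by blast
    next
      assume "\<exists>m'. m = Suc m' \<and> unimodal_at p \<sigma> m'"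
      then obtain m' where m': "m = Suc m'" "unimodal_at p \<sigma> m'" by blast
      have "?u k > ?u (Suc k)" if "k \<in> {1..m}" for k
      proof (cases "k = 1")
        case True
        then show ?thesis using u1 u[of 1] b[of 1] p by simp
      next
        case False
        note k = that
        obtain j where "k = Suc j" "1 \<le> j" "j \<le> m'" using k m' False by (cases k) auto
        then show ?thesis using m'(2) u[of j] u[of "Suc j"] unfolding unimodal_at_def by auto
      qed
      moreover have "?u k < ?u (Suc k)" if "k \<in> {Suc m..<Suc p}" for k
      proof -
        note k = that
        obtain j where "k = Suc j" "Suc m' \<le> j" "j < p" using k m' by (cases k) auto
        then show ?thesis using m'(2) u[of j] u[of "Suc j"] unfolding unimodal_at_def by auto
      qed
      ultimately show "unimodal_at (Suc p) ?u m" using m' unfolding unimodal_at_def by auto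
    qed
    show ?thesis
    proof (cases "\<exists>m. unimodal_at p \<sigma> m")
      case True
      then obtain m where m: "unimodal_at p \<sigma> m" by blast
      then have "unimodal_at (Suc p) ?u (Suc m)" using iff by blast
      then show ?thesis using unimodal_sign_eq[OF m] unimodal_sign_eq 2 by simp
    next
      case False
      then have "\<not> (\<exists>m. unimodal_at (Suc p) ?u m)" using iff by blast
      then show ?thesis using False 2 by (simp add: unimodal_sign_def)
    qed
  next
    \<comment> \<open>An interior maximum puts an ascent directly before a descent, which no turning
      point \<open>m\<close> permits.\<close>
    case 3
    obtain j where j: "i = Suc j" "1 \<le> j" "j < p" using 3 by (cases i) auto
    have "\<not> unimodal_at (Suc p) ?u m" for m
    proof
      assume m: "unimodal_at (Suc p) ?u m"
      have "?u j < ?u (Suc j)" using j b[of j] sp by (auto simp: insert_max_def)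
      then have "\<not> j \<le> m" using m j unfolding unimodal_at_def by force
      moreover have "?u (Suc j) > ?u (Suc (Suc j))" using j b[of "Suc j"] sp by (auto simp: insert_max_def)
      then have "\<not> Suc m \<le> Suc j" using m j unfolding unimodal_at_def by force
      ultimately show False by simp
    qed
    then show ?thesis using 3 by (simp add: unimodal_sign_def)
  qed
qed

section \<open>Generating functions by inversions\<close>

definition sym_poincare :: "nat \<Rightarrow> 'c::comm_ring_1 \<Rightarrow> 'c" where
  "sym_poincare n q = (\<Sum>\<pi> | \<pi> permutes {1..n}. q ^ invs n \<pi>)"

definition unimodal_sum :: "nat \<Rightarrow> 'c::comm_ring_1 \<Rightarrow> 'c" where
  "unimodal_sum n q = (\<Sum>\<pi> | \<pi> permutes {1..n}. q ^ invs n \<pi> * of_int (unimodal_sign n \<pi>))"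

lemma sum_permutes_Suc:
  "(\<Sum>\<pi> | \<pi> permutes {1..Suc p}. F \<pi>) = (\<Sum>\<sigma> | \<sigma> permutes {1..p}. \<Sum>i=1..Suc p. F (\<sigma> \<circ> insert_max p i))"
  by (subst sum.reindex_bij_betw[OF insert_max_bij, symmetric])
    (unfold sum.cartesian_product, rule sum.cong, auto)

lemma sym_poincare_Suc: "(1 - q) * sym_poincare (Suc p) q = (1 - q ^ Suc p) * sym_poincare p q"
proof -
  have "sym_poincare (Suc p) q = (\<Sum>\<sigma> | \<sigma> permutes {1..p}. \<Sum>i=1..Suc p. q ^ invs p \<sigma> * q ^ (Suc p - i))"
    unfolding sym_poincare_def sum_permutes_Suc
    by (intro sum.cong refl) (metis insert_max_invs power_add mem_Collect_eq)
  also have "\<dots> = sym_poincare p q * (\<Sum>i=1..Suc p. q ^ (Suc p - i))"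
    unfolding sym_poincare_def sum_product ..
  also have "(\<Sum>i=1..Suc p. q ^ (Suc p - i)) = (\<Sum>j<Suc p. q ^ j)"
    by (rule sum.reindex_bij_witness[of _ "\<lambda>j. Suc p - j" "\<lambda>i. Suc p - i"]) auto
  finally show ?thesis using one_diff_power_eq[of q "Suc p"] by (simp add: mult_ac)
qed

text \<open>Only two insertions survive: the right end adds no inversion, the left end adds
  \<open>p\<close> inversions and a sign.\<close>

lemma unimodal_sum_Suc:
  assumes p: "1 \<le> p" shows "unimodal_sum (Suc p) q = (1 - q ^ p) * unimodal_sum p q"
proof -
  have "(\<Sum>i=1..Suc p. q ^ invs (Suc p) (\<sigma> \<circ> insert_max p i) * of_int (unimodal_sign (Suc p) (\<sigma> \<circ> insert_max p i)))
     = (1 - q ^ p) * (q ^ invs p \<sigma> * of_int (unimodal_sign p \<sigma>))" if s: "\<sigma> permutes {1..p}" for \<sigma>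
  proof -
    let ?F = "\<lambda>i. q ^ (invs p \<sigma> + (Suc p - i)) * of_int (if i = Suc p then unimodal_sign p \<sigma> else if i = 1 then - unimodal_sign p \<sigma> else 0)"
    have "(\<Sum>i=1..Suc p. q ^ invs (Suc p) (\<sigma> \<circ> insert_max p i) * of_int (unimodal_sign (Suc p) (\<sigma> \<circ> insert_max p i))) = (\<Sum>i=1..Suc p. ?F i)"
      using insert_max_invs[OF s] unimodal_sign_insert_max[OF s p] by (intro sum.cong refl) simp
    also have "\<dots> = (\<Sum>i\<in>{1, Suc p}. ?F i)"
      using p by (intro sum.mono_neutral_right) auto
    also have "\<dots> = (1 - q ^ p) * (q ^ invs p \<sigma> * of_int (unimodal_sign p \<sigma>))"
      using p by (simp add: power_add algebra_simps)
    finally show ?thesis .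
  qed
  then show ?thesis unfolding unimodal_sum_def sum_permutes_Suc by (simp add: sum_distrib_left)
qed

lemma sym_poincare_0: "sym_poincare 0 q = 1"
proof -
  have "{\<pi>. \<pi> permutes {1..0::nat}} = {id}" by auto
  then show ?thesis by (simp add: sym_poincare_def invs_id)
qed

text \<open>The left factor is the product of \<open>1 - q ^ i\<close> for \<open>i < p\<close>, and
  \<open>(1 - q) ^ p\<close> times the Poincare polynomial is the same product up to
  \<open>i = p\<close>.\<close>

lemma unimodal_sum_poincare:
  assumes "1 \<le> p" shows "unimodal_sum p q * (1 - q ^ p) = (1 - q) ^ p * sym_poincare p q"
  using assms
proof (induction p rule: nat_induct_at_least)
  case base
  have "unimodal_at 1 id 0" by (simp add: unimodal_at_def)
  then have s: "unimodal_sign 1 id = 1" using unimodal_sign_eq by fastforce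
  have "{\<pi>. \<pi> permutes {1..1::nat}} = {id}" by auto
  then have "unimodal_sum 1 q = 1" using s by (simp add: unimodal_sum_def invs_id)
  moreover have "(1 - q) * sym_poincare 1 q = 1 - q" using sym_poincare_Suc[of q 0] sym_poincare_0[of q] by simp
  ultimately show ?case by simp
next
  case (Suc p)
  have "unimodal_sum (Suc p) q * (1 - q ^ Suc p) = (unimodal_sum p q * (1 - q ^ p)) * (1 - q ^ Suc p)"
    unfolding unimodal_sum_Suc[OF Suc(1)] by (simp only: mult_ac)
  also have "\<dots> = (1 - q) ^ p * ((1 - q ^ Suc p) * sym_poincare p q)"
    unfolding Suc.IH by (simp add: mult_ac)
  also have "\<dots> = (1 - q) ^ Suc p * sym_poincare (Suc p) q"
    unfolding sym_poincare_Suc[symmetric] by (simp add: mult_ac)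
  finally show ?case .
qed

lemma young_subset: "young_subgroup \<mu> \<subseteq> {\<pi>. \<pi> permutes {1..sum_list \<mu>}}"
  using young_permutes by blast

text \<open>The coset factorisation for the Young subgroup reduces the sum to one unimodal sum per
  block, where \<open>unimodal_sum_poincare\<close> applies. The assumption on \<open>q\<close>
  allows the Poincare polynomials of the blocks to be cancelled.\<close>

lemma sym_weight_sum:
  fixes q :: "'c::idom"
  assumes q: "\<And>p. sym_poincare p q \<noteq> 0" and pos: "\<And>p. p \<in> set \<mu> \<Longrightarrow> 1 \<le> p"
  shows "(\<Sum>\<pi> | \<pi> permutes {1..sum_list \<mu>}. q ^ invs (sum_list \<mu>) \<pi> * of_int (sym_weight \<mu> \<pi>)) * (\<Prod>p\<leftarrow>\<mu>. 1 - q ^ p)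
    = (1 - q) ^ sum_list \<mu> * sym_poincare (sum_list \<mu>) q"
proof -
  let ?n = "sum_list \<mu>"
  let ?S = "{\<pi>. \<pi> permutes {1..?n}}" and ?Y = "young_subgroup \<mu>"
  let ?F = "\<lambda>\<sigma>. of_int (\<Prod>i<length \<mu>. unimodal_sign (\<mu> ! i) (young_component \<mu> i \<sigma>)) :: 'c"
  let ?wl = "word_length (adjacent_transpositions ?n)"
  have wl: "?wl \<pi> = invs ?n \<pi>" if "\<pi> permutes {1..?n}" for \<pi> using sym_word_length[OF that] .
  have "(\<Sum>\<pi>\<in>?S. q ^ ?wl \<pi> * ?F (subgroup_part ?wl ?Y \<pi>)) * (\<Sum>h\<in>?Y. q ^ ?wl h) = (\<Sum>\<pi>\<in>?S. q ^ ?wl \<pi>) * (\<Sum>h\<in>?Y. q ^ ?wl h * ?F h)"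
  proof (rule coset_factorization)
    show "finite ?S" by (simp add: finite_permutations)
    show "?Y \<subseteq> ?S" by (rule young_subset)
    show "g \<circ> h \<in> ?S" if "g \<in> ?S" "h \<in> ?Y" for g h using that permutes_compose[OF young_permutes] by blast
    show "id \<in> ?Y" by (rule young_id)
    show "h \<circ> k \<in> ?Y" if "h \<in> ?Y" "k \<in> ?Y" for h k using young_comp that .
    show "inv' h \<in> ?Y" if "h \<in> ?Y" for h using young_inv that .
    show "bij g" if "g \<in> ?S" for g using that permutes_bij by blast
    show "h = id" if "h \<in> ?Y" "?wl h = 0" for h
      using that invs_eq_0[OF young_permutes] wl[OF young_permutes] by metis
    fix r h assume r: "r \<in> ?S" "\<forall>k\<in>?Y. ?wl r \<le> ?wl (r \<circ> k)" and h: "h \<in> ?Y"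
    have rp: "r permutes {1..?n}" using r by simp
    have rk: "?wl (r \<circ> k) = invs ?n (r \<circ> k)" if "k \<in> ?Y" for k
      using wl[OF permutes_compose[OF young_permutes[OF that] rp]] .
    show "?wl (r \<circ> h) = ?wl r + ?wl h"
      using young_length_additive[OF rp _ h] r(2) rk wl[OF rp] wl[OF young_permutes[OF h]] h by simp
  qed
  moreover have "(\<Sum>\<pi>\<in>?S. q ^ ?wl \<pi>) = sym_poincare ?n q" unfolding sym_poincare_def using wl by (intro sum.cong) auto
  moreover have "(\<Sum>h\<in>?Y. q ^ ?wl h) = (\<Prod>i<length \<mu>. sym_poincare (\<mu> ! i) q)"
  proof -
    have "(\<Sum>h\<in>?Y. q ^ ?wl h) = (\<Sum>h\<in>?Y. q ^ invs ?n h * (\<Prod>i<length \<mu>. 1))"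
      using wl young_permutes by (intro sum.cong) auto
    then show ?thesis using young_sum[of q \<mu> "\<lambda>_ _. 1"] unfolding sym_poincare_def by simp
  qed
  moreover have "(\<Sum>h\<in>?Y. q ^ ?wl h * ?F h) = (\<Prod>i<length \<mu>. unimodal_sum (\<mu> ! i) q)"
  proof -
    have "(\<Sum>h\<in>?Y. q ^ ?wl h * ?F h) = (\<Sum>h\<in>?Y. q ^ invs ?n h * (\<Prod>i<length \<mu>. of_int (unimodal_sign (\<mu> ! i) (young_component \<mu> i h))))"
      using wl young_permutes by (intro sum.cong) (auto simp: of_int_prod)
    then show ?thesis
      using young_sum[of q \<mu> "\<lambda>i \<pi>. of_int (unimodal_sign (\<mu> ! i) \<pi>)"] unfolding unimodal_sum_def by simp
  qed
  moreover have "(\<Sum>\<pi>\<in>?S. q ^ ?wl \<pi> * ?F (subgroup_part ?wl ?Y \<pi>)) = (\<Sum>\<pi>\<in>?S. q ^ invs ?n \<pi> * of_int (sym_weight \<mu> \<pi>))" (is "_ = ?Z")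
    using wl by (intro sum.cong) (auto simp: sym_weight_def Let_def)
  ultimately have eq: "?Z * (\<Prod>i<length \<mu>. sym_poincare (\<mu> ! i) q) = sym_poincare ?n q * (\<Prod>i<length \<mu>. unimodal_sum (\<mu> ! i) q)"
    by simp
  have lp: "(\<Prod>p\<leftarrow>\<mu>. f p) = (\<Prod>i<length \<mu>. f (\<mu> ! i))" for f :: "nat \<Rightarrow> 'c"
    by (simp add: prod.list_conv_set_nth atLeast0LessThan)
  have "(\<Prod>i<length \<mu>. unimodal_sum (\<mu> ! i) q) * (\<Prod>p\<leftarrow>\<mu>. 1 - q ^ p) = (\<Prod>i<length \<mu>. (1 - q) ^ (\<mu> ! i) * sym_poincare (\<mu> ! i) q)"
    unfolding lp prod.distrib[symmetric] by (intro prod.cong refl unimodal_sum_poincare pos) auto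
  also have "\<dots> = (1 - q) ^ ?n * (\<Prod>i<length \<mu>. sym_poincare (\<mu> ! i) q)"
    by (simp add: prod.distrib power_sum[symmetric] sum_list_sum_nth atLeast0LessThan)
  finally have eq': "(\<Prod>i<length \<mu>. unimodal_sum (\<mu> ! i) q) * (\<Prod>p\<leftarrow>\<mu>. 1 - q ^ p) = (1 - q) ^ ?n * (\<Prod>i<length \<mu>. sym_poincare (\<mu> ! i) q)" .
  \<comment> \<open>Division-free elimination of the unimodal sums \<open>u\<close> between the two
    product identities; \<open>p\<close> is the factor cancelled afterwards.\<close>
  have cancel: "(z * l) * p = (c * s) * p" if "z * p = s * u" "u * l = c * p" for z l p c s u :: 'c
  proof -
    have "(z * l) * p = (z * p) * l" by (simp only: mult_ac)
    also have "\<dots> = s * (u * l)" unfolding that(1) by (simp only: mult_ac)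
    also have "\<dots> = (c * s) * p" unfolding that(2) by (simp only: mult_ac)
    finally show ?thesis .
  qed
  have "(?Z * (\<Prod>p\<leftarrow>\<mu>. 1 - q ^ p)) * (\<Prod>i<length \<mu>. sym_poincare (\<mu> ! i) q) =
    ((1 - q) ^ ?n * sym_poincare ?n q) * (\<Prod>i<length \<mu>. sym_poincare (\<mu> ! i) q)"
    by (rule cancel[OF eq eq'])
  moreover have "(\<Prod>i<length \<mu>. sym_poincare (\<mu> ! i) q) \<noteq> 0" using q by simp
  ultimately show ?thesis by simp
qed

section \<open>Parabolic subgroups of type A\<close>

definition fixes_count :: "nat \<Rightarrow> (nat \<Rightarrow> nat) \<Rightarrow> nat" where
  "fixes_count n \<pi> = card {x \<in> {1..n}. \<pi> x = x}"

text \<open>The summand is the diagonal entry of \<open>\<pi>\<close> in the basis of consecutive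
  differences of coordinate vectors, so the sum is the trace of the permutation representation minus
  the trivial summand.\<close>

lemma sum_step_fixes:
  assumes p: "\<pi> permutes {1..n}" and n: "1 \<le> n"
  shows "(\<Sum>b\<in>{1..<n}. of_bool (\<pi> b \<le> b) - of_bool (\<pi> (Suc b) \<le> b) :: real) = real (fixes_count n \<pi>) - 1"
proof -
  let ?f = "\<lambda>b. of_bool (\<pi> b \<le> b) :: real" and ?e = "\<lambda>b. of_bool (\<pi> b = b) :: real"
  \<comment> \<open>Replacing \<open>\<pi> (Suc b) \<le> b\<close> by
    \<open>\<pi> (Suc b) \<le> Suc b\<close>, at the cost of the fixed points, makes the sum
    telescope.\<close>
  have "(\<Sum>b\<in>{1..<n}. of_bool (\<pi> b \<le> b) - of_bool (\<pi> (Suc b) \<le> b) :: real) =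
     (\<Sum>b\<in>{1..<n}. (?f b - ?f (Suc b)) + ?e (Suc b))"
    by (intro sum.cong refl) (auto simp: of_bool_def)
  also have "\<dots> = (?f 1 - ?f n) + (\<Sum>b\<in>{1..<n}. ?e (Suc b))"
    unfolding sum.distrib using sum_Suc_diff'[of 1 n "\<lambda>b. - ?f b"] n by simp
  also have "(\<Sum>b\<in>{1..<n}. ?e (Suc b)) = (\<Sum>b\<in>{Suc 1..<Suc n}. ?e b)"
    using sum.shift_bounds_Suc_ivl[of ?e 1 n] by simp
  also have "?f n = 1" using permutes_in_image[OF p, of n] n by simp
  also have "?f 1 = ?e 1" using permutes_in_image[OF p, of 1] n by auto
  also have "(\<Sum>b\<in>{Suc 1..<Suc n}. ?e b) = (\<Sum>b\<in>{1..<Suc n}. ?e b) - ?e 1"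
    using sum.atLeast_Suc_lessThan[of 1 "Suc n" ?e] n by simp
  also have "(\<Sum>b\<in>{1..<Suc n}. ?e b) = real (fixes_count n \<pi>)"
    by (simp add: fixes_count_def of_bool_def sum.If_cases Int_def atLeastLessThanSuc_atLeastAtMost conj_commute)
  finally show ?thesis by simp
qed

text \<open>That \<open>J\<close> is of type A is encoded only in \<open>\<psi>\<close>; the inner
  structure of \<open>J\<close> as a set of roots has to be recovered from it.\<close>

locale type_A_parabolic = based_roots +
  fixes J :: "'a set" and r :: nat and n :: "nat \<Rightarrow> nat" and \<psi> :: "('a \<Rightarrow> 'a) \<Rightarrow> nat \<Rightarrow> nat \<Rightarrow> nat"
  assumes J: "J \<subseteq> \<Delta>"
    and psi_iso: "\<psi> \<in> iso (comp_group (generated_group (reflection ` J))) (product_group {1..r} (\<lambda>j. sym_group (n j)))"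
    and psi_gens: "\<psi> ` (reflection ` J) = product_adjacent_transpositions r n"
begin

definition H where "H = generated_group (reflection ` J)"

lemma H_WG: "h \<in> H \<Longrightarrow> h \<in> WG"
  using parabolic_subset[OF J] by (auto simp: H_def)

lemma H_id: "id \<in> H" and H_comp: "g \<in> H \<Longrightarrow> h \<in> H \<Longrightarrow> g \<circ> h \<in> H"
  and H_gen: "\<alpha> \<in> J \<Longrightarrow> reflection \<alpha> \<in> H" and H_inv: "h \<in> H \<Longrightarrow> inv' h \<in> H"
  unfolding H_def by (auto intro: generated_group_id generated_group_comp generated_group_gen reflection_group_inv)

abbreviation prod_perms where "prod_perms \<equiv> \<Pi>\<^sub>E j\<in>{1..r}. {\<pi>. \<pi> permutes {1..n j}}"

lemma psi_bij: "bij_betw \<psi> H prod_perms"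
  using psi_iso by (simp add: iso_def comp_group_def H_def sym_group_def)

lemma psi_inj: "g \<in> H \<Longrightarrow> h \<in> H \<Longrightarrow> \<psi> g = \<psi> h \<Longrightarrow> g = h"
  using psi_bij by (auto simp: bij_betw_def inj_on_def)

lemma psi_mem: "h \<in> H \<Longrightarrow> \<psi> h \<in> prod_perms"
  using psi_bij by (auto simp: bij_betw_def)

lemma psi_permutes: "h \<in> H \<Longrightarrow> j \<in> {1..r} \<Longrightarrow> \<psi> h j permutes {1..n j}"
  using psi_mem by fastforce

lemma psi_comp: "g \<in> H \<Longrightarrow> h \<in> H \<Longrightarrow> \<psi> (g \<circ> h) = (\<lambda>j\<in>{1..r}. \<psi> g j \<circ> \<psi> h j)"
  using psi_iso by (simp add: iso_def hom_def comp_group_def H_def sym_group_def)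

lemma psi_id: assumes "j \<in> {1..r}" shows "\<psi> id j = id"
proof -
  have "\<psi> (id \<circ> id) j = \<psi> id j \<circ> \<psi> id j" unfolding psi_comp[OF H_id H_id] using assms by simp
  then have "\<psi> id j (\<psi> id j x) = \<psi> id j x" for x by (simp add: fun_eq_iff)
  then have "\<psi> id j x = x" for x using injD[OF permutes_inj[OF psi_permutes[OF H_id assms]]] by blast
  then show ?thesis by (simp add: fun_eq_iff)
qed

lemma psi_eqI: "g \<in> H \<Longrightarrow> h \<in> H \<Longrightarrow> (\<And>j. j \<in> {1..r} \<Longrightarrow> \<psi> g j = \<psi> h j) \<Longrightarrow> g = h"
  using psi_inj PiE_ext[OF psi_mem psi_mem] by blast

definition gen_image :: "nat \<Rightarrow> nat \<Rightarrow> nat \<Rightarrow> nat \<Rightarrow> nat" where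
  "gen_image j a = (\<lambda>i\<in>{1..r}. if i = j then adj a else id)"

definition gen_index :: "(nat \<times> nat) set" where "gen_index = (SIGMA j:{1..r}. {1..<n j})"

text \<open>Labels the roots of \<open>J\<close> by factor and adjacent transposition.\<close>

definition simple_gen :: "nat \<Rightarrow> nat \<Rightarrow> 'a" where
  "simple_gen j a = (SOME \<alpha>. \<alpha> \<in> J \<and> \<psi> (reflection \<alpha>) = gen_image j a)"

lemma gen_image_set: "product_adjacent_transpositions r n = (\<lambda>(j, a). gen_image j a) ` gen_index"
proof (intro subset_antisym subsetI)
  fix x assume "x \<in> product_adjacent_transpositions r n"
  then obtain j t where "x = (\<lambda>i\<in>{1..r}. if i = j then t else id)" "j \<in> {1..r}" "t \<in> adjacent_transpositions (n j)"
    unfolding product_adjacent_transpositions_def by blast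
  moreover then obtain a where "t = adj a" "1 \<le> a" "a < n j" unfolding adjacent_transpositions_def by blast
  ultimately have "x = gen_image j a" "(j, a) \<in> gen_index" unfolding gen_image_def gen_index_def by auto
  then show "x \<in> (\<lambda>(j, a). gen_image j a) ` gen_index" by (intro image_eqI[of _ _ "(j, a)"]) simp_all
next
  fix x assume "x \<in> (\<lambda>(j, a). gen_image j a) ` gen_index"
  then obtain j a where "x = gen_image j a" "j \<in> {1..r}" "1 \<le> a" "a < n j" by (auto simp: gen_index_def)
  moreover then have "adj a \<in> adjacent_transpositions (n j)" unfolding adjacent_transpositions_def by blast
  ultimately show "x \<in> product_adjacent_transpositions r n"
    unfolding product_adjacent_transpositions_def gen_image_def by blast
qed

lemma simple_gen: assumes "(j, a) \<in> gen_index" shows "simple_gen j a \<in> J" "\<psi> (reflection (simple_gen j a)) = gen_image j a"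
proof -
  have "gen_image j a \<in> \<psi> ` (reflection ` J)"
    unfolding psi_gens gen_image_set using imageI[OF assms, of "\<lambda>(j, a). gen_image j a"] by simp
  then have "\<exists>\<alpha>\<in>J. gen_image j a = \<psi> (reflection \<alpha>)" by (simp add: image_iff)
  then have "\<exists>\<alpha>. \<alpha> \<in> J \<and> \<psi> (reflection \<alpha>) = gen_image j a" by metis
  from someI_ex[OF this] show "simple_gen j a \<in> J" "\<psi> (reflection (simple_gen j a)) = gen_image j a"
    unfolding simple_gen_def by blast+
qed

lemma simple_gen_simple: "(j, a) \<in> gen_index \<Longrightarrow> simple_gen j a \<in> \<Delta>" using simple_gen(1) J by blast

lemma simple_gen_H: "(j, a) \<in> gen_index \<Longrightarrow> reflection (simple_gen j a) \<in> H" using simple_gen(1) H_gen by blast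

lemma gen_image_eq: "(j, a) \<in> gen_index \<Longrightarrow> i \<in> {1..r} \<Longrightarrow> \<psi> (reflection (simple_gen j a)) i = (if i = j then adj a else id)"
  using simple_gen(2) by (simp add: gen_image_def)

lemma adj_neq_id: "adj a \<noteq> id" by (metis Transposition.transpose_apply_first id_apply n_not_Suc_n)

lemma adj_inj: assumes "adj a = adj b" shows "a = b"
proof -
  have e: "adj b a = Suc a" using fun_cong[OF assms, of a] by (metis Transposition.transpose_apply_first)
  show ?thesis
  proof (rule ccontr)
    assume ne: "a \<noteq> b"
    show False
    proof (cases "a = Suc b")
      case True
      have "adj b a = b" unfolding True by (rule Transposition.transpose_apply_second)
      then show False using e True by linarith
    next
      case False
      have "adj b a = a" using ne False by (rule Transposition.transpose_apply_other)
      then show False using e by linarith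
    qed
  qed
qed

lemma simple_gen_inj:
  assumes "(j, a) \<in> gen_index" "(i, b) \<in> gen_index" "simple_gen j a = simple_gen i b" shows "j = i \<and> a = b"
proof -
  have jr: "j \<in> {1..r}" using assms by (auto simp: gen_index_def)
  have "adj a = (if j = i then adj b else id)"
    using gen_image_eq[OF assms(1) jr] gen_image_eq[OF assms(2) jr] assms(3) by simp
  then have "j = i" using adj_neq_id[of a] by (cases "j = i") simp_all
  then have "adj a = adj b" using \<open>adj a = (if j = i then adj b else id)\<close> by simp
  then show ?thesis using adj_inj \<open>j = i\<close> by blast
qed

lemma simple_gen_surj: "\<alpha> \<in> J \<Longrightarrow> \<exists>(j, a)\<in>gen_index. \<alpha> = simple_gen j a"
proof -
  assume a: "\<alpha> \<in> J"
  then have "\<psi> (reflection \<alpha>) \<in> (\<lambda>(j, a). gen_image j a) ` gen_index" using psi_gens gen_image_set by blast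
  then obtain j b where jb: "(j, b) \<in> gen_index" "\<psi> (reflection \<alpha>) = gen_image j b" by auto
  then have "reflection \<alpha> = reflection (simple_gen j b)" using psi_inj[OF H_gen[OF a] simple_gen_H] simple_gen(2) by simp
  then have "\<alpha> = simple_gen j b" using reflection_Pos_eq simple_Pos a J simple_gen_simple[OF jb(1)] by blast
  then show ?thesis using jb by blast
qed

lemma simple_gen_bij: "bij_betw (\<lambda>(j, a). simple_gen j a) gen_index J"
  unfolding bij_betw_def
proof
  show "inj_on (\<lambda>(j, a). simple_gen j a) gen_index" using simple_gen_inj by (auto simp: inj_on_def)
  show "(\<lambda>(j, a). simple_gen j a) ` gen_index = J" using simple_gen(1) simple_gen_surj by force
qed

lemma reflection_conj_simple:
  assumes "\<alpha> \<in> \<Delta>"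
  shows "reflection (reflection \<alpha> \<beta>) = reflection \<alpha> \<circ> reflection \<beta> \<circ> reflection \<alpha>"
proof
  fix x
  show "reflection (reflection \<alpha> \<beta>) x = (reflection \<alpha> \<circ> reflection \<beta> \<circ> reflection \<alpha>) x"
    using reflection_conj[OF reflection_linear reflection_inner, of \<alpha> \<beta> "reflection \<alpha> x"] by simp
qed

text \<open>Commuting reflections, transported back through \<open>\<psi>\<close>, say that one
  reflection maps the other root to a root with the same reflection; positivity selects the root
  itself rather than its negative.\<close>

lemma simple_gen_commuting:
  assumes ja: "(j, a) \<in> gen_index" and ib: "(i, b) \<in> gen_index" and far: "i \<noteq> j \<or> Suc a < b \<or> Suc b < a"
  shows "reflection (simple_gen j a) (simple_gen i b) = simple_gen i b"
proof -
  let ?s = "reflection (simple_gen j a)" and ?t = "reflection (simple_gen i b)"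
  have ne: "simple_gen j a \<noteq> simple_gen i b" using simple_gen_inj[OF ja ib] far by auto
  have "\<psi> (?s \<circ> ?t) k = \<psi> (?t \<circ> ?s) k" if k: "k \<in> {1..r}" for k
  proof -
    have "adj a (adj b x) = adj b (adj a x)" if "Suc a < b \<or> Suc b < a" for x
      using that by (auto simp: Transposition.transpose_def)
    then have "adj a \<circ> adj b = adj b \<circ> adj a" if "i = j" using far that by (auto simp: fun_eq_iff)
    then show ?thesis
      using k by (simp add: psi_comp simple_gen_H ja ib gen_image_eq)
  qed
  then have st: "?s \<circ> ?t = ?t \<circ> ?s"
    by (rule psi_eqI[OF H_comp[OF simple_gen_H[OF ja] simple_gen_H[OF ib]] H_comp[OF simple_gen_H[OF ib] simple_gen_H[OF ja]]])
  have "reflection (?s (simple_gen i b)) = ?t"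
    unfolding reflection_conj_simple[OF simple_gen_simple[OF ja]] st by (rule comp_reflection_reflection(1))
  moreover have "?s (simple_gen i b) \<in> Pos"
    using reflection_simple_Pos[OF simple_gen_simple[OF ja] simple_Pos[OF simple_gen_simple[OF ib]]] ne by simp
  ultimately show ?thesis using reflection_Pos_eq simple_Pos[OF simple_gen_simple[OF ib]] by blast
qed

text \<open>The braid relation says that the images \<open>?s ?\<beta>\<close> and
  \<open>?t ?\<alpha>\<close> have the same reflection; both are positive, so they coincide. The
  first has the coefficients of \<open>?\<beta>\<close> away from \<open>?\<alpha>\<close>, the
  second those of \<open>?\<alpha>\<close> away from \<open>?\<beta>\<close>, which leaves only the
  sum.\<close>

lemma simple_gen_adjacent:
  assumes ja: "(j, a) \<in> gen_index" and jb: "(j, Suc a) \<in> gen_index"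
  shows "reflection (simple_gen j a) (simple_gen j (Suc a)) = simple_gen j a + simple_gen j (Suc a)"
    and "reflection (simple_gen j (Suc a)) (simple_gen j a) = simple_gen j a + simple_gen j (Suc a)"
proof -
  let ?\<alpha> = "simple_gen j a" and ?\<beta> = "simple_gen j (Suc a)"
  let ?s = "reflection ?\<alpha>" and ?t = "reflection ?\<beta>"
  have d: "?\<alpha> \<in> \<Delta>" "?\<beta> \<in> \<Delta>" using simple_gen_simple ja jb by auto
  have ne: "?\<alpha> \<noteq> ?\<beta>" using simple_gen_inj[OF ja jb] by auto
  have sp: "?\<alpha> \<in> span \<Delta>" "?\<beta> \<in> span \<Delta>" using d span_base by auto
  have "\<psi> (?s \<circ> ?t \<circ> ?s) k = \<psi> (?t \<circ> ?s \<circ> ?t) k" if k: "k \<in> {1..r}" for k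
  proof -
    have "adj a \<circ> adj (Suc a) \<circ> adj a = adj (Suc a) \<circ> adj a \<circ> adj (Suc a)"
      by (auto simp: fun_eq_iff Transposition.transpose_def)
    then show ?thesis using k by (simp add: psi_comp simple_gen_H ja jb gen_image_eq H_comp)
  qed
  then have "?s \<circ> ?t \<circ> ?s = ?t \<circ> ?s \<circ> ?t"
    by (rule psi_eqI[OF H_comp[OF H_comp[OF simple_gen_H[OF ja] simple_gen_H[OF jb]] simple_gen_H[OF ja]]
        H_comp[OF H_comp[OF simple_gen_H[OF jb] simple_gen_H[OF ja]] simple_gen_H[OF jb]]])
  then have "reflection (?s ?\<beta>) = reflection (?t ?\<alpha>)"
    unfolding reflection_conj_simple[OF d(1)] reflection_conj_simple[OF d(2)] .
  moreover have "?s ?\<beta> \<in> Pos" "?t ?\<alpha> \<in> Pos"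
    using reflection_simple_Pos[OF d(1) simple_Pos[OF d(2)]] reflection_simple_Pos[OF d(2) simple_Pos[OF d(1)]] ne
    by simp_all
  ultimately have eq: "?s ?\<beta> = ?t ?\<alpha>" using reflection_Pos_eq by blast
  have "?s ?\<beta> = ?\<alpha> + ?\<beta>"
  proof (rule coeff_eqI)
    show "?s ?\<beta> \<in> span \<Delta>" using \<open>?s ?\<beta> \<in> Pos\<close> Pos_root root_span by blast
    show "?\<alpha> + ?\<beta> \<in> span \<Delta>" using sp by (rule span_add)
    fix \<gamma> assume "\<gamma> \<in> \<Delta>"
    show "coeff (?s ?\<beta>) \<gamma> = coeff (?\<alpha> + ?\<beta>) \<gamma>"
    proof (cases "\<gamma> = ?\<alpha>")
      case True
      then have "coeff (?t ?\<alpha>) \<gamma> = coeff ?\<alpha> \<gamma>" using coeff_reflection[OF d(2) _ sp(1)] ne by simp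
      then show ?thesis using eq True ne d sp by (simp add: coeff_simps coeff_simple)
    next
      case False
      then have "coeff (?s ?\<beta>) \<gamma> = coeff ?\<beta> \<gamma>" using coeff_reflection[OF d(1) _ sp(2)] by simp
      then show ?thesis using False d sp by (simp add: coeff_simps coeff_simple)
    qed
  qed
  then show "?s ?\<beta> = ?\<alpha> + ?\<beta>" "?t ?\<alpha> = ?\<alpha> + ?\<beta>" using eq by simp_all
qed

text \<open>The vectors \<open>E j p - E j q\<close> play the role of the differences of coordinate vectors on which the
  \<open>j\<close>-th symmetric group acts by permuting indices.\<close>
definition E :: "nat \<Rightarrow> nat \<Rightarrow> 'a" where "E j p = (\<Sum>b\<in>{p..<n j}. simple_gen j b)"

lemma E_step: "b < n j \<Longrightarrow> E j b = simple_gen j b + E j (Suc b)"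
  by (simp add: E_def sum.atLeast_Suc_lessThan)

text \<open>The four cases are the Cartan integers 0, 2 and twice -1 of type A; in each of them the
  generator acts by permuting indices.\<close>

lemma gen_action:
  assumes ja: "(j, a) \<in> gen_index" and ib: "(i, b) \<in> gen_index"
  shows "reflection (simple_gen j a) (simple_gen i b) = E i (gen_image j a i b) - E i (gen_image j a i (Suc b))"
proof -
  have ir: "i \<in> {1..r}" and b: "1 \<le> b" "b < n i" and a: "1 \<le> a" "a < n j" using ib ja by (auto simp: gen_index_def)
  consider "i \<noteq> j \<or> Suc a < b \<or> Suc b < a" | "i = j" "b = a" | "i = j" "b = Suc a" | "i = j" "a = Suc b" by linarith
  then show ?thesis
  proof cases
    case 1
    then have "gen_image j a i b = b" "gen_image j a i (Suc b) = Suc b"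
      using ir by (auto simp: gen_image_def Transposition.transpose_def)
    then show ?thesis using simple_gen_commuting[OF ja ib 1] E_step[OF b(2)] by simp
  next
    case 2
    then have "gen_image j a i b = Suc b" "gen_image j a i (Suc b) = b"
      using ir by (auto simp: gen_image_def)
    then show ?thesis using reflection_simple_self[OF simple_gen_simple[OF ja]] 2 E_step[OF b(2)] by simp
  next
    case 3
    then have "gen_image j a i b = a" "gen_image j a i (Suc b) = Suc b"
      using ir by (auto simp: gen_image_def Transposition.transpose_def)
    then show ?thesis using simple_gen_adjacent(1)[OF ja] ib 3 E_step[OF b(2)] E_step[OF a(2)] by simp
  next
    case 4
    then have "gen_image j a i b = b" "gen_image j a i (Suc b) = Suc a"
      using ir by (auto simp: gen_image_def Transposition.transpose_def)
    then show ?thesis using simple_gen_adjacent(2)[of j b] ib ja 4 E_step[OF b(2)] E_step[OF a(2)] by simp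
  qed
qed

text \<open>Since \<open>E i (n i)\<close> is zero, \<open>E i p\<close> is itself a difference; the
  correction term is the image of its second end, and it cancels when two such vectors are
  subtracted.\<close>

lemma action_E:
  assumes w: "linear w" and i: "i \<in> {1..r}"
    and act: "\<And>b. (i, b) \<in> gen_index \<Longrightarrow> w (simple_gen i b) = E i (\<pi> b) - E i (\<pi> (Suc b))"
    and p: "1 \<le> p" "p \<le> n i"
  shows "w (E i p) = E i (\<pi> p) - E i (\<pi> (n i))"
proof -
  have "w (E i p) = (\<Sum>b\<in>{p..<n i}. w (simple_gen i b))" unfolding E_def by (rule linear_sum[OF w])
  also have "\<dots> = (\<Sum>b\<in>{p..<n i}. E i (\<pi> b) - E i (\<pi> (Suc b)))"
    using act i p by (intro sum.cong refl) (auto simp: gen_index_def)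
  also have "\<dots> = E i (\<pi> p) - E i (\<pi> (n i))"
    using sum_Suc_diff'[OF p(2), of "\<lambda>b. - E i (\<pi> b)"] by simp
  finally show ?thesis .
qed

text \<open>Induction on a word for \<open>h\<close>. The statement carries membership in
  \<open>H\<close> along, because \<open>psi_comp\<close> requires it at each step.\<close>

lemma H_action:
  assumes h: "h \<in> H"
  shows "\<forall>(i, b)\<in>gen_index. h (simple_gen i b) = E i (\<psi> h i b) - E i (\<psi> h i (Suc b))"
proof -
  have "h \<in> H \<and> (\<forall>(i, b)\<in>gen_index. h (simple_gen i b) = E i (\<psi> h i b) - E i (\<psi> h i (Suc b)))"
    using h unfolding H_def
  proof (induction rule: generated_group_induct)
    case id
    have "simple_gen i b = E i (\<psi> id i b) - E i (\<psi> id i (Suc b))" if "(i, b) \<in> gen_index" for i b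
      using psi_id[of i] that E_step[of b i] by (auto simp: gen_index_def)
    then have "\<forall>(i, b)\<in>gen_index. id (simple_gen i b) = E i (\<psi> id i b) - E i (\<psi> id i (Suc b))" by auto
    then show ?case using generated_group_id by blast
  next
    case (comp s w)
    then have w: "w \<in> H" by (simp add: H_def)
    have IH: "w (simple_gen i b) = E i (\<psi> w i b) - E i (\<psi> w i (Suc b))" if "(i, b) \<in> gen_index" for i b
      using comp(3) that by blast
    obtain j a where ja: "(j, a) \<in> gen_index" "s = reflection (simple_gen j a)" using comp(1) simple_gen_surj by blast
    have s: "s \<in> H" using ja simple_gen_H by simp
    have "(s \<circ> w) (simple_gen i b) = E i (\<psi> (s \<circ> w) i b) - E i (\<psi> (s \<circ> w) i (Suc b))" if ib: "(i, b) \<in> gen_index" for i b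
    proof -
      let ?\<tau> = "gen_image j a i" and ?\<pi> = "\<psi> w i"
      have ir: "i \<in> {1..r}" and b: "1 \<le> b" "b < n i" using ib by (auto simp: gen_index_def)
      have range: "?\<pi> b \<in> {1..n i}" "?\<pi> (Suc b) \<in> {1..n i}"
        using permutes_in_image[OF psi_permutes[OF w ir]] b by auto
      have E: "s (E i p) = E i (?\<tau> p) - E i (?\<tau> (n i))" if "p \<in> {1..n i}" for p
        unfolding ja(2) by (rule action_E[OF reflection_linear ir gen_action[OF ja(1)]]) (use that in auto)
      have "(s \<circ> w) (simple_gen i b) = s (E i (?\<pi> b)) - s (E i (?\<pi> (Suc b)))"
        using IH[OF ib] linear_diff[OF reflection_linear] ja(2) by simp
      also have "\<dots> = E i (?\<tau> (?\<pi> b)) - E i (?\<tau> (?\<pi> (Suc b)))"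
        unfolding E[OF range(1)] E[OF range(2)] by simp
      also have "?\<tau> = \<psi> s i" using simple_gen(2)[OF ja(1)] ja(2) by simp
      finally show ?thesis using psi_comp[OF s w] ir by simp
    qed
    moreover have "s \<circ> w \<in> generated_group (reflection ` J)" using H_comp[OF s w] unfolding H_def .
    ultimately show ?case by blast
  qed
  then show ?thesis by blast
qed

lemma coeff_E:
  assumes "(i, b) \<in> gen_index" "1 \<le> p"
  shows "coeff (E i p) (simple_gen i b) = of_bool (p \<le> b)"
proof -
  have m: "(i, c) \<in> gen_index" if "c \<in> {p..<n i}" for c using assms that by (auto simp: gen_index_def)
  have "coeff (E i p) (simple_gen i b) = (\<Sum>c\<in>{p..<n i}. coeff (simple_gen i c) (simple_gen i b))"
    unfolding E_def
    by (rule representation_sum[OF independent_base, THEN fun_cong, of _ _ "simple_gen i b", simplified])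
      (rule span_base[OF simple_gen_simple[OF m]])
  also have "\<dots> = (\<Sum>c\<in>{p..<n i}. if b = c then 1 else 0)"
  proof (rule sum.cong[OF refl])
    fix c assume c: "c \<in> {p..<n i}"
    have "simple_gen i b = simple_gen i c \<longleftrightarrow> b = c" using simple_gen_inj[OF assms(1) m[OF c]] by auto
    then show "coeff (simple_gen i c) (simple_gen i b) = (if b = c then 1 else 0)"
      using coeff_simple[OF simple_gen_simple[OF m[OF c]]] by simp
  qed
  also have "\<dots> = of_bool (p \<le> b)" using assms by (simp add: gen_index_def)
  finally show ?thesis .
qed

lemma E_span: "1 \<le> p \<Longrightarrow> i \<in> {1..r} \<Longrightarrow> E i p \<in> span \<Delta>"
  unfolding E_def by (intro span_sum span_base simple_gen_simple) (auto simp: gen_index_def)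

lemma sum_gen_index: "(\<Sum>(j, a)\<in>gen_index. F j a) = (\<Sum>j\<in>{1..r}. \<Sum>a\<in>{1..<n j}. F j a)"
  unfolding gen_index_def by (subst sum.Sigma) auto

section \<open>Trace, length and weight through the identification\<close>

lemma vtrace_H:
  assumes h: "h \<in> H"
  shows "vtrace h = real (card \<Delta>) + (\<Sum>j\<in>{1..r}. real (fixes_count (n j) (\<psi> h j)) - real (n j))"
proof -
  have fJ: "finite J" using J finite_base finite_subset by blast
  have "vtrace h = (\<Sum>\<alpha>\<in>\<Delta> - J. coeff (h \<alpha>) \<alpha>) + (\<Sum>\<alpha>\<in>J. coeff (h \<alpha>) \<alpha>)"
    unfolding vtrace_base[OF H_WG[OF h]] using sum.subset_diff[OF J finite_base] by blast
  \<comment> \<open>A simple root outside \<open>J\<close> is changed only by an element of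
    \<open>span J\<close>, so its diagonal entry stays 1.\<close>
  also have "(\<Sum>\<alpha>\<in>\<Delta> - J. coeff (h \<alpha>) \<alpha>) = (\<Sum>\<alpha>\<in>\<Delta> - J. 1)"
  proof (rule sum.cong[OF refl])
    fix \<alpha> assume a: "\<alpha> \<in> \<Delta> - J"
    have hs: "h \<alpha> \<in> span \<Delta>" using root_span[OF WG_root[OF H_WG[OF h] simple_root]] a by blast
    have "coeff (h \<alpha> - \<alpha>) \<alpha> = 0"
      using coeff_span_outside[OF J parabolic_diff_span a] h unfolding H_def by blast
    then show "coeff (h \<alpha>) \<alpha> = 1" using a hs by (simp add: coeff_simps span_base coeff_simple)
  qed
  also have "(\<Sum>\<alpha>\<in>\<Delta> - J. 1 :: real) = real (card \<Delta>) - real (card J)"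
    using card_Diff_subset[OF fJ J] card_mono[OF finite_base J] by simp
  also have "(\<Sum>\<alpha>\<in>J. coeff (h \<alpha>) \<alpha>) = (\<Sum>(j, a)\<in>gen_index. coeff (h (simple_gen j a)) (simple_gen j a))"
    by (subst sum.reindex_bij_betw[OF simple_gen_bij, symmetric]) (simp add: case_prod_unfold)
  also have "\<dots> = (\<Sum>(j, a)\<in>gen_index. of_bool (\<psi> h j a \<le> a) - of_bool (\<psi> h j (Suc a) \<le> a))"
  proof (rule sum.cong[OF refl], clarify)
    fix j a assume ja: "(j, a) \<in> gen_index"
    then have jr: "j \<in> {1..r}" and a: "a \<in> {1..n j}" "Suc a \<in> {1..n j}" by (auto simp: gen_index_def)
    have rng: "1 \<le> \<psi> h j a" "1 \<le> \<psi> h j (Suc a)"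
      using permutes_in_image[OF psi_permutes[OF h jr]] a by (meson atLeastAtMost_iff)+
    have "h (simple_gen j a) = E j (\<psi> h j a) - E j (\<psi> h j (Suc a))" using H_action[OF h] ja by blast
    then show "coeff (h (simple_gen j a)) (simple_gen j a) = of_bool (\<psi> h j a \<le> a) - of_bool (\<psi> h j (Suc a) \<le> a)"
      using coeff_E[OF ja rng(1)] coeff_E[OF ja rng(2)] E_span[OF rng(1) jr] E_span[OF rng(2) jr]
      by (simp add: coeff_simps)
  qed
  also have "\<dots> = (\<Sum>j\<in>{1..r}. \<Sum>a\<in>{1..<n j}. of_bool (\<psi> h j a \<le> a) - of_bool (\<psi> h j (Suc a) \<le> a))"
    by (rule sum_gen_index)
  \<comment> \<open>The term \<open>real (n j - 1)\<close> counts the roots of the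
    \<open>j\<close>-th factor. The subtraction on naturals makes it 0 for an empty factor, where
    \<open>sum_step_fixes\<close> does not apply.\<close>
  also have "\<dots> = (\<Sum>j\<in>{1..r}. real (fixes_count (n j) (\<psi> h j)) - real (n j) + real (n j - 1))"
  proof (rule sum.cong[OF refl])
    fix j assume j: "j \<in> {1..r}"
    show "(\<Sum>a\<in>{1..<n j}. of_bool (\<psi> h j a \<le> a) - of_bool (\<psi> h j (Suc a) \<le> a)) =
      real (fixes_count (n j) (\<psi> h j)) - real (n j) + real (n j - 1)"
    proof (cases "n j = 0")
      case True
      then show ?thesis by (simp add: fixes_count_def)
    next
      case False
      then show ?thesis using sum_step_fixes[OF psi_permutes[OF h j]] by simp
    qed
  qed
  also have "\<dots> = (\<Sum>j\<in>{1..r}. real (fixes_count (n j) (\<psi> h j)) - real (n j)) + real (card J)"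
  proof -
    have "card J = card gen_index" using bij_betw_same_card[OF simple_gen_bij] by simp
    also have "\<dots> = (\<Sum>j\<in>{1..r}. n j - 1)" unfolding gen_index_def by simp
    finally show ?thesis by (simp add: sum.distrib)
  qed
  finally show ?thesis by simp
qed

lemma psi_gen_comp:
  assumes g: "g \<in> H" and ja: "(j, a) \<in> gen_index" and i: "i \<in> {1..r}"
  shows "\<psi> (g \<circ> reflection (simple_gen j a)) i = (if i = j then \<psi> g j \<circ> adj a else \<psi> g i)"
  using psi_comp[OF g simple_gen_H[OF ja]] gen_image_eq[OF ja i] i by simp

text \<open>By \<open>parabolic_word_length\<close> the length may be computed with the generators
  from \<open>J\<close> only. These act on one factor each, by an adjacent transposition, so the
  total inversion count meets \<open>word_length_eqI\<close>.\<close>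

lemma len_H: assumes h: "h \<in> H" shows "len h = (\<Sum>j\<in>{1..r}. invs (n j) (\<psi> h j))"
proof -
  let ?f = "\<lambda>h. \<Sum>j\<in>{1..r}. invs (n j) (\<psi> h j)"
  have split: "?f g = invs (n j) (\<psi> g j) + (\<Sum>i\<in>{1..r} - {j}. invs (n i) (\<psi> g i))" if "j \<in> {1..r}" for g j
    using that by (intro sum.remove) auto
  have step: "?f (g \<circ> reflection (simple_gen j a)) = invs (n j) (\<psi> g j \<circ> adj a) + (\<Sum>i\<in>{1..r} - {j}. invs (n i) (\<psi> g i))"
    if g: "g \<in> H" "(j, a) \<in> gen_index" for g j a
  proof -
    have j: "j \<in> {1..r}" using g by (auto simp: gen_index_def)
    show ?thesis unfolding split[OF j]
      using psi_gen_comp[OF g j] psi_gen_comp[OF g] by (intro arg_cong2[where f = "(+)"] sum.cong) auto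
  qed
  have "word_length (reflection ` J) h = ?f h"
  proof (rule word_length_eqI(1)[where G = H])
    show "id \<in> H" by (rule H_id)
    show "g \<circ> s \<in> H" if "g \<in> H" "s \<in> reflection ` J" for g s using that H_comp H_gen by blast
    show "s \<circ> s = id" if "s \<in> reflection ` J" for s using that reflection_involution by auto
    show "?f id = 0" using psi_id invs_id by simp
    show "h \<in> H" by fact
  next
    fix g assume g: "g \<in> H"
    show "g = id" if z: "?f g = 0"
    proof (rule psi_eqI[OF g H_id])
      fix j assume j: "j \<in> {1..r}"
      have "invs (n j) (\<psi> g j) = 0" using z j by simp
      then show "\<psi> g j = \<psi> id j" using invs_eq_0[OF psi_permutes[OF g j]] psi_id[OF j] by simp
    qed
    show "\<exists>s\<in>reflection ` J. Suc (?f (g \<circ> s)) = ?f g" if pos: "0 < ?f g"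
    proof -
      have "\<exists>j\<in>{1..r}. 0 < invs (n j) (\<psi> g j)"
      proof (rule ccontr)
        assume "\<not> ?thesis"
        then have "?f g = 0" by simp
        then show False using pos by simp
      qed
      then obtain j where j: "j \<in> {1..r}" "0 < invs (n j) (\<psi> g j)" by blast
      obtain a where a: "1 \<le> a" "a < n j" "\<not> \<psi> g j a < \<psi> g j (Suc a)"
        using invs_pos_descent[OF psi_permutes[OF g j(1)] j(2)] by blast
      then have ja: "(j, a) \<in> gen_index" using j by (simp add: gen_index_def)
      have "Suc (?f (g \<circ> reflection (simple_gen j a))) = ?f g"
        unfolding step[OF g ja] using split[OF j(1), of g] invs_comp_adj(2)[OF psi_permutes[OF g j(1)] a] by simp
      then show ?thesis using simple_gen(1)[OF ja] by blast
    qed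
  next
    fix g s assume g: "g \<in> H" and s: "s \<in> reflection ` J"
    obtain j a where ja: "(j, a) \<in> gen_index" "s = reflection (simple_gen j a)" using s simple_gen_surj by blast
    have j: "j \<in> {1..r}" and a: "1 \<le> a" "a < n j" using ja by (auto simp: gen_index_def)
    show "?f (g \<circ> s) \<le> Suc (?f g)"
      unfolding ja(2) step[OF g ja(1)] using split[OF j, of g] invs_comp_adj[OF psi_permutes[OF g j] a]
      by (cases "\<psi> g j a < \<psi> g j (Suc a)") auto
  qed
  then show ?thesis using parabolic_word_length[OF J, of h] h unfolding H_def len_def by simp
qed

lemma H_sum:
  fixes q :: "'c::comm_semiring_1"
  shows "(\<Sum>h\<in>H. q ^ len h * (\<Prod>j\<in>{1..r}. F j (\<psi> h j))) =
    (\<Prod>j\<in>{1..r}. \<Sum>\<pi> | \<pi> permutes {1..n j}. q ^ invs (n j) \<pi> * F j \<pi>)"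
proof -
  have "(\<Prod>j\<in>{1..r}. \<Sum>\<pi> | \<pi> permutes {1..n j}. q ^ invs (n j) \<pi> * F j \<pi>) =
      (\<Sum>g\<in>prod_perms. \<Prod>j\<in>{1..r}. q ^ invs (n j) (g j) * F j (g j))"
    by (rule prod_sum_PiE) (auto simp: finite_permutations)
  also have "\<dots> = (\<Sum>h\<in>H. \<Prod>j\<in>{1..r}. q ^ invs (n j) (\<psi> h j) * F j (\<psi> h j))"
    by (subst sum.reindex_bij_betw[OF psi_bij, symmetric]) simp
  also have "\<dots> = (\<Sum>h\<in>H. q ^ len h * (\<Prod>j\<in>{1..r}. F j (\<psi> h j)))"
    by (intro sum.cong refl) (simp add: len_H prod.distrib power_sum)
  finally show ?thesis ..
qed

text \<open>The coset factorisation for \<open>H\<close> in the Weyl group; over \<open>H\<close>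
  itself both the length and the weight split along the factors.\<close>

lemma weyl_weight_factorization:
  fixes q :: "'c::comm_ring_1"
  shows "(\<Sum>w\<in>WG. q ^ len w * of_int (weyl_weight (reflection ` \<Delta>) H \<psi> r \<mu> w)) * (\<Prod>j\<in>{1..r}. sym_poincare (n j) q) =
    (\<Sum>w\<in>WG. q ^ len w) * (\<Prod>j\<in>{1..r}. \<Sum>\<pi> | \<pi> permutes {1..n j}. q ^ invs (n j) \<pi> * of_int (sym_weight (\<mu> j) \<pi>))"
proof -
  let ?wl = "word_length (reflection ` \<Delta>)"
  let ?F = "\<lambda>h. of_int (product_weight r \<mu> (\<psi> h)) :: 'c"
  have wl: "?wl w = len w" if "w \<in> WG" for w using simple_word_length[OF that] by (simp add: len_def)
  have "(\<Sum>w\<in>WG. q ^ ?wl w * ?F (subgroup_part ?wl H w)) * (\<Sum>h\<in>H. q ^ ?wl h) = (\<Sum>w\<in>WG. q ^ ?wl w) * (\<Sum>h\<in>H. q ^ ?wl h * ?F h)"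
  proof (rule coset_factorization)
    show "finite WG" by (rule finite_WG)
    show "H \<subseteq> WG" using H_WG by blast
    show "g \<circ> h \<in> WG" if "g \<in> WG" "h \<in> H" for g h using that H_WG WG_comp by blast
    show "id \<in> H" by (rule H_id)
    show "h \<circ> k \<in> H" if "h \<in> H" "k \<in> H" for h k using H_comp that .
    show "inv' h \<in> H" if "h \<in> H" for h using H_inv that .
    show "bij g" if "g \<in> WG" for g using WG_bij that .
    show "h = id" if "h \<in> H" "?wl h = 0" for h using that len_eq_0[OF H_WG] wl[OF H_WG] by simp
    fix w h assume w: "w \<in> WG" "\<forall>k\<in>H. ?wl w \<le> ?wl (w \<circ> k)" and h: "h \<in> H"
    have wk: "?wl (w \<circ> k) = len (w \<circ> k)" if "k \<in> H" for k using wl[OF WG_comp[OF w(1) H_WG[OF that]]] .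
    then have "\<forall>k\<in>H. len w \<le> len (w \<circ> k)" using w wl[OF w(1)] by simp
    then show "?wl (w \<circ> h) = ?wl w + ?wl h"
      using parabolic_length_additive[OF J h[unfolded H_def] w(1)] unfolding wk[OF h] wl[OF w(1)] wl[OF H_WG[OF h]] H_def
      by blast
  qed
  moreover have "(\<Sum>h\<in>H. q ^ ?wl h) = (\<Prod>j\<in>{1..r}. sym_poincare (n j) q)"
    using H_sum[of q "\<lambda>_ _. 1"] wl H_WG by (simp add: sym_poincare_def cong: sum.cong)
  moreover have "(\<Sum>h\<in>H. q ^ ?wl h * ?F h) =
      (\<Prod>j\<in>{1..r}. \<Sum>\<pi> | \<pi> permutes {1..n j}. q ^ invs (n j) \<pi> * of_int (sym_weight (\<mu> j) \<pi>))"
  proof -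
    have "(\<Sum>h\<in>H. q ^ ?wl h * ?F h) = (\<Sum>h\<in>H. q ^ len h * (\<Prod>j\<in>{1..r}. of_int (sym_weight (\<mu> j) (\<psi> h j))))"
      using wl H_WG by (intro sum.cong refl) (simp add: product_weight_def of_int_prod)
    then show ?thesis using H_sum[of q "\<lambda>j \<pi>. of_int (sym_weight (\<mu> j) \<pi>)"] by simp
  qed
  moreover have "(\<Sum>w\<in>WG. q ^ ?wl w) = (\<Sum>w\<in>WG. q ^ len w)" using wl by (intro sum.cong) auto
  moreover have "(\<Sum>w\<in>WG. q ^ ?wl w * ?F (subgroup_part ?wl H w)) =
      (\<Sum>w\<in>WG. q ^ len w * of_int (weyl_weight (reflection ` \<Delta>) H \<psi> r \<mu> w))"
    using wl by (intro sum.cong) (auto simp: weyl_weight_def)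
  ultimately show ?thesis by simp
qed

lemma psi_funpow: "h \<in> H \<Longrightarrow> h ^^ k \<in> H \<and> (\<forall>j\<in>{1..r}. \<psi> (h ^^ k) j = \<psi> h j ^^ k)"
proof (induction k)
  case 0
  have "\<forall>j\<in>{1..r}. \<psi> id j = id" using psi_id by blast
  then show ?case unfolding funpow.simps using H_id by blast
next
  case (Suc k)
  then have k: "h ^^ k \<in> H" "\<forall>j\<in>{1..r}. \<psi> (h ^^ k) j = \<psi> h j ^^ k" by blast+
  have "\<forall>j\<in>{1..r}. \<psi> (h \<circ> h ^^ k) j = \<psi> h j \<circ> \<psi> h j ^^ k"
    using psi_comp[OF Suc.prems k(1)] k(2) by simp
  then show ?case unfolding funpow.simps using H_comp[OF Suc.prems k(1)] by blast
qed

end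

section \<open>Cycle types and generating functions\<close>

lemma card_orbit_least_power:
  assumes "permutation \<pi>" shows "card (orbit \<pi> x) = least_power \<pi> x"
proof -
  have "orbit \<pi> x = set (support \<pi> x)"
    unfolding support_set[OF assms] orbit_altdef_permutation[OF assms] by auto
  then show ?thesis using cycle_of_permutation[OF assms, of x] distinct_card by fastforce
qed

lemma sum_list_cycle_type:
  "(\<Sum>p\<leftarrow>cycle_type n \<pi>. f p) = (\<Sum>C\<in>orbit \<pi> ` {1..n}. f (card C))"
proof -
  let ?M = "image_mset card (mset_set (orbit \<pi> ` {1..n}))"
  have "(\<Sum>p\<leftarrow>cycle_type n \<pi>. f p) = sum_mset (mset (map f (cycle_type n \<pi>)))"
    by (rule sum_mset_sum_list[symmetric])
  also have "\<dots> = sum_mset (image_mset f ?M)" by (simp add: cycle_type_def)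
  finally show ?thesis by (simp add: sum_unfold_sum_mset image_mset.compositionality comp_def)
qed

lemma cycle_type_positive:
  assumes p: "\<pi> permutes {1..n}" and "x \<in> set (cycle_type n \<pi>)" shows "1 \<le> x"
proof -
  have perm: "permutation \<pi>" using p permutation_permutes by blast
  obtain y where "x = card (orbit \<pi> y)" using assms(2) by (auto simp: cycle_type_def)
  then show ?thesis using card_orbit_least_power[OF perm] least_power_of_permutation(2)[OF perm, of y] by simp
qed

text \<open>A point is fixed by the \<open>i\<close>-th power exactly when its cycle length divides
  \<open>i\<close>, and then the whole cycle is fixed.\<close>

lemma fixes_count_funpow:
  assumes p: "\<pi> permutes {1..n}"
  shows "fixes_count n (\<pi> ^^ i) = (\<Sum>p\<leftarrow>cycle_type n \<pi>. if p dvd i then p else 0)"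
proof -
  have perm: "permutation \<pi>" using p permutation_permutes by blast
  have self: "x \<in> orbit \<pi> x" for x by (rule permutation_self_in_orbit[OF perm])
  have fixed: "(\<pi> ^^ i) x = x \<longleftrightarrow> card (orbit \<pi> x) dvd i" for x
    using least_power_dvd[OF perm] card_orbit_least_power[OF perm] by metis
  have fiber: "{x \<in> {1..n}. orbit \<pi> x = orbit \<pi> y} = orbit \<pi> y" if y: "y \<in> {1..n}" for y
  proof
    show "{x \<in> {1..n}. orbit \<pi> x = orbit \<pi> y} \<subseteq> orbit \<pi> y" using self by blast
    show "orbit \<pi> y \<subseteq> {x \<in> {1..n}. orbit \<pi> x = orbit \<pi> y}"
    proof
      fix x assume x: "x \<in> orbit \<pi> y"
      have "x \<in> {1..n}" using permutes_orbit_subset[OF p y] x by blast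
      moreover have "orbit \<pi> x = orbit \<pi> y"
        using orbit_cyclic_eq3[OF cyclic_on_orbit[OF p finite_atLeastAtMost] x] .
      ultimately show "x \<in> {x \<in> {1..n}. orbit \<pi> x = orbit \<pi> y}" by blast
    qed
  qed
  have "fixes_count n (\<pi> ^^ i) = (\<Sum>x\<in>{1..n}. if card (orbit \<pi> x) dvd i then 1 else 0)"
    by (simp add: fixes_count_def fixed sum.If_cases Int_def)
  also have "\<dots> = (\<Sum>C\<in>orbit \<pi> ` {1..n}. \<Sum>x | x \<in> {1..n} \<and> orbit \<pi> x = C. if card (orbit \<pi> x) dvd i then 1 else 0)"
    by (rule sum.group[symmetric]) auto
  also have "\<dots> = (\<Sum>C\<in>orbit \<pi> ` {1..n}. if card C dvd i then card C else 0)"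
  proof (rule sum.cong[OF refl])
    fix C assume "C \<in> orbit \<pi> ` {1..n}"
    then obtain y where y: "y \<in> {1..n}" "C = orbit \<pi> y" by blast
    have "(\<Sum>x | x \<in> {1..n} \<and> orbit \<pi> x = C. if card (orbit \<pi> x) dvd i then 1 else 0 :: nat) =
       (\<Sum>x | x \<in> {1..n} \<and> orbit \<pi> x = C. if card C dvd i then 1 else 0)"
      by (rule sum.cong) auto
    also have "\<dots> = (if card C dvd i then card C else 0)"
      unfolding y(2) using fiber[OF y(1)] by simp
    finally show "(\<Sum>x | x \<in> {1..n} \<and> orbit \<pi> x = C. if card (orbit \<pi> x) dvd i then 1 else 0) = (if card C dvd i then card C else 0)" .
  qed
  finally show ?thesis unfolding sum_list_cycle_type .
qed

lemma sum_list_cycle_type_eq: assumes "\<pi> permutes {1..n}" shows "sum_list (cycle_type n \<pi>) = n"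
proof -
  have "{x \<in> {1..n}. (\<pi> ^^ 0) x = x} = {1..n}" by auto
  then have "fixes_count n (\<pi> ^^ 0) = n" unfolding fixes_count_def by simp
  then show ?thesis using fixes_count_funpow[OF assms, of 0] by simp
qed

text \<open>\<open>Q\<close> is the image of \<open>F\<close> under the logarithmic derivative \<open>F \<mapsto> X F' / F\<close>.\<close>
definition log_deriv :: "real fps \<Rightarrow> real fps \<Rightarrow> bool" where
  "log_deriv F Q \<longleftrightarrow> fps_nth F 0 = 1 \<and> fps_X * fps_deriv F = F * Q"

lemma log_deriv_mult: "log_deriv F Q \<Longrightarrow> log_deriv G R \<Longrightarrow> log_deriv (F * G) (Q + R)"
proof -
  assume a: "log_deriv F Q" "log_deriv G R"
  have "fps_X * fps_deriv (F * G) = (fps_X * fps_deriv F) * G + F * (fps_X * fps_deriv G)"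
    by (simp add: algebra_simps)
  also have "\<dots> = F * G * (Q + R)" using a by (simp add: log_deriv_def algebra_simps)
  finally show ?thesis using a by (simp add: log_deriv_def)
qed

lemma log_deriv_1: "log_deriv 1 0" by (simp add: log_deriv_def)

lemma log_deriv_prod: "finite I \<Longrightarrow> (\<And>i. i \<in> I \<Longrightarrow> log_deriv (F i) (Q i)) \<Longrightarrow> log_deriv (\<Prod>i\<in>I. F i) (\<Sum>i\<in>I. Q i)"
  by (induction I rule: finite_induct) (auto simp: log_deriv_1 intro: log_deriv_mult)

lemma log_deriv_prod_list: "(\<And>i. i \<in> set xs \<Longrightarrow> log_deriv (F i) (Q i)) \<Longrightarrow> log_deriv (\<Prod>i\<leftarrow>xs. F i) (\<Sum>i\<leftarrow>xs. Q i)"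
  by (induction xs) (auto simp: log_deriv_1 intro: log_deriv_mult)

lemma log_deriv_power: "log_deriv F Q \<Longrightarrow> log_deriv (F ^ m) (of_nat m * Q)"
proof (induction m)
  case (Suc m)
  have "log_deriv (F * F ^ m) (Q + of_nat m * Q)" using Suc by (intro log_deriv_mult)
  then show ?case by (simp add: algebra_simps)
qed (simp add: log_deriv_1)

text \<open>The quotient of the two series has derivative zero, so it is constant, and the constant
  terms make it 1.\<close>

lemma log_deriv_unique:
  assumes F: "log_deriv F Q" and G: "log_deriv G Q" shows "F = G"
proof -
  define H where "H = F * inverse G"
  have "fps_nth G 0 \<noteq> 0" using G by (simp add: log_deriv_def)
  then have FH: "F = H * G" by (simp add: H_def mult.assoc inverse_mult_eq_1)
  have "fps_X * fps_deriv F = (fps_X * fps_deriv H) * G + H * (fps_X * fps_deriv G)"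
    unfolding FH by (simp add: algebra_simps)
  also have "H * (fps_X * fps_deriv G) = F * Q" using G by (simp add: FH log_deriv_def mult.assoc)
  finally have "(fps_X * fps_deriv H) * G = 0" using F by (simp add: log_deriv_def)
  moreover have "G \<noteq> 0" using \<open>fps_nth G 0 \<noteq> 0\<close> by auto
  ultimately have "fps_deriv H = 0" by simp
  then obtain c where c: "H = fps_const c" by (metis fps_deriv_eq_0_iff)
  have "fps_nth F 0 = c * fps_nth G 0" unfolding FH c by simp
  then have "c = 1" using F G by (simp add: log_deriv_def)
  then show ?thesis using FH c by simp
qed

text \<open>The series \<open>p X^p / (1 - X^p)\<close>, the negative of the logarithmic derivative
  of \<open>1 - X^p\<close>. The guard \<open>0 < i\<close> is essential, since every
  \<open>p\<close> divides 0.\<close>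

definition period :: "nat \<Rightarrow> real fps" where
  "period p = Abs_fps (\<lambda>i. if 0 < i \<and> p dvd i then real p else 0)"

lemma period_nth: "fps_nth (period p) i = (if 0 < i \<and> p dvd i then real p else 0)"
  by (simp add: period_def)

lemma log_deriv_one_minus_power:
  assumes p: "1 \<le> p" shows "log_deriv (1 - fps_X ^ p) (- period p)"
proof -
  have "(1 - fps_X ^ p) * period p = of_nat p * fps_X ^ p"
  proof (rule fps_ext)
    fix k
    have "fps_nth ((1 - fps_X ^ p) * period p) k = fps_nth (period p) k - (if k < p then 0 else fps_nth (period p) (k - p))"
      by (simp add: left_diff_distrib fps_X_power_mult_nth)
    also have "\<dots> = (if k = p then real p else 0)"
    proof -
      consider "k < p" | "k = p" | "p < k" by linarith
      then show ?thesis
      proof cases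
        case 1
        then have "\<not> (0 < k \<and> p dvd k)" by (auto dest: dvd_imp_le)
        then show ?thesis using 1 by (simp add: period_def)
      next
        case 2
        then show ?thesis using p by (simp add: period_def)
      next
        case 3
        then have "p dvd k \<longleftrightarrow> p dvd (k - p)" by (simp add: dvd_minus_self)
        then show ?thesis using 3 p by (simp add: period_def)
      qed
    qed
    also have "\<dots> = fps_nth (of_nat p * fps_X ^ p) k" by (simp add: fps_of_nat[symmetric])
    finally show "fps_nth ((1 - fps_X ^ p) * period p) k = fps_nth (of_nat p * fps_X ^ p) k" .
  qed
  moreover have "fps_X * fps_deriv (1 - fps_X ^ p) = - (of_nat p * fps_X ^ p :: real fps)"
    unfolding fps_mult_fps_X_deriv_shift by (rule fps_ext) (use p in \<open>simp add: fps_of_nat[symmetric]\<close>)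
  ultimately show ?thesis using p by (simp add: log_deriv_def)
qed

lemma one_minus_X_power_nonzero: "1 \<le> p \<Longrightarrow> 1 - fps_X ^ p \<noteq> (0 :: real fps)"
proof
  assume p: "1 \<le> p" and z: "1 - fps_X ^ p = (0 :: real fps)"
  have "fps_nth (1 - fps_X ^ p) 0 = (1 :: real)" using p by simp
  then show False unfolding z by simp
qed

lemma sym_poincare_nonzero: "sym_poincare p (fps_X :: real fps) \<noteq> 0"
proof (induction p)
  case 0
  then show ?case by (simp add: sym_poincare_0)
next
  case (Suc p)
  have "(1 - fps_X) * sym_poincare (Suc p) (fps_X :: real fps) \<noteq> 0"
    unfolding sym_poincare_Suc using Suc one_minus_X_power_nonzero[of "Suc p"] by simp
  then show ?case by auto
qed

section \<open>Generating functions of traces and characters\<close>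

context based_roots begin

definition sym_gf :: "('a \<Rightarrow> 'a) \<Rightarrow> real fps" where
  "sym_gf v = Abs_fps (\<lambda>k. sym_trace k v)"

definition char_gf :: "('a \<Rightarrow> 'a) \<Rightarrow> real fps" where
  "char_gf v = Abs_fps (\<lambda>k. coinvariant_character \<Phi> k v)"

definition inv_gf :: "real fps" where "inv_gf = Abs_fps (\<lambda>d. real (card (inv_basis d)))"

lemma sym_gf_factor: "v \<in> WG \<Longrightarrow> sym_gf v = inv_gf * char_gf v"
proof (rule fps_ext)
  fix k assume v: "v \<in> WG"
  have "fps_nth (inv_gf * char_gf v) k = fps_nth (char_gf v * inv_gf) k" by (simp add: mult.commute)
  also have "\<dots> = (\<Sum>m\<le>k. coinvariant_character \<Phi> m v * card (inv_basis (k - m)))"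
    by (simp add: fps_mult_nth char_gf_def inv_gf_def atMost_atLeast0)
  finally show "fps_nth (sym_gf v) k = fps_nth (inv_gf * char_gf v) k"
    using sym_trace_eq[OF v] by (simp add: sym_gf_def mult.commute)
qed

lemma inv_gf_nonzero: "inv_gf \<noteq> 0"
proof
  assume "inv_gf = 0"
  then have "fps_nth inv_gf 0 = 0" by simp
  then show False using card_inv_basis_0 by (simp add: inv_gf_def)
qed

text \<open>The constant coefficient is 0 because \<open>X F' / F\<close> has no constant
  term.\<close>

definition trace_gf :: "('a \<Rightarrow> 'a) \<Rightarrow> real fps" where
  "trace_gf v = Abs_fps (\<lambda>i. if i = 0 then 0 else vtrace (v ^^ i))"

text \<open>Newton's identities, read as an equation between power series.\<close>

lemma log_deriv_sym_gf: assumes v: "v \<in> WG" shows "log_deriv (sym_gf v) (trace_gf v)"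
proof -
  have "fps_nth (fps_X * fps_deriv (sym_gf v)) k = fps_nth (sym_gf v * trace_gf v) k" for k
  proof -
    have "fps_nth (sym_gf v * trace_gf v) k = (\<Sum>i\<in>{0..k}. sym_trace i v * (if k - i = 0 then 0 else vtrace (v ^^ (k - i))))"
      by (simp add: fps_mult_nth sym_gf_def trace_gf_def)
    also have "\<dots> = (\<Sum>i<k. sym_trace i v * vtrace (v ^^ (k - i)))"
      by (rule sum.mono_neutral_cong_right) auto
    also have "\<dots> = (\<Sum>j<k. vtrace (v ^^ Suc j) * sym_trace (k - 1 - j) v)"
    proof (rule sum.reindex_bij_witness[of _ "\<lambda>j. k - 1 - j" "\<lambda>j. k - 1 - j"])
      fix i assume "i \<in> {..<k}"
      then have "Suc (k - 1 - i) = k - i" "k - 1 - (k - 1 - i) = i" by auto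
      then show "vtrace (v ^^ Suc (k - 1 - i)) * sym_trace (k - 1 - (k - 1 - i)) v = sym_trace i v * vtrace (v ^^ (k - i))"
        by (metis mult.commute)
    qed auto
    finally show ?thesis using newton[OF v, of k] by (simp add: fps_mult_fps_X_deriv_shift sym_gf_def)
  qed
  then show ?thesis using sym_trace_0[OF v] by (auto simp: log_deriv_def sym_gf_def intro: fps_ext)
qed

lemma char_gf_id: "char_gf id = (\<Sum>w\<in>WG. fps_X ^ len w)"
proof (rule fps_ext)
  fix k
  have "fps_nth (\<Sum>w\<in>WG. fps_X ^ len w :: real fps) k = (\<Sum>w\<in>WG. if len w = k then 1 else 0)"
    by (auto simp: fps_sum_nth intro!: sum.cong)
  also have "\<dots> = real (card {w \<in> WG. len w = k})"
    using finite_WG by (simp add: sum.If_cases Int_def)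
  finally show "fps_nth (char_gf id) k = fps_nth (\<Sum>w\<in>WG. fps_X ^ len w) k"
    by (simp add: char_gf_def coinvariant_character_id)
qed

lemma trace_gf_id: "trace_gf id = of_nat (card \<Delta>) * period 1"
proof (rule fps_ext)
  fix i
  have "vtrace id = real (card \<Delta>)"
    unfolding vtrace_base[OF WG_id] by (simp add: coeff_simple)
  moreover have "(id :: 'a \<Rightarrow> 'a) ^^ i = id" by (induction i) auto
  ultimately show "fps_nth (trace_gf id) i = fps_nth (of_nat (card \<Delta>) * period 1) i"
    by (simp add: trace_gf_def period_def fps_of_nat[symmetric])
qed

end

context type_A_parabolic begin

context
  fixes v :: "'a \<Rightarrow> 'a" and \<mu> :: "nat \<Rightarrow> nat list"
  assumes v: "v \<in> H" and \<mu>: "\<And>j. j \<in> {1..r} \<Longrightarrow> cycle_type (n j) (\<psi> v j) = \<mu> j"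
begin

lemma mu_pos: "j \<in> {1..r} \<Longrightarrow> p \<in> set (\<mu> j) \<Longrightarrow> 1 \<le> p"
  using cycle_type_positive[OF psi_permutes[OF v]] \<mu> by metis

lemma sum_list_mu: "j \<in> {1..r} \<Longrightarrow> sum_list (\<mu> j) = n j"
  using sum_list_cycle_type_eq[OF psi_permutes[OF v]] \<mu> by metis

text \<open>The fixed points of the powers of a cycle of length \<open>p\<close> have generating
  function \<open>period p\<close>; everything else in the trace agrees with the identity up to
  multiples of \<open>period 1\<close>.\<close>

lemma trace_gf_H:
  "trace_gf v = of_nat (card \<Delta>) * period 1 + (\<Sum>j\<in>{1..r}. (\<Sum>p\<leftarrow>\<mu> j. period p) - of_nat (n j) * period 1)"
proof (rule fps_ext)
  fix i
  have lst: "fps_nth (\<Sum>p\<leftarrow>xs. period p) i = (\<Sum>p\<leftarrow>xs. if 0 < i \<and> p dvd i then real p else 0)" for xs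
    by (induction xs) (simp_all add: period_nth)
  show "fps_nth (trace_gf v) i = fps_nth (of_nat (card \<Delta>) * period 1 + (\<Sum>j\<in>{1..r}. (\<Sum>p\<leftarrow>\<mu> j. period p) - of_nat (n j) * period 1)) i"
  proof (cases "i = 0")
    case True
    then show ?thesis using lst[unfolded True] by (simp add: trace_gf_def fps_sum_nth period_nth fps_of_nat[symmetric])
  next
    case False
    have vi: "v ^^ i \<in> H" "\<And>j. j \<in> {1..r} \<Longrightarrow> \<psi> (v ^^ i) j = \<psi> v j ^^ i" using psi_funpow[OF v] by blast+
    have "real (fixes_count (n j) (\<psi> (v ^^ i) j)) = fps_nth (\<Sum>p\<leftarrow>\<mu> j. period p) i" if j: "j \<in> {1..r}" for j
    proof -
      have "real (\<Sum>p\<leftarrow>xs. if p dvd i then p else 0) = (\<Sum>p\<leftarrow>xs. if p dvd i then real p else 0)" for xs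
        by (induction xs) auto
      then show ?thesis
        unfolding vi(2)[OF j] fixes_count_funpow[OF psi_permutes[OF v j]] \<mu>[OF j] lst using False by simp
    qed
    then have "vtrace (v ^^ i) = real (card \<Delta>) + (\<Sum>j\<in>{1..r}. fps_nth (\<Sum>p\<leftarrow>\<mu> j. period p) i - real (n j))"
      unfolding vtrace_H[OF vi(1)] by simp
    then show ?thesis using False
      by (simp add: trace_gf_def fps_sum_nth period_nth fps_of_nat[symmetric])
  qed
qed

text \<open>The graded traces of \<open>v\<close> and of the identity, multiplied by the indicated
  factors, have the same logarithmic derivative and therefore coincide. The Hilbert series of the
  invariants is then cancelled, and the character series of the identity is the Poincare
  polynomial.\<close>

lemma char_gf_H:
  "char_gf v * (\<Prod>j\<in>{1..r}. \<Prod>p\<leftarrow>\<mu> j. 1 - fps_X ^ p) = (\<Sum>w\<in>WG. fps_X ^ len w) * (1 - fps_X) ^ (\<Sum>j\<in>{1..r}. n j)"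
proof -
  let ?P = "\<Prod>j\<in>{1..r}. \<Prod>p\<leftarrow>\<mu> j. 1 - fps_X ^ p :: real fps"
  let ?m = "\<Sum>j\<in>{1..r}. n j"
  have P: "log_deriv ?P (\<Sum>j\<in>{1..r}. \<Sum>p\<leftarrow>\<mu> j. - period p)"
    by (intro log_deriv_prod log_deriv_prod_list log_deriv_one_minus_power mu_pos) auto
  have neg: "(\<Sum>p\<leftarrow>xs. - period p) = - (\<Sum>p\<leftarrow>xs. period p)" for xs
    by (induction xs) auto
  have "log_deriv (sym_gf v * ?P) (trace_gf v + (\<Sum>j\<in>{1..r}. \<Sum>p\<leftarrow>\<mu> j. - period p))"
    by (rule log_deriv_mult[OF log_deriv_sym_gf[OF H_WG[OF v]] P])
  also have "trace_gf v + (\<Sum>j\<in>{1..r}. \<Sum>p\<leftarrow>\<mu> j. - period p) = trace_gf id + of_nat ?m * (- period 1)"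
    unfolding trace_gf_H trace_gf_id neg by (simp add: sum_subtractf sum_negf sum_distrib_right)
  finally have L: "log_deriv (sym_gf v * ?P) (trace_gf id + of_nat ?m * (- period 1))" .
  have "log_deriv (1 - fps_X) (- period 1)" using log_deriv_one_minus_power[of 1] by simp
  then have "log_deriv ((1 - fps_X) ^ ?m) (of_nat ?m * (- period 1))" by (rule log_deriv_power)
  then have R: "log_deriv (sym_gf id * (1 - fps_X) ^ ?m) (trace_gf id + of_nat ?m * (- period 1))"
    by (intro log_deriv_mult log_deriv_sym_gf[OF WG_id])
  have "sym_gf v * ?P = sym_gf id * (1 - fps_X) ^ ?m" by (rule log_deriv_unique[OF L R])
  then have "inv_gf * (char_gf v * ?P) = inv_gf * (char_gf id * (1 - fps_X) ^ ?m)"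
    unfolding sym_gf_factor[OF H_WG[OF v]] sym_gf_factor[OF WG_id] by (simp only: mult.assoc)
  then show ?thesis using inv_gf_nonzero unfolding char_gf_id by simp
qed

definition weight_gf :: "real fps" where
  "weight_gf = (\<Sum>w\<in>WG. fps_X ^ len w * of_int (weyl_weight (reflection ` \<Delta>) H \<psi> r \<mu> w))"

text \<open>The right-hand side is the one of \<open>char_gf_H\<close>. The Poincare polynomials of
  the symmetric factors enter from the cosets of \<open>H\<close> and again from
  \<open>sym_weight_sum\<close>, and they cancel.\<close>

lemma weight_gf_eq:
  "weight_gf * (\<Prod>j\<in>{1..r}. \<Prod>p\<leftarrow>\<mu> j. 1 - fps_X ^ p) = (\<Sum>w\<in>WG. fps_X ^ len w) * (1 - fps_X) ^ (\<Sum>j\<in>{1..r}. n j)"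
proof -
  let ?P = "\<lambda>j. \<Prod>p\<leftarrow>\<mu> j. 1 - fps_X ^ p :: real fps"
  let ?Z = "\<lambda>j. \<Sum>\<pi> | \<pi> permutes {1..n j}. fps_X ^ invs (n j) \<pi> * of_int (sym_weight (\<mu> j) \<pi>) :: real fps"
  let ?S = "\<Prod>j\<in>{1..r}. sym_poincare (n j) (fps_X :: real fps)" and ?W = "\<Sum>w\<in>WG. fps_X ^ len w :: real fps"
  have Z: "?Z j * ?P j = (1 - fps_X) ^ n j * sym_poincare (n j) fps_X" if j: "j \<in> {1..r}" for j
    using sym_weight_sum[of "fps_X :: real fps" "\<mu> j", OF sym_poincare_nonzero mu_pos[OF j]]
    unfolding sum_list_mu[OF j] by simp
  have "(weight_gf * (\<Prod>j\<in>{1..r}. ?P j)) * ?S = (weight_gf * ?S) * (\<Prod>j\<in>{1..r}. ?P j)" by (simp only: mult_ac)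
  also have "\<dots> = ?W * ((\<Prod>j\<in>{1..r}. ?Z j) * (\<Prod>j\<in>{1..r}. ?P j))"
    unfolding weight_gf_def weyl_weight_factorization by (simp only: mult_ac)
  also have "(\<Prod>j\<in>{1..r}. ?Z j) * (\<Prod>j\<in>{1..r}. ?P j) = (\<Prod>j\<in>{1..r}. (1 - fps_X) ^ n j * sym_poincare (n j) fps_X)"
    unfolding prod.distrib[symmetric] by (intro prod.cong refl Z)
  also have "\<dots> = (1 - fps_X) ^ (\<Sum>j\<in>{1..r}. n j) * ?S" by (simp add: prod.distrib power_sum)
  finally have "(weight_gf * (\<Prod>j\<in>{1..r}. ?P j)) * ?S = (?W * (1 - fps_X) ^ (\<Sum>j\<in>{1..r}. n j)) * ?S"
    by (simp only: mult.assoc)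
  moreover have "?S \<noteq> 0" using sym_poincare_nonzero by simp
  ultimately show ?thesis by simp
qed

lemma char_gf_eq_weight_gf: "char_gf v = weight_gf"
proof -
  let ?P = "\<Prod>j\<in>{1..r}. \<Prod>p\<leftarrow>\<mu> j. 1 - fps_X ^ p :: real fps"
  have "(\<Prod>p\<leftarrow>xs. 1 - fps_X ^ p :: real fps) \<noteq> 0" if "\<And>p. p \<in> set xs \<Longrightarrow> 1 \<le> p" for xs
    using that one_minus_X_power_nonzero by (induction xs) auto
  then have "?P \<noteq> 0" using mu_pos by simp
  moreover have "char_gf v * ?P = weight_gf * ?P" unfolding char_gf_H weight_gf_eq ..
  ultimately show ?thesis by simp
qed

lemma coinvariant_character_weights:
  "coinvariant_character \<Phi> k v = of_int (\<Sum>w | w \<in> WG \<and> len w = k. weyl_weight (reflection ` \<Delta>) H \<psi> r \<mu> w)"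
proof -
  have "coinvariant_character \<Phi> k v = fps_nth weight_gf k"
    unfolding char_gf_eq_weight_gf[symmetric] by (simp add: char_gf_def)
  also have "\<dots> = (\<Sum>w\<in>WG. if len w = k then of_int (weyl_weight (reflection ` \<Delta>) H \<psi> r \<mu> w) else 0)"
    unfolding weight_gf_def fps_sum_nth
    by (intro sum.cong refl) (simp add: fps_X_power_mult_nth fps_of_int[symmetric])
  also have "\<dots> = of_int (\<Sum>w | w \<in> WG \<and> len w = k. weyl_weight (reflection ` \<Delta>) H \<psi> r \<mu> w)"
    unfolding of_int_sum by (rule sum.inter_filter[symmetric, OF finite_WG])
  finally show ?thesis .
qed

end
end

theorem theorem4:
  fixes \<Phi> \<Delta> J :: "'a::euclidean_space set"
    and W S H :: "('a \<Rightarrow> 'a) set"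
    and r k :: nat
    and n :: "nat \<Rightarrow> nat"
    and \<psi> :: "('a \<Rightarrow> 'a) \<Rightarrow> nat \<Rightarrow> nat \<Rightarrow> nat"
    and \<mu> :: "nat \<Rightarrow> nat list"
    and v :: "'a \<Rightarrow> 'a"
  assumes "root_system \<Phi>" and "root_base \<Phi> \<Delta>"
    and "W = weyl_group \<Phi>" and "S = reflection ` \<Delta>"
    and "J \<subseteq> \<Delta>" and "H = generated_group (reflection ` J)"
    and "\<psi> \<in> iso (comp_group H) (product_group {1..r} (\<lambda>j. sym_group (n j)))"
    and "\<psi> ` (reflection ` J) = product_adjacent_transpositions r n"
    and "v \<in> H" and "\<forall>j\<in>{1..r}. cycle_type (n j) (\<psi> v j) = \<mu> j"
  shows "coinvariant_character \<Phi> k v =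
    of_int (\<Sum>w\<in>{w \<in> W. word_length S w = k}. weyl_weight S H \<psi> r \<mu> w)"
proof -
  interpret type_A_parabolic \<Phi> \<Delta> J r n \<psi>
    using assms by unfold_locales auto
  have W: "W = WG" and H: "H = generated_group (reflection ` J)" using assms weyl_group_eq by auto
  have "{w \<in> W. word_length S w = k} = {w. w \<in> WG \<and> len w = k}"
    unfolding W assms(4) using simple_word_length by (auto simp: len_def)
  then show ?thesis
    using coinvariant_character_weights[of v \<mu> k] assms(4,9,10) unfolding H H_def by simp
qed

end
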